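(* There is an algorithm that, given a 3-regular graph $G$, finds a perfect triangle-free 2-matching in $G$ in linear time (that is, in $O(n)$ time, where $n = |VG|$).
   Context: Graphs are finite, undirected, without loops and parallel edges; $VG$ and $EG$ denote the node and edge sets of $G$. A graph is 3-regular if all its nodes have degree 3. A 2-matching in $G$ is a function $x\colon EG \to \{0,1,2\}$ such that for each node $v \in VG$ the sum of the values $x(e)$ over all edges $e$ incident to $v$ does not exceed $2$. Its size is $\|x\| := \sum_{e \in EG} x(e)$, and $x$ is perfect if $\|x\| = |VG|$. A 2-matching is basic if the set $\{e : x(e) = 1\}$ partitions into a collection of node-disjoint circuits of odd length; by convention only basic 2-matchings are considered. A 2-matching $x$ is triangle-free if its support $\{e \in EG : x(e) \neq 0\}$ contains no triangle (circuit of length 3). Running time is the worst-case number of elementary operations on a standard RAM, with the graph given by adjacency lists. *)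

theory Defs
  imports Complex_Main "HOL-Library.Landau_Symbols"
begin

definition graph :: "'a set \<Rightarrow> 'a set set \<Rightarrow> bool" where
  "graph V E \<longleftrightarrow> finite V \<and> (\<forall>e\<in>E. e \<subseteq> V \<and> card e = 2)"

definition incident :: "'a set set \<Rightarrow> 'a \<Rightarrow> 'a set set" where
  "incident E v = {e \<in> E. v \<in> e}"

definition regular :: "nat \<Rightarrow> 'a set \<Rightarrow> 'a set set \<Rightarrow> bool" where
  "regular d V E \<longleftrightarrow> (\<forall>v\<in>V. card (incident E v) = d)"

definition circuit_edges :: "'a list \<Rightarrow> 'a set set" where
  "circuit_edges c = {{c ! i, c ! (Suc i mod length c)} | i. i < length c}"

definition circuit :: "'a set set \<Rightarrow> 'a list \<Rightarrow> bool" where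
  "circuit E c \<longleftrightarrow> length c \<ge> 3 \<and> distinct c \<and> circuit_edges c \<subseteq> E"

text \<open>Only the values of \<open>x\<close> on \<open>E\<close> matter in the following notions.\<close>

definition two_matching :: "'a set \<Rightarrow> 'a set set \<Rightarrow> ('a set \<Rightarrow> nat) \<Rightarrow> bool" where
  "two_matching V E x \<longleftrightarrow>
     (\<forall>e\<in>E. x e \<in> {0, 1, 2}) \<and> (\<forall>v\<in>V. (\<Sum>e\<in>incident E v. x e) \<le> 2)"

definition perfect :: "'a set \<Rightarrow> 'a set set \<Rightarrow> ('a set \<Rightarrow> nat) \<Rightarrow> bool" where
  "perfect V E x \<longleftrightarrow> (\<Sum>e\<in>E. x e) = card V"

definition basic :: "'a set set \<Rightarrow> ('a set \<Rightarrow> nat) \<Rightarrow> bool" where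
  "basic E x \<longleftrightarrow>
     (\<exists>\<C>. (\<forall>c\<in>\<C>. circuit E c \<and> odd (length c)) \<and>
          (\<forall>c\<in>\<C>. \<forall>d\<in>\<C>. c \<noteq> d \<longrightarrow> set c \<inter> set d = {}) \<and>
          {e \<in> E. x e = 1} = (\<Union>c\<in>\<C>. circuit_edges c))"

definition triangle_free :: "'a set set \<Rightarrow> ('a set \<Rightarrow> nat) \<Rightarrow> bool" where
  "triangle_free E x \<longleftrightarrow> \<not> (\<exists>c. circuit {e \<in> E. x e \<noteq> 0} c \<and> length c = 3)"

text \<open>
  A unit-cost RAM: a fixed program, registers (a program mentions only finitely many of them),
  and a memory accessed indirectly through registers. The arithmetic instructions are addition
  and truncated subtraction. Words are natural numbers below a bound \<open>W\<close>; an instruction that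
  would produce a value \<open>\<ge> W\<close> is a fault and blocks the machine, so that unit cost cannot be
  exploited by computing with very long numbers.
\<close>

datatype instr =
    Const nat nat
  | Add nat nat nat
  | Sub nat nat nat
  | Load nat nat
  | Store nat nat
  | Jump nat
  | JumpZero nat nat
  | Halt

record config =
  pc :: nat
  reg :: "nat \<Rightarrow> nat"
  mem :: "nat \<Rightarrow> nat"

definition set_reg :: "nat \<Rightarrow> nat \<Rightarrow> nat \<Rightarrow> config \<Rightarrow> config option" where
  "set_reg W r a s =
     (if a < W then Some (s\<lparr>pc := Suc (pc s), reg := (reg s)(r := a)\<rparr>) else None)"

fun exec :: "nat \<Rightarrow> instr \<Rightarrow> config \<Rightarrow> config option" where
  "exec W (Const r k) s = set_reg W r k s"
| "exec W (Add r i j) s = set_reg W r (reg s i + reg s j) s"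
| "exec W (Sub r i j) s = set_reg W r (reg s i - reg s j) s"
| "exec W (Load r i) s = set_reg W r (mem s (reg s i)) s"
| "exec W (Store r i) s =
     Some (s\<lparr>pc := Suc (pc s), mem := (mem s)(reg s r := reg s i)\<rparr>)"
| "exec W (Jump l) s = Some (s\<lparr>pc := l\<rparr>)"
| "exec W (JumpZero r l) s = Some (s\<lparr>pc := (if reg s r = 0 then l else Suc (pc s))\<rparr>)"
| "exec W Halt s = None"

definition step :: "nat \<Rightarrow> instr list \<Rightarrow> config \<Rightarrow> config option" where
  "step W P s = (if pc s < length P then exec W (P ! pc s) s else None)"

primrec run :: "nat \<Rightarrow> instr list \<Rightarrow> nat \<Rightarrow> config \<Rightarrow> config option" where
  "run W P 0 s = Some s"
| "run W P (Suc k) s = Option.bind (step W P s) (run W P k)"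

definition halted :: "instr list \<Rightarrow> config \<Rightarrow> bool" where
  "halted P s \<longleftrightarrow> pc s < length P \<and> P ! pc s = Halt"

definition halts_within :: "nat \<Rightarrow> instr list \<Rightarrow> nat \<Rightarrow> config \<Rightarrow> config \<Rightarrow> bool" where
  "halts_within W P t s s' \<longleftrightarrow> (\<exists>k\<le>t. run W P k s = Some s' \<and> halted P s')"

definition adjacency_lists :: "nat set \<Rightarrow> nat set set \<Rightarrow> nat list list \<Rightarrow> bool" where
  "adjacency_lists V E adj \<longleftrightarrow> V = {..<length adj} \<and>
     (\<forall>v\<in>V. distinct (adj ! v) \<and> set (adj ! v) = {u. {v, u} \<in> E})"

text \<open>
  With \<open>n\<close> nodes, the memory initially contains \<open>n\<close> at address \<open>0\<close>, at address \<open>1 + v\<close>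
  (\<open>v \<le> n\<close>) the address where the adjacency list of \<open>v\<close> starts, which for \<open>v > 0\<close> is also the
  address just behind the list of \<open>v - 1\<close>, and from address \<open>n + 2\<close> on the adjacency lists, one
  after the other. \<open>list_pos adj v\<close> is the position of the list of \<open>v\<close> in their concatenation.
\<close>

definition list_pos :: "nat list list \<Rightarrow> nat \<Rightarrow> nat" where
  "list_pos adj v = (\<Sum>u<v. length (adj ! u))"

definition encode :: "nat list list \<Rightarrow> nat list" where
  "encode adj = length adj #
     map (\<lambda>v. length adj + 2 + list_pos adj v) [0..<Suc (length adj)] @ concat adj"

definition initial :: "nat list list \<Rightarrow> config" where
  "initial adj = \<lparr>pc = 0, reg = (\<lambda>_. 0),
     mem = (\<lambda>a. if a < length (encode adj) then encode adj ! a else 0)\<rparr>"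

text \<open>
  On termination, register \<open>0\<close> holds the start address of an array parallel to the concatenated
  adjacency lists, which gives for each entry \<open>u\<close> in the list of \<open>v\<close> the value of the edge
  \<open>{v, u}\<close>.
\<close>

definition outputs :: "nat list list \<Rightarrow> config \<Rightarrow> (nat set \<Rightarrow> nat) \<Rightarrow> bool" where
  "outputs adj s x \<longleftrightarrow>
     (\<forall>v<length adj. \<forall>i<length (adj ! v).
        mem s (reg s 0 + list_pos adj v + i) = x {v, adj ! v ! i})"

end

theory Submission
  imports Defs "HOL-Combinatorics.Permutations"
begin

text \<open>
  A permutation \<open>p\<close> of the nodes that moves every node to a neighbour and has no cycle of length 3
  yields the required 2-matching: odd cycles of \<open>p\<close> become circuits of value 1, and on even cycles
  (including those of length 2) every other edge \<open>{v, p v}\<close> gets value 2. To avoid cycles of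
  length 3, contract a maximal family of disjoint triangles. In the contracted cubic multigraph a
  permutation of this kind is a perfect matching of the bipartite double cover, which is found by
  Schrijver's method: give every edge weight 1, walk along edges of weight 1 or 2 until a circuit
  closes, and add \<open>\<plusminus>1\<close> alternately along the circuit, with the sign for which the sum of
  the squared weights grows by at least the length of the circuit; this sum is linearly bounded, and
  in the end all weights are 0 or 3. A cycle passing through a contracted triangle is rerouted
  through all three of its nodes; if it enters and leaves at the same node, the other two nodes
  are swapped. So no triangle can become a cycle.
\<close>

section \<open>A while language and its compilation to the RAM\<close>

text \<open>The double cover is the source of the linear time bound: a matching of the cubic graph
  itself calls for augmenting paths or blossoms, while in a bipartite cubic multigraph cancelling
  circuits alone ends in a perfect matching. The total is linear because nothing is done twice. When
  a circuit closes, only the circuit is cut off and the older part of the walk stays; and an edge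
  whose weight has become 0 or 3 never changes again, so the search for a start never goes back.

  Contracting once is enough, although the contracted graph may have parallel edges and new
  triangles. A cycle of length 3 of the final permutation would be a triangle of the graph, so by
  maximality it would meet a contracted triangle. But every node of a contracted triangle has only
  one edge that leaves the triangle. A cycle that enters and leaves at the same node therefore uses
  one edge in both directions and has length 2; any other cycle that enters contains all three nodes
  and at least one further node.\<close>

text \<open>
  Variables are unbounded in number and memory is split into 16 fields indexed by naturals; field 0
  is the part of the RAM memory below \<open>D\<close> that holds the input. Costs count loop iterations only,
  since the number of RAM steps between two iterations is bounded by the program size. There is no
  addition: every assignment exceeds the values present before by at most a constant, so the word
  bound follows from the running time.
\<close>

datatype exp = Nm nat | Vr nat | Sc exp | Sb exp exp | Df exp exp | Ld nat exp

datatype com =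
    Skip
  | Asg nat exp
  | Sto nat exp exp
  | Seq com com  (infixr ";;" 60)
  | Cond exp com com
  | While exp com

record state =
  rg :: "nat \<Rightarrow> nat"
  fd :: "nat \<Rightarrow> nat \<Rightarrow> nat"

text \<open>\<open>Df\<close> is there for conditions, where it tests whether its arguments
  differ.\<close>

primrec ev :: "exp \<Rightarrow> state \<Rightarrow> nat" where
  "ev (Nm k) s = k"
| "ev (Vr x) s = rg s x"
| "ev (Sc e) s = Suc (ev e s)"
| "ev (Sb a b) s = ev a s - ev b s"
| "ev (Df a b) s = (ev a s - ev b s) + (ev b s - ev a s)"
| "ev (Ld k e) s = fd s k (ev e s)"

text \<open>An access to field 0 at or above \<open>D\<close> would hit the cells of the other
  fields, which are interleaved there.\<close>

primrec ok :: "nat \<Rightarrow> exp \<Rightarrow> state \<Rightarrow> bool" where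
  "ok D (Nm k) s = True"
| "ok D (Vr x) s = True"
| "ok D (Sc e) s = ok D e s"
| "ok D (Sb a b) s = (ok D a s \<and> ok D b s)"
| "ok D (Df a b) s = (ok D a s \<and> ok D b s)"
| "ok D (Ld k e) s = (ok D e s \<and> k < 16 \<and> (k = 0 \<longrightarrow> ev e s < D))"

definition set_var :: "nat \<Rightarrow> nat \<Rightarrow> state \<Rightarrow> state" where
  "set_var x a s = s\<lparr>rg := (rg s)(x := a)\<rparr>"

definition set_fld :: "nat \<Rightarrow> nat \<Rightarrow> nat \<Rightarrow> state \<Rightarrow> state" where
  "set_fld k p a s = s\<lparr>fd := (fd s)(k := (fd s k)(p := a))\<rparr>"

lemma set_var_simps [simp]:
  "rg (set_var x a s) = (rg s)(x := a)" "fd (set_var x a s) = fd s"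
  "rg (set_fld k p a s) = rg s" "fd (set_fld k p a s) = (fd s)(k := (fd s k)(p := a))"
  by (simp_all add: set_var_def set_fld_def)

inductive big :: "nat \<Rightarrow> com \<Rightarrow> state \<Rightarrow> nat \<Rightarrow> state \<Rightarrow> bool" for D where
  Skip: "big D Skip s 0 s"
| Asg: "ok D e s \<Longrightarrow> big D (Asg x e) s 0 (set_var x (ev e s) s)"
| Sto: "ok D (Ld k a) s \<Longrightarrow> ok D e s \<Longrightarrow> big D (Sto k a e) s 0 (set_fld k (ev a s) (ev e s) s)"
| Seq: "big D c s t s' \<Longrightarrow> big D d s' t' s'' \<Longrightarrow> big D (c ;; d) s (t + t') s''"
| CondT: "ok D e s \<Longrightarrow> ev e s \<noteq> 0 \<Longrightarrow> big D c s t s' \<Longrightarrow> big D (Cond e c d) s t s'"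
| CondF: "ok D e s \<Longrightarrow> ev e s = 0 \<Longrightarrow> big D d s t s' \<Longrightarrow> big D (Cond e c d) s t s'"
| WhileF: "ok D e s \<Longrightarrow> ev e s = 0 \<Longrightarrow> big D (While e c) s 0 s"
| WhileT: "ok D e s \<Longrightarrow> ev e s \<noteq> 0 \<Longrightarrow> big D c s t s' \<Longrightarrow> big D (While e c) s' t' s'' \<Longrightarrow>
    big D (While e c) s (Suc (t + t')) s''"

section \<open>Code generation\<close>

abbreviation tmp :: "nat \<Rightarrow> nat" where "tmp d \<equiv> 2 * d + 3"

text \<open>Four doublings multiply by 16, the number of fields; register 1 supplies
  \<open>D\<close>.\<close>

definition addr :: "nat \<Rightarrow> nat \<Rightarrow> instr list" where
  "addr d k = (if k = 0 then [] else
     [Add (tmp d) (tmp d) (tmp d), Add (tmp d) (tmp d) (tmp d),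
      Add (tmp d) (tmp d) (tmp d), Add (tmp d) (tmp d) (tmp d),
      Const (tmp (Suc d)) k, Add (tmp d) (tmp d) (tmp (Suc d)), Add (tmp d) (tmp d) 1])"

text \<open>The machine has no move instruction, so a variable is copied by adding it to 0. The
  depth \<open>d\<close> selects the temporary register, so that operands evaluated earlier
  survive.\<close>

primrec ce :: "nat \<Rightarrow> exp \<Rightarrow> instr list" where
  "ce d (Nm k) = [Const (tmp d) k]"
| "ce d (Vr x) = [Const (tmp d) 0, Add (tmp d) (tmp d) (2 * x)]"
| "ce d (Sc e) = ce d e @ [Const (tmp (Suc d)) 1, Add (tmp d) (tmp d) (tmp (Suc d))]"
| "ce d (Sb a b) = ce d a @ ce (Suc d) b @ [Sub (tmp d) (tmp d) (tmp (Suc d))]"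
| "ce d (Df a b) = ce d a @ ce (Suc d) b @
     [Sub (tmp (Suc (Suc d))) (tmp d) (tmp (Suc d)), Sub (tmp (Suc d)) (tmp (Suc d)) (tmp d),
      Add (tmp d) (tmp (Suc d)) (tmp (Suc (Suc d)))]"
| "ce d (Ld k e) = ce d e @ addr d k @ [Load (tmp d) (tmp d)]"

primrec sz :: "com \<Rightarrow> nat" where
  "sz Skip = 0"
| "sz (Asg x e) = length (ce 0 e) + 2"
| "sz (Sto k a e) = length (ce 0 a) + length (addr 0 k) + length (ce 1 e) + 1"
| "sz (c ;; d) = sz c + sz d"
| "sz (Cond e c d) = length (ce 0 e) + sz c + sz d + 2"
| "sz (While e c) = length (ce 0 e) + sz c + 2"

primrec cc :: "nat \<Rightarrow> com \<Rightarrow> instr list" where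
  "cc i Skip = []"
| "cc i (Asg x e) = ce 0 e @ [Const (2 * x) 0, Add (2 * x) (2 * x) (tmp 0)]"
| "cc i (Sto k a e) = ce 0 a @ addr 0 k @ ce 1 e @ [Store (tmp 0) (tmp 1)]"
| "cc i (c ;; d) = cc i c @ cc (i + sz c) d"
| "cc i (Cond e c d) = (let j = i + length (ce 0 e) + 1 in
     ce 0 e @ [JumpZero (tmp 0) (j + sz c + 1)] @ cc j c @ [Jump (j + sz c + 1 + sz d)] @
     cc (j + sz c + 1) d)"
| "cc i (While e c) = (let j = i + length (ce 0 e) + 1 in
     ce 0 e @ [JumpZero (tmp 0) (j + sz c + 1)] @ cc j c @ [Jump i])"

lemma length_cc [simp]: "length (cc i c) = sz c"
  by (induction c arbitrary: i) (simp_all add: Let_def)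

text \<open>A bound on the amount by which any value met during evaluation exceeds the values in the
  state. The bounds of both operands are added even for the two differences, so that the operands
  themselves are covered.\<close>

primrec gre :: "exp \<Rightarrow> nat" where
  "gre (Nm k) = k"
| "gre (Vr x) = 0"
| "gre (Sc e) = Suc (gre e)"
| "gre (Sb a b) = gre a + gre b"
| "gre (Df a b) = gre a + gre b"
| "gre (Ld k e) = gre e"

primrec gr :: "com \<Rightarrow> nat" where
  "gr Skip = 0"
| "gr (Asg x e) = gre e"
| "gr (Sto k a e) = gre a + gre e"
| "gr (c ;; d) = gr c + gr d"
| "gr (Cond e c d) = gre e + gr c + gr d"
| "gr (While e c) = gre e + gr c"

definition code_at :: "instr list \<Rightarrow> nat \<Rightarrow> instr list \<Rightarrow> bool" where
  "code_at P i xs \<longleftrightarrow> (\<exists>as bs. P = as @ xs @ bs \<and> length as = i)"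

lemma code_at_append:
  "code_at P i (xs @ ys) \<longleftrightarrow> code_at P i xs \<and> code_at P (i + length xs) ys"
proof
  assume "code_at P i (xs @ ys)"
  then obtain as bs where P: "P = as @ xs @ ys @ bs" "length as = i"
    by (auto simp: code_at_def)
  have "P = as @ xs @ (ys @ bs)" "P = (as @ xs) @ ys @ bs" "length (as @ xs) = i + length xs"
    using P by auto
  then show "code_at P i xs \<and> code_at P (i + length xs) ys"
    using P(2) unfolding code_at_def by blast
next
  assume "code_at P i xs \<and> code_at P (i + length xs) ys"
  then obtain as bs as' bs' where P: "P = as @ xs @ bs" "length as = i"
    "P = as' @ ys @ bs'" "length as' = i + length xs" unfolding code_at_def by blast
  have "as' = as @ xs"
    using P by (metis append_assoc append_eq_append_conv length_append)
  then show "code_at P i (xs @ ys)"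
    using P unfolding code_at_def by (metis append_assoc)
qed

lemma code_at_Cons:
  "code_at P i (x # xs) \<longleftrightarrow> i < length P \<and> P ! i = x \<and> code_at P (Suc i) xs"
proof -
  have "code_at P i [x]" if "i < length P" "P ! i = x"
  proof -
    have "P = take i P @ [x] @ drop (Suc i) P" "length (take i P) = i"
      using id_take_nth_drop[OF that(1)] that by simp_all
    then show ?thesis unfolding code_at_def by blast
  qed
  moreover have "i < length P \<and> P ! i = x" if "code_at P i [x]"
    using that by (auto simp: code_at_def)
  ultimately have "code_at P i [x] \<longleftrightarrow> i < length P \<and> P ! i = x" by blast
  then show ?thesis
    using code_at_append[of P i "[x]" xs] by simp
qed

lemma code_at_Nil: "code_at P i [] \<longleftrightarrow> i \<le> length P"
proof
  assume "i \<le> length P"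
  then have "P = take i P @ [] @ drop i P" "length (take i P) = i" by auto
  then show "code_at P i []" unfolding code_at_def by blast
qed (auto simp: code_at_def)

lemma code_at_nth_append: "code_at (as @ xs @ bs) (length as) xs"
  by (auto simp: code_at_def)

section \<open>Simulation of the while language by the compiled code\<close>

lemma run_add: "run W P (j + k) s = Option.bind (run W P j s) (run W P k)"
proof (induction j arbitrary: s)
  case (Suc j)
  then show ?case by (cases "step W P s") auto
qed simp

lemma run_trans: "run W P j s = Some s' \<Longrightarrow> run W P k s' = Some s'' \<Longrightarrow> run W P (j + k) s = Some s''"
  by (simp add: run_add)

text \<open>Variables live in the even registers, which leaves the odd ones from 3 on to
  temporaries. Variable 0 is thus register 0, where the address of the result is expected. Beyond
  the input, each block of 16 cells holds one entry of every field.\<close>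

definition rep :: "nat \<Rightarrow> state \<Rightarrow> config \<Rightarrow> bool" where
  "rep D s c \<longleftrightarrow> (\<forall>x. reg c (2 * x) = rg s x) \<and> reg c 1 = D \<and>
     (\<forall>k p. 0 < k \<and> k < 16 \<longrightarrow> mem c (D + 16 * p + k) = fd s k p) \<and>
     (\<forall>p<D. mem c p = fd s 0 p)"

definition bnd :: "nat \<Rightarrow> state \<Rightarrow> bool" where
  "bnd B s \<longleftrightarrow> (\<forall>x. rg s x \<le> B) \<and> (\<forall>k p. fd s k p \<le> B)"

lemma ev_le: "bnd B s \<Longrightarrow> ev e s \<le> B + gre e"
proof (induction e)
  case (Df a b)
  then have "ev a s \<le> B + gre a" "ev b s \<le> B + gre b" by auto
  then show ?case by simp
next
  case (Ld k e)
  then show ?case by (simp add: bnd_def trans_le_add1)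
qed (auto simp: bnd_def trans_le_add1)

text \<open>The frame of an expression at depth \<open>d\<close>: memory, variables, register 1 and
  the temporaries of the enclosing operators survive.\<close>

definition same_below :: "nat \<Rightarrow> config \<Rightarrow> config \<Rightarrow> bool" where
  "same_below d c c' \<longleftrightarrow> mem c' = mem c \<and> (\<forall>r. even r \<or> r < tmp d \<longrightarrow> reg c' r = reg c r)"

lemma rep_same_below: "rep D s c \<Longrightarrow> same_below d c c' \<Longrightarrow> rep D s c'"
  by (auto simp: rep_def same_below_def)

lemma addr_sim:
  assumes "code_at P i (addr d k)" "pc c = i" "k < 16" "reg c 1 = D"
    "reg c (tmp d) = a" "D + 16 * a + 16 < W" "16 < W"
  shows "\<exists>c'. run W P (length (addr d k)) c = Some c' \<and> pc c' = i + length (addr d k) \<and>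
    same_below d c c' \<and> reg c' (tmp d) = (if k = 0 then a else D + 16 * a + k)"
proof (cases "k = 0")
  case True
  then show ?thesis using assms by (auto simp: addr_def same_below_def)
next
  case False
  then show ?thesis using assms
    by (simp add: addr_def code_at_Cons step_def set_reg_def same_below_def
       )
qed

text \<open>No fault occurs, because every number formed is at most an address computed from a value
  below \<open>B + gre e\<close> or equal to it, and these addresses are below
  \<open>W\<close>.\<close>

lemma ce_sim:
  assumes "code_at P i (ce d e)" "pc c = i" "rep D s c" "ok D e s" "bnd B s"
    "D + 16 * (B + gre e) + 16 < W"
  shows "\<exists>c'. run W P (length (ce d e)) c = Some c' \<and> pc c' = i + length (ce d e) \<and>
    same_below d c c' \<and> reg c' (tmp d) = ev e s"
  using assms
proof (induction e arbitrary: i d c)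
  case (Nm k)
  then show ?case
    by (simp add: code_at_Cons step_def set_reg_def same_below_def)
next
  case (Vr x)
  have "rg s x \<le> B" using Vr by (simp add: bnd_def)
  moreover have "reg c (2 * x) = rg s x" using Vr by (simp add: rep_def)
  moreover have "2 * x \<noteq> tmp d" by presburger
  ultimately show ?case using Vr
    by (auto simp: code_at_Cons step_def set_reg_def same_below_def)
next
  case (Sc e)
  have *: "code_at P i (ce d e)" using Sc.prems by (simp add: code_at_append)
  then obtain c1 where c1: "run W P (length (ce d e)) c = Some c1" "pc c1 = i + length (ce d e)"
    "same_below d c c1" "reg c1 (tmp d) = ev e s"
    using Sc.IH[OF *] Sc.prems by auto
  have le: "ev e s \<le> B + gre e" using Sc.prems by (intro ev_le) auto
  have "\<exists>c'. run W P (Suc (Suc 0)) c1 = Some c' \<and> pc c' = pc c1 + 2 \<and> same_below d c1 c' \<and>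
      reg c' (tmp d) = Suc (ev e s)"
    using Sc.prems c1(2,4) le
    by (simp add: code_at_Cons code_at_append step_def set_reg_def
        same_below_def)
  then obtain c2 where "run W P (Suc (Suc 0)) c1 = Some c2" "pc c2 = pc c1 + 2" "same_below d c1 c2"
      "reg c2 (tmp d) = Suc (ev e s)" by blast
  note c2 = this
  have "run W P (length (ce d (Sc e))) c = Some c2"
    using run_trans[OF c1(1) c2(1)] by (simp add:)
  moreover have "same_below d c c2" using c1(3) c2(3) by (auto simp: same_below_def)
  ultimately show ?case using c1(2) c2 by auto
next
  case (Sb a b)
  have *: "code_at P i (ce d a)" "code_at P (i + length (ce d a)) (ce (Suc d) b)"
    using Sb.prems by (simp_all add: code_at_append)
  obtain c1 where c1: "run W P (length (ce d a)) c = Some c1" "pc c1 = i + length (ce d a)"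
    "same_below d c c1" "reg c1 (tmp d) = ev a s"
    using Sb.IH(1)[OF *(1)] Sb.prems by auto
  obtain c2 where c2: "run W P (length (ce (Suc d) b)) c1 = Some c2"
    "pc c2 = pc c1 + length (ce (Suc d) b)"
    "same_below (Suc d) c1 c2" "reg c2 (tmp (Suc d)) = ev b s"
    using Sb.IH(2)[OF *(2) c1(2) rep_same_below[OF Sb.prems(3) c1(3)]] Sb.prems c1(2) by auto
  have e2: "reg c2 (tmp d) = ev a s" using c1(4) c2(3) by (simp add: same_below_def)
  have le: "ev a s \<le> B + gre a" using Sb.prems by (intro ev_le) auto
  have "\<exists>c'. run W P 1 c2 = Some c' \<and> pc c' = pc c2 + 1 \<and> same_below d c2 c' \<and>
      reg c' (tmp d) = ev a s - ev b s"
    using Sb.prems c1(2) c2(2,4) e2 le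
    by (simp add: code_at_Cons code_at_append step_def set_reg_def
        same_below_def add.assoc)
  then obtain c3 where c3: "run W P 1 c2 = Some c3" "pc c3 = pc c2 + 1" "same_below d c2 c3"
      "reg c3 (tmp d) = ev a s - ev b s" by blast
  have "same_below d c c3"
    using c1(3) c2(3) c3(3)
    by (auto simp: same_below_def)
  moreover have "run W P (length (ce d (Sb a b))) c = Some c3"
    using run_trans[OF c1(1) run_trans[OF c2(1) c3(1)]] by (simp add: numeral_3_eq_3)
  moreover have "pc c3 = i + length (ce d (Sb a b))" using c1(2) c2(2) c3(2) by simp
  ultimately show ?case using c3(4) by auto
next
  case (Df a b)
  have *: "code_at P i (ce d a)" "code_at P (i + length (ce d a)) (ce (Suc d) b)"
    using Df.prems by (simp_all add: code_at_append)
  obtain c1 where c1: "run W P (length (ce d a)) c = Some c1" "pc c1 = i + length (ce d a)"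
    "same_below d c c1" "reg c1 (tmp d) = ev a s"
    using Df.IH(1)[OF *(1)] Df.prems by auto
  obtain c2 where c2: "run W P (length (ce (Suc d) b)) c1 = Some c2"
    "pc c2 = pc c1 + length (ce (Suc d) b)"
    "same_below (Suc d) c1 c2" "reg c2 (tmp (Suc d)) = ev b s"
    using Df.IH(2)[OF *(2) c1(2) rep_same_below[OF Df.prems(3) c1(3)]] Df.prems c1(2) by auto
  have e2: "reg c2 (tmp d) = ev a s" using c1(4) c2(3) by (simp add: same_below_def)
  have le: "ev a s \<le> B + gre a" "ev b s \<le> B + gre b" using Df.prems by (intro ev_le; auto)+
  have "\<exists>c'. run W P 3 c2 = Some c' \<and> pc c' = pc c2 + 3 \<and> same_below d c2 c' \<and>
      reg c' (tmp d) = ev (Df a b) s"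
    using Df.prems c1(2) c2(2,4) e2 le
    by (simp add: code_at_Cons code_at_append step_def set_reg_def numeral_3_eq_3
        same_below_def add.assoc)
  then obtain c3 where c3: "run W P 3 c2 = Some c3" "pc c3 = pc c2 + 3" "same_below d c2 c3"
      "reg c3 (tmp d) = ev (Df a b) s" by blast
  have "same_below d c c3"
    using c1(3) c2(3) c3(3) by (auto simp: same_below_def)
  moreover have "run W P (length (ce d (Df a b))) c = Some c3"
    using run_trans[OF c1(1) run_trans[OF c2(1) c3(1)]] by (simp add: numeral_3_eq_3)
  moreover have "pc c3 = i + length (ce d (Df a b))" using c1(2) c2(2) c3(2) by simp
  ultimately show ?case using c3(4) by auto
next
  case (Ld k e)
  have *: "code_at P i (ce d e)" "code_at P (i + length (ce d e)) (addr d k)"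
    using Ld.prems by (simp_all add: code_at_append)
  obtain c1 where c1: "run W P (length (ce d e)) c = Some c1" "pc c1 = i + length (ce d e)"
    "same_below d c c1" "reg c1 (tmp d) = ev e s"
    using Ld.IH[OF *(1)] Ld.prems by auto
  have le: "ev e s \<le> B + gre e" using Ld.prems by (intro ev_le) auto
  have r1: "rep D s c1" using rep_same_below[OF Ld.prems(3) c1(3)] .
  obtain c2 where c2: "run W P (length (addr d k)) c1 = Some c2"
    "pc c2 = pc c1 + length (addr d k)" "same_below d c1 c2"
    "reg c2 (tmp d) = (if k = 0 then ev e s else D + 16 * ev e s + k)"
    using addr_sim[OF *(2) c1(2), of D "ev e s" W] Ld.prems c1 r1 le by (auto simp: rep_def)
  have r2: "rep D s c2" using rep_same_below[OF r1 c2(3)] .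
  have m2: "mem c2 (reg c2 (tmp d)) = fd s k (ev e s)"
    using r2 Ld.prems c2(4) by (auto simp: rep_def)
  have "fd s k (ev e s) \<le> B" using Ld.prems by (simp add: bnd_def)
  then have "\<exists>c'. run W P 1 c2 = Some c' \<and> pc c' = pc c2 + 1 \<and> same_below d c2 c' \<and>
      reg c' (tmp d) = ev (Ld k e) s"
    using Ld.prems c1(2) c2(2) m2
    by (simp add: code_at_Cons code_at_append step_def set_reg_def
        same_below_def add.assoc)
  then obtain c3 where c3: "run W P 1 c2 = Some c3" "pc c3 = pc c2 + 1" "same_below d c2 c3"
      "reg c3 (tmp d) = ev (Ld k e) s" by blast
  have "same_below d c c3"
    using c1(3) c2(3) c3(3) by (auto simp: same_below_def)
  moreover have "run W P (length (ce d (Ld k e))) c = Some c3"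
    using run_trans[OF c1(1) run_trans[OF c2(1) c3(1)]] by (simp add: numeral_3_eq_3)
  moreover have "pc c3 = i + length (ce d (Ld k e))" using c1(2) c2(2) c3(2) by simp
  ultimately show ?case using c3(4) by auto
qed

lemma bnd_mono: "bnd B s \<Longrightarrow> B \<le> B' \<Longrightarrow> bnd B' s"
  by (meson bnd_def le_trans)

lemma test_sim:
  assumes "code_at P i (ce 0 e @ JumpZero (tmp 0) l # xs)" "pc c = i" "rep D s c" "ok D e s"
    "bnd B s" "D + 16 * (B + gre e) + 16 < W"
  shows "\<exists>c'. run W P (length (ce 0 e) + 1) c = Some c' \<and> rep D s c' \<and>
    pc c' = (if ev e s = 0 then l else i + length (ce 0 e) + 1)"
proof -
  have *: "code_at P i (ce 0 e)" using assms by (simp add: code_at_append)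
  obtain c1 where c1: "run W P (length (ce 0 e)) c = Some c1" "pc c1 = i + length (ce 0 e)"
    "same_below 0 c c1" "reg c1 (tmp 0) = ev e s"
    using ce_sim[OF * assms(2-6)] by auto
  have r1: "rep D s c1" using rep_same_below[OF assms(3) c1(3)] .
  have "run W P (Suc 0) c1 = Some (c1\<lparr>pc := (if ev e s = 0 then l else Suc (pc c1))\<rparr>)"
    using assms(1) c1(2,4) by (simp add: code_at_append code_at_Cons step_def)
  from run_trans[OF c1(1) this] show ?thesis
    using r1 c1(2) by (simp add: rep_def)
qed

text \<open>The \<open>t\<close> iterations cut a run into \<open>1 + t\<close> stretches, each of
  which executes an instruction of the code at most once; steps and growth of values are both
  charged per stretch. The bounds are additive: in the \<open>While\<close> case
  \<open>1 + Suc (t + t')\<close> is \<open>1 + t\<close> for the test and the body plus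
  \<open>1 + t'\<close> for the rest of the loop.\<close>

theorem cc_sim:
  assumes "big D c s t s'"
  shows "code_at P i (cc i c) \<Longrightarrow> pc cf = i \<Longrightarrow> rep D s cf \<Longrightarrow> bnd B s \<Longrightarrow>
    D + 16 * (B + gr c * (1 + t)) + 16 < W \<Longrightarrow>
    \<exists>k cf'. k \<le> sz c * (1 + t) \<and> run W P k cf = Some cf' \<and> pc cf' = i + sz c \<and>
      rep D s' cf' \<and> bnd (B + gr c * (1 + t)) s'"
  using assms
proof (induction arbitrary: i cf B rule: big.induct)
  case (Skip s)
  then show ?case by (intro exI[of _ 0] exI[of _ cf]) auto
next
  case (Asg e s x)
  have *: "code_at P i (ce 0 e)" using Asg by (simp add: code_at_append)
  obtain c1 where c1: "run W P (length (ce 0 e)) cf = Some c1" "pc c1 = i + length (ce 0 e)"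
    "same_below 0 cf c1" "reg c1 (tmp 0) = ev e s"
    using ce_sim[OF * Asg.prems(2,3) Asg.hyps Asg.prems(4), of W] Asg.prems by auto
  have r1: "rep D s c1" using rep_same_below[OF Asg.prems(3) c1(3)] .
  have le: "ev e s \<le> B + gre e" using Asg.prems by (intro ev_le) auto
  define c2 where "c2 = c1\<lparr>pc := Suc (Suc (pc c1)), reg := (reg c1)(2 * x := ev e s)\<rparr>"
  have ne: "2 * x \<noteq> 3" by presburger
  have "run W P (Suc (Suc 0)) c1 = Some c2"
    using Asg.prems(1,5) c1(2,4) le ne
    by (simp add: c2_def code_at_append code_at_Cons step_def set_reg_def)
  from run_trans[OF c1(1) this]
  have "run W P (length (ce 0 e) + 2) cf = Some c2" by (simp add: numeral_2_eq_2)
  moreover have "rep D (set_var x (ev e s) s) c2"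
    using r1 by (auto simp: rep_def c2_def)
  moreover have "bnd (B + gre e) (set_var x (ev e s) s)"
    using bnd_mono[OF Asg.prems(4), of "B + gre e"] le by (auto simp: bnd_def)
  ultimately show ?case using c1(2)
    by (intro exI[of _ "length (ce 0 e) + 2"] exI[of _ c2]) (simp add: c2_def)
next
  case (Sto k a s e)
  have *: "code_at P i (ce 0 a)" "code_at P (i + length (ce 0 a)) (addr 0 k)"
    "code_at P (i + length (ce 0 a) + length (addr 0 k)) (ce 1 e)"
    using Sto by (simp_all add: code_at_append add.assoc)
  have oks: "ok D a s" "k < 16" "k = 0 \<Longrightarrow> ev a s < D" using Sto.hyps by auto
  obtain c1 where c1: "run W P (length (ce 0 a)) cf = Some c1" "pc c1 = i + length (ce 0 a)"
    "same_below 0 cf c1" "reg c1 (tmp 0) = ev a s"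
    using ce_sim[OF *(1) Sto.prems(2,3) oks(1) Sto.prems(4), of W] Sto.prems by auto
  have r1: "rep D s c1" using rep_same_below[OF Sto.prems(3) c1(3)] .
  have le: "ev a s \<le> B + gre a" "ev e s \<le> B + gre e" using Sto.prems by (intro ev_le; auto)+
  obtain c2 where c2: "run W P (length (addr 0 k)) c1 = Some c2"
    "pc c2 = pc c1 + length (addr 0 k)" "same_below 0 c1 c2"
    "reg c2 (tmp 0) = (if k = 0 then ev a s else D + 16 * ev a s + k)"
    using addr_sim[OF *(2) c1(2), of D "ev a s" W] Sto.prems c1 r1 le oks by (auto simp: rep_def)
  have r2: "rep D s c2" using rep_same_below[OF r1 c2(3)] .
  obtain c3 where c3: "run W P (length (ce 1 e)) c2 = Some c3"
    "pc c3 = pc c2 + length (ce 1 e)" "same_below 1 c2 c3" "reg c3 (tmp 1) = ev e s"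
    using ce_sim[OF *(3) _ r2 Sto.hyps(2) Sto.prems(4), of W] Sto.prems(5) c1(2) c2(2) by auto
  have r3: "rep D s c3"
    by (rule rep_same_below[OF r2 c3(3)])
  define A where "A = (if k = 0 then ev a s else D + 16 * ev a s + k)"
  have A: "reg c3 (tmp 0) = A" using c2(4) c3(3) by (simp add: same_below_def A_def)
  define c4 where "c4 = c3\<lparr>pc := Suc (pc c3), mem := (mem c3)(A := ev e s)\<rparr>"
  have "run W P (Suc 0) c3 = Some c4"
    using Sto.prems(1) c1(2) c2(2) c3(2,4) A
    by (simp add: c4_def code_at_append code_at_Cons step_def add.assoc)
  from run_trans[OF c1(1) run_trans[OF c2(1) run_trans[OF c3(1) this]]]
  have run: "run W P (sz (Sto k a e)) cf = Some c4" by (simp add: add.assoc)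
  have r4: "rep D (set_fld k (ev a s) (ev e s) s) c4"
  proof (cases "k = 0")
    case True
    then show ?thesis using r3 oks by (auto simp: rep_def c4_def A_def)
  next
    case False
    \<comment> \<open>Entry and field number are quotient and remainder modulo 16, so distinct cells
      have distinct addresses.\<close>
    have "D + 16 * p + k' = D + 16 * ev a s + k \<longleftrightarrow> p = ev a s \<and> k' = k"
      if "k' < 16" for p k'
      using that oks(2) by (cases p "ev a s" rule: linorder_cases) auto
    then show ?thesis using r3 False oks(2) by (auto simp: rep_def c4_def A_def)
  qed
  have "bnd (B + (gre a + gre e)) (set_fld k (ev a s) (ev e s) s)"
    using bnd_mono[OF Sto.prems(4), of "B + (gre a + gre e)"] le(2) by (auto simp: bnd_def)
  then show ?case using run r4 c1(2) c2(2) c3(2)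
    by (intro exI[of _ "sz (Sto k a e)"] exI[of _ c4]) (simp add: c4_def)
next
  case (Seq c s t s' d t' s'')
  have *: "code_at P i (cc i c)" "code_at P (i + sz c) (cc (i + sz c) d)"
    using Seq.prems by (simp_all add: code_at_append)
  have g: "gr c * (1 + t) + gr d * (1 + t') \<le> gr (c ;; d) * (1 + (t + t'))"
    "sz c * (1 + t) + sz d * (1 + t') \<le> sz (c ;; d) * (1 + (t + t'))"
    by (simp_all add: algebra_simps)
  obtain k1 c1 where c1: "k1 \<le> sz c * (1 + t)" "run W P k1 cf = Some c1" "pc c1 = i + sz c"
    "rep D s' c1" "bnd (B + gr c * (1 + t)) s'"
    using Seq.IH(1)[OF *(1) Seq.prems(2-4)] Seq.prems(5) g(1) by auto
  obtain k2 c2 where c2: "k2 \<le> sz d * (1 + t')" "run W P k2 c1 = Some c2"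
    "pc c2 = i + sz c + sz d" "rep D s'' c2" "bnd (B + gr c * (1 + t) + gr d * (1 + t')) s''"
    using Seq.IH(2)[OF *(2) c1(3,4,5)] Seq.prems(5) g(1) by auto
  have "bnd (B + gr (c ;; d) * (1 + (t + t'))) s''"
    using bnd_mono[OF c2(5)] g(1) by (simp add: add.assoc)
  then show ?case using run_trans[OF c1(2) c2(2)] c1(1) c2 g(2)
    by (intro exI[of _ "k1 + k2"] exI[of _ c2]) (simp add: add.assoc)
next
  case (CondT e s c t s' d)
  let ?j = "i + length (ce 0 e) + 1"
  have *: "code_at P i (ce 0 e @ JumpZero (tmp 0) (?j + sz c + 1) #
      (cc ?j c @ [Jump (?j + sz c + 1 + sz d)] @ cc (?j + sz c + 1) d))"
    using CondT.prems by (simp add: Let_def)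
  then have **: "code_at P ?j (cc ?j c)" "code_at P (?j + sz c) [Jump (?j + sz c + 1 + sz d)]"
    by (simp_all add: code_at_append code_at_Cons code_at_Nil add.assoc)
  obtain c1 where c1: "run W P (length (ce 0 e) + 1) cf = Some c1" "rep D s c1" "pc c1 = ?j"
    using test_sim[OF * CondT.prems(2,3) CondT.hyps(1) CondT.prems(4), of W] CondT by auto
  obtain k2 c2 where c2: "k2 \<le> sz c * (1 + t)" "run W P k2 c1 = Some c2" "pc c2 = ?j + sz c"
    "rep D s' c2" "bnd (B + gr c * (1 + t)) s'"
    using CondT.IH[OF **(1) c1(3,2) CondT.prems(4)] CondT.prems(5) by (auto simp: algebra_simps)
  define c3 where "c3 = c2\<lparr>pc := ?j + sz c + 1 + sz d\<rparr>"
  have "run W P (Suc 0) c2 = Some c3"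
    using **(2) c2(3) by (simp add: c3_def code_at_Cons step_def)
  from run_trans[OF c1(1) run_trans[OF c2(2) this]]
  have "run W P (length (ce 0 e) + 1 + (k2 + Suc 0)) cf = Some c3" .
  moreover have "rep D s' c3" using c2(4) by (simp add: c3_def rep_def)
  moreover have "bnd (B + gr (Cond e c d) * (1 + t)) s'"
    by (rule bnd_mono[OF c2(5)]) (simp add: algebra_simps)
  ultimately show ?case using c2(1)
    by (intro exI[of _ "length (ce 0 e) + 1 + (k2 + Suc 0)"] exI[of _ c3])
      (simp add: c3_def algebra_simps)
next
  case (CondF e s d t s' c)
  let ?j = "i + length (ce 0 e) + 1"
  have *: "code_at P i (ce 0 e @ JumpZero (tmp 0) (?j + sz c + 1) #
      (cc ?j c @ [Jump (?j + sz c + 1 + sz d)] @ cc (?j + sz c + 1) d))"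
    using CondF.prems by (simp add: Let_def)
  then have **: "code_at P (?j + sz c + 1) (cc (?j + sz c + 1) d)"
    by (simp add: code_at_append code_at_Cons add.assoc)
  obtain c1 where c1: "run W P (length (ce 0 e) + 1) cf = Some c1" "rep D s c1"
    "pc c1 = ?j + sz c + 1"
    using test_sim[OF * CondF.prems(2,3) CondF.hyps(1) CondF.prems(4), of W] CondF by auto
  obtain k2 c2 where c2: "k2 \<le> sz d * (1 + t)" "run W P k2 c1 = Some c2"
    "pc c2 = ?j + sz c + 1 + sz d" "rep D s' c2" "bnd (B + gr d * (1 + t)) s'"
    using CondF.IH[OF **(1) c1(3,2) CondF.prems(4)] CondF.prems(5) by (auto simp: algebra_simps)
  have "bnd (B + gr (Cond e c d) * (1 + t)) s'"
    by (rule bnd_mono[OF c2(5)]) (simp add: algebra_simps)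
  then show ?case using run_trans[OF c1(1) c2(2)] c2
    by (intro exI[of _ "length (ce 0 e) + 1 + k2"] exI[of _ c2]) (simp add: algebra_simps)
next
  case (WhileF e s c)
  let ?j = "i + length (ce 0 e) + 1"
  have *: "code_at P i (ce 0 e @ JumpZero (tmp 0) (?j + sz c + 1) # (cc ?j c @ [Jump i]))"
    using WhileF.prems by (simp add: Let_def)
  obtain c1 where c1: "run W P (length (ce 0 e) + 1) cf = Some c1" "rep D s c1"
    "pc c1 = ?j + sz c + 1"
    using test_sim[OF * WhileF.prems(2,3) WhileF.hyps(1) WhileF.prems(4), of W] WhileF by auto
  show ?case using c1 bnd_mono[OF WhileF.prems(4)]
    by (intro exI[of _ "length (ce 0 e) + 1"] exI[of _ c1]) simp
next
  case (WhileT e s c t s' t' s'')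
  let ?j = "i + length (ce 0 e) + 1"
  have *: "code_at P i (ce 0 e @ JumpZero (tmp 0) (?j + sz c + 1) # (cc ?j c @ [Jump i]))"
    using WhileT.prems by (simp add: Let_def)
  then have **: "code_at P ?j (cc ?j c)" "code_at P (?j + sz c) [Jump i]"
    by (simp_all add: code_at_append code_at_Cons code_at_Nil add.assoc)
  have g: "gr c * (1 + t) + gr (While e c) * (1 + t') \<le> gr (While e c) * (1 + Suc (t + t'))"
    by (simp add: algebra_simps)
  obtain c1 where c1: "run W P (length (ce 0 e) + 1) cf = Some c1" "rep D s c1" "pc c1 = ?j"
    using test_sim[OF * WhileT.prems(2,3) WhileT.hyps(1) WhileT.prems(4), of W] WhileT by auto
  obtain k2 c2 where c2: "k2 \<le> sz c * (1 + t)" "run W P k2 c1 = Some c2" "pc c2 = ?j + sz c"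
    "rep D s' c2" "bnd (B + gr c * (1 + t)) s'"
    using WhileT.IH(1)[OF **(1) c1(3,2) WhileT.prems(4)] WhileT.prems(5) g by auto
  define c3 where "c3 = c2\<lparr>pc := i\<rparr>"
  have s3: "run W P (Suc 0) c2 = Some c3"
    using **(2) c2(3) by (simp add: c3_def code_at_Cons step_def)
  have c3: "pc c3 = i" "rep D s' c3" using c2(4) by (simp_all add: c3_def rep_def)
  obtain k4 c4 where c4: "k4 \<le> sz (While e c) * (1 + t')" "run W P k4 c3 = Some c4"
    "pc c4 = i + sz (While e c)" "rep D s'' c4"
    "bnd (B + gr c * (1 + t) + gr (While e c) * (1 + t')) s''"
    using WhileT.IH(2)[OF WhileT.prems(1) c3 c2(5)] WhileT.prems(5) g by auto
  have "run W P (length (ce 0 e) + 1 + (k2 + (Suc 0 + k4))) cf = Some c4"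
    using run_trans[OF c1(1) run_trans[OF c2(2) run_trans[OF s3 c4(2)]]] .
  moreover have "bnd (B + gr (While e c) * (1 + Suc (t + t'))) s''"
    by (rule bnd_mono[OF c4(5)]) (use g in simp)
  ultimately show ?case using c2(1) c4
    by (intro exI[of _ "length (ce 0 e) + 1 + (k2 + (Suc 0 + k4))"] exI[of _ c4])
      (simp add: algebra_simps)
qed

section \<open>Weakest preconditions with a budget of loop iterations\<close>

definition wp :: "nat \<Rightarrow> com \<Rightarrow> (state \<Rightarrow> nat \<Rightarrow> bool) \<Rightarrow> state \<Rightarrow> nat \<Rightarrow> bool" where
  "wp D c Q s k \<longleftrightarrow> (\<exists>t s'. big D c s t s' \<and> t \<le> k \<and> Q s' (k - t))"

lemma wp_Skip [intro]: "Q s k \<Longrightarrow> wp D Skip Q s k"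
  unfolding wp_def using big.Skip by fastforce

lemma wp_Asg: "ok D e s \<Longrightarrow> Q (set_var x (ev e s) s) k \<Longrightarrow> wp D (Asg x e) Q s k"
  unfolding wp_def using big.Asg by fastforce

lemma wp_Sto:
  "ok D (Ld f a) s \<Longrightarrow> ok D e s \<Longrightarrow> Q (set_fld f (ev a s) (ev e s) s) k \<Longrightarrow> wp D (Sto f a e) Q s k"
  unfolding wp_def using big.Sto by fastforce

lemma wp_Seq:
  assumes "wp D c (wp D d Q) s k"
  shows "wp D (c ;; d) Q s k"
proof -
  obtain t s' t' s'' where "big D c s t s'" "t \<le> k" "big D d s' t' s''" "t' \<le> k - t"
    "Q s'' (k - t - t')"
    using assms unfolding wp_def by blast
  then show ?thesis
    unfolding wp_def by (intro exI[of _ "t + t'"] exI[of _ s'']) (auto intro: big.Seq)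
qed

lemma wp_Cond:
  assumes "ok D e s" "ev e s \<noteq> 0 \<Longrightarrow> wp D c Q s k" "ev e s = 0 \<Longrightarrow> wp D d Q s k"
  shows "wp D (Cond e c d) Q s k"
  using assms unfolding wp_def by (cases "ev e s = 0") (blast intro: big.CondT big.CondF)+

lemma wp_unfold:
  assumes "ok D e s" "ev e s = 0 \<Longrightarrow> Q s k"
    "ev e s \<noteq> 0 \<Longrightarrow> 0 < k \<and> wp D c (wp D (While e c) Q) s (k - 1)"
  shows "wp D (While e c) Q s k"
proof (cases "ev e s = 0")
  case True
  then show ?thesis unfolding wp_def using assms big.WhileF by fastforce
next
  case False
  then obtain t s' t' s'' where *: "big D c s t s'" "t \<le> k - 1" "big D (While e c) s' t' s''"
    "t' \<le> k - 1 - t" "Q s'' (k - 1 - t - t')"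
    using assms(3) unfolding wp_def by blast
  have "big D (While e c) s (Suc (t + t')) s''"
    using big.WhileT[OF assms(1) False *(1,3)] .
  then show ?thesis using *(2,4,5) False assms(3)
    unfolding wp_def by (intro exI[of _ "Suc (t + t')"] exI[of _ s'']) auto
qed

lemma wp_conseq: "wp D c Q s k \<Longrightarrow> (\<And>s' k'. Q s' k' \<Longrightarrow> Q' s' k') \<Longrightarrow> wp D c Q' s k"
  unfolding wp_def by blast

text \<open>The budget drops with every iteration and so serves as the termination measure; the
  invariant relates the state to the remaining budget.\<close>

lemma wp_While:
  assumes "I s k"
    and "\<And>s k. I s k \<Longrightarrow> ok D e s"
    and "\<And>s k. I s k \<Longrightarrow> ev e s = 0 \<Longrightarrow> Q s k"
    and "\<And>s k. I s k \<Longrightarrow> ev e s \<noteq> 0 \<Longrightarrow> 0 < k \<and> wp D c I s (k - 1)"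
  shows "wp D (While e c) Q s k"
  using assms(1)
proof (induction k arbitrary: s rule: less_induct)
  case (less k)
  show ?case
  proof (rule wp_unfold)
    assume "ev e s \<noteq> 0"
    then have *: "0 < k" "wp D c I s (k - 1)" using assms(4)[OF less.prems] by auto
    then obtain t s' where "big D c s t s'" "t \<le> k - 1" "I s' (k - 1 - t)"
      unfolding wp_def by blast
    moreover have "wp D (While e c) Q s' (k - 1 - t)"
      using less.IH[of "k - 1 - t" s'] * \<open>I s' (k - 1 - t)\<close> by simp
    ultimately show "0 < k \<and> wp D c (wp D (While e c) Q) s (k - 1)"
      using * unfolding wp_def[of D c] by blast
  qed (use assms less.prems in auto)
qed

primrec wflds :: "com \<Rightarrow> nat set" where
  "wflds Skip = {}"
| "wflds (Asg x e) = {}"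
| "wflds (Sto f a e) = {f}"
| "wflds (c ;; d) = wflds c \<union> wflds d"
| "wflds (Cond e c d) = wflds c \<union> wflds d"
| "wflds (While e c) = wflds c"

primrec wvars :: "com \<Rightarrow> nat set" where
  "wvars Skip = {}"
| "wvars (Asg x e) = {x}"
| "wvars (Sto f a e) = {}"
| "wvars (c ;; d) = wvars c \<union> wvars d"
| "wvars (Cond e c d) = wvars c \<union> wvars d"
| "wvars (While e c) = wvars c"

lemma big_frame:
  "big D c s t s' \<Longrightarrow> (\<forall>f. f \<notin> wflds c \<longrightarrow> fd s' f = fd s f) \<and> (\<forall>x. x \<notin> wvars c \<longrightarrow> rg s' x = rg s x)"
  by (induction rule: big.induct) auto

text \<open>What the program text does not assign keeps its value. This spares the specifications of
  the phases a list of unchanged components.\<close>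

lemma wp_frame:
  assumes "wp D c Q s k"
    and "\<And>s' k'. Q s' k' \<Longrightarrow> (\<And>f. f \<notin> wflds c \<Longrightarrow> fd s' f = fd s f) \<Longrightarrow>
      (\<And>x. x \<notin> wvars c \<Longrightarrow> rg s' x = rg s x) \<Longrightarrow> Q' s' k'"
  shows "wp D c Q' s k"
  using assms big_frame[of D c s] unfolding wp_def by blast

section \<open>From permutations to 2-matchings\<close>

definition period :: "(nat \<Rightarrow> nat) \<Rightarrow> nat \<Rightarrow> nat" where
  "period p v = (LEAST k. 0 < k \<and> (p ^^ k) v = v)"

lemma period:
  assumes "p permutes V" "finite V"
  shows "0 < period p v" "(p ^^ period p v) v = v" "\<And>k. 0 < k \<Longrightarrow> k < period p v \<Longrightarrow> (p ^^ k) v \<noteq> v"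
proof -
  have "finite {y. \<exists>k. y = (p ^^ k) v}"
  proof (cases "v \<in> V")
    case True
    then have "(p ^^ k) v \<in> V" for k
      by (induction k) (auto simp: permutes_in_image[OF assms(1)])
    then show ?thesis by (intro finite_subset[OF _ assms(2)]) auto
  next
    case False
    then have "(p ^^ k) v = v" for k
      by (induction k) (auto simp: permutes_not_in[OF assms(1)])
    then show ?thesis by simp
  qed
  from funpow_inj_finite[OF permutes_inj[OF assms(1)] this]
  have "\<exists>k. 0 < k \<and> (p ^^ k) v = v" by metis
  from LeastI_ex[OF this] show "0 < period p v" "(p ^^ period p v) v = v"
    by (simp_all add: period_def)
  show "(p ^^ k) v \<noteq> v" if "0 < k" "k < period p v" for k
    using not_less_Least[of k "\<lambda>k. 0 < k \<and> (p ^^ k) v = v"] that by (auto simp: period_def)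
qed

text \<open>By injectivity of \<open>p ^^ i\<close> the node would return after \<open>j - i\<close>
  steps, sooner than its period.\<close>

lemma funpow_period_eq:
  assumes "p permutes V" "finite V" "(p ^^ i) v = (p ^^ j) v" "i < j" "j < i + period p v"
  shows False
proof -
  have "(p ^^ j) v = (p ^^ i) ((p ^^ (j - i)) v)"
    using assms(4) by (metis add_diff_inverse_nat comp_apply funpow_add not_less_iff_gr_or_eq)
  moreover have "inj (p ^^ i)"
    using permutes_inj[OF assms(1)] by (rule inj_fn)
  ultimately have "(p ^^ (j - i)) v = v" using assms(3) by (metis injD)
  then show False using period(3)[OF assms(1,2), of "j - i" v] assms(4,5) by auto
qed

definition cyc :: "(nat \<Rightarrow> nat) \<Rightarrow> nat \<Rightarrow> nat list" where
  "cyc p v = map (\<lambda>i. (p ^^ i) v) [0..<period p v]"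

lemma length_cyc [simp]: "length (cyc p v) = period p v"
  by (simp add: cyc_def)

lemma distinct_cyc: "p permutes V \<Longrightarrow> finite V \<Longrightarrow> distinct (cyc p v)"
  unfolding cyc_def distinct_map
  by (auto simp: inj_on_def) (metis funpow_period_eq linorder_neqE_nat trans_less_add2)

lemma set_cyc:
  assumes "p permutes V" "finite V"
  shows "set (cyc p v) = {(p ^^ i) v |i. True}"
proof -
  have "(p ^^ i) v = (p ^^ (i mod period p v)) v" for i
    using funpow_mod_eq[OF period(2)[OF assms], of i] by simp
  moreover have "i mod period p v < period p v" for i
    using period(1)[OF assms] by simp
  ultimately show ?thesis unfolding cyc_def by (auto simp: image_iff) (metis atLeastLessThan_iff le0)
qed

text \<open>At the last index the wrap-around modulo the length agrees with one more application of
  \<open>p\<close>, since the period leads back to \<open>v\<close>.\<close>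

lemma circuit_edges_cyc:
  assumes "p permutes V" "finite V"
  shows "circuit_edges (cyc p v) = {{u, p u} |u. u \<in> set (cyc p v)}"
proof -
  have "cyc p v ! (Suc i mod period p v) = p ((p ^^ i) v)" if "i < period p v" for i
  proof -
    have "(p ^^ (Suc i mod period p v)) v = (p ^^ Suc i) v"
      using funpow_mod_eq[OF period(2)[OF assms], of "Suc i"] by simp
    then show ?thesis using period(1)[OF assms] by (simp add: cyc_def)
  qed
  moreover have "cyc p v ! i = (p ^^ i) v" if "i < period p v" for i
    using that by (simp add: cyc_def)
  ultimately have "circuit_edges (cyc p v) = {{(p ^^ i) v, p ((p ^^ i) v)} |i. i < period p v}"
    unfolding circuit_edges_def length_cyc by (intro Collect_cong) metis
  also have "\<dots> = {{u, p u} |u. u \<in> set (cyc p v)}"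
    by (auto simp: cyc_def)
  finally show ?thesis .
qed

lemma set_cyc_eq:
  assumes "p permutes V" "finite V" "u \<in> set (cyc p v)"
  shows "set (cyc p u) = set (cyc p v)"
proof -
  obtain i where i: "i < period p v" "u = (p ^^ i) v" using assms(3) by (auto simp: cyc_def)
  have "v = (p ^^ (period p v - i)) u"
    unfolding i(2) using period(2)[OF assms(1,2), of v] i(1)
    by (metis add.commute comp_apply funpow_add le_add_diff_inverse less_imp_le)
  then show ?thesis using i(2)
    unfolding set_cyc[OF assms(1,2)] by auto (metis comp_apply funpow_add)+
qed

text \<open>The sum over both ends matters when \<open>p\<close> swaps them: the edge then gets the
  values of both, which add up to 2 in the locale \<open>cycle_cover\<close>.\<close>

definition edge_val :: "(nat \<Rightarrow> nat) \<Rightarrow> (nat \<Rightarrow> nat) \<Rightarrow> nat set \<Rightarrow> nat" where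
  "edge_val p val e = (\<Sum>v\<in>e. if e = {v, p v} then val v else 0)"

lemma edge_val_pair:
  "u \<noteq> v \<Longrightarrow> edge_val p val {v, u} = (if p v = u then val v else 0) + (if p u = v then val u else 0)"
  by (auto simp: edge_val_def doubleton_eq_iff)

text \<open>\<open>val v\<close> is the value of the arc from \<open>v\<close> to
  \<open>p v\<close>. Along a cycle the values alternate between \<open>a\<close> and
  \<open>2 - a\<close>, so they are 1 throughout on an odd cycle; \<open>odd_per\<close> excludes
  the constant value 1 on an even one.\<close>

locale cycle_cover =
  fixes V :: "nat set" and E :: "nat set set" and p val :: "nat \<Rightarrow> nat"
  assumes graph: "graph V E" and perm: "p permutes V"
    and edge: "\<And>v. v \<in> V \<Longrightarrow> {v, p v} \<in> E"
    and no3: "\<And>v. v \<in> V \<Longrightarrow> p (p (p v)) \<noteq> v"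
    and val: "\<And>v. v \<in> V \<Longrightarrow> val v + val (p v) = 2"
    and odd_per: "\<And>v. v \<in> V \<Longrightarrow> val v = 1 \<Longrightarrow> odd (period p v)"
begin

lemma fin: "finite V" and finE: "finite E"
  using graph finite_subset[of E "Pow V"] by (auto simp: graph_def)

lemma p_in: "p v \<in> V \<longleftrightarrow> v \<in> V"
  using perm by (rule permutes_in_image)

lemma p_ne: "v \<in> V \<Longrightarrow> p v \<noteq> v"
  using edge[of v] graph by (auto simp: graph_def)

lemma edgeE:
  assumes "e \<in> E"
  obtains a b where "e = {a, b}" "a \<noteq> b" "a \<in> V" "b \<in> V"
  using assms graph unfolding graph_def by (metis card_2_iff insert_subset)

lemma edge_val_sum: "e \<in> E \<Longrightarrow> edge_val p val e = (\<Sum>u\<in>V. if e = {u, p u} then val u else 0)"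
  unfolding edge_val_def
  by (rule sum.mono_neutral_left) (use fin graph in \<open>auto simp: graph_def\<close>)

text \<open>Double counting: a sum over nodes, that is over arcs, keeps the two arcs of a 2-cycle
  apart although they share their edge.\<close>

lemma sum_edge_val:
  assumes "A \<subseteq> E"
  shows "(\<Sum>e\<in>A. edge_val p val e) = (\<Sum>u\<in>V. if {u, p u} \<in> A then val u else 0)"
proof -
  have "(\<Sum>e\<in>A. edge_val p val e) = (\<Sum>e\<in>A. \<Sum>u\<in>V. if e = {u, p u} then val u else 0)"
    using assms by (intro sum.cong) (auto simp: edge_val_sum)
  also have "\<dots> = (\<Sum>u\<in>V. \<Sum>e\<in>A. if e = {u, p u} then val u else 0)"
    by (rule sum.swap)
  also have "\<dots> = (\<Sum>u\<in>V. if {u, p u} \<in> A then val u else 0)"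
    using finite_subset[OF assms finE] by (intro sum.cong) (auto simp: sum.delta)
  finally show ?thesis .
qed

text \<open>Only the arcs into and out of \<open>v\<close> meet \<open>v\<close>. They start at the
  predecessor \<open>u\<close> and at \<open>v = p u\<close>, and contribute
  \<open>val u + val (p u)\<close>.\<close>

lemma sum_incident:
  assumes "v \<in> V"
  shows "(\<Sum>e\<in>incident E v. edge_val p val e) = 2"
proof -
  define u where "u = inv p v"
  have u: "p u = v" "u \<in> V" "u \<noteq> v"
    using permutes_inverses(1)[OF perm, of v] assms p_in[of u] p_ne[of v] by (auto simp: u_def)
  have "(\<Sum>e\<in>incident E v. edge_val p val e) = (\<Sum>w\<in>V. if {w, p w} \<in> incident E v then val w else 0)"
    by (rule sum_edge_val) (auto simp: incident_def)
  also have "\<dots> = (\<Sum>w\<in>V. if w \<in> {u, v} then val w else 0)"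
    using edge u permutes_inj[OF perm] by (intro sum.cong) (auto simp: incident_def dest: injD)
  also have "\<dots> = (\<Sum>w\<in>{u, v}. val w)"
  proof -
    have "V \<inter> {w. w \<in> {u, v}} = {u, v}" using u assms by auto
    then show ?thesis using fin by (simp only: sum.If_cases) simp
  qed
  also have "\<dots> = 2" using u val[of u] by simp
  finally show ?thesis .
qed

lemma edge_val_le: "e \<in> E \<Longrightarrow> v \<in> e \<Longrightarrow> edge_val p val e \<le> 2"
  using sum_incident[of v] graph finE
  by (metis (no_types, lifting) finite_subset graph_def incident_def mem_Collect_eq member_le_sum
      subsetD subsetI zero_le)

lemma two_matching: "two_matching V E (edge_val p val)"
proof -
  have "edge_val p val e \<in> {0, 1, 2}" if e: "e \<in> E" for e
  proof -
    obtain a b where "e = {a, b}" using edgeE[OF e] by metis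
    then have "edge_val p val e \<le> 2" using edge_val_le[OF e, of a] by simp
    then show ?thesis by auto
  qed
  then show ?thesis by (simp add: two_matching_def sum_incident)
qed

text \<open>The sums of \<open>val\<close> and of its shift by \<open>p\<close> are equal, and
  together they count 2 for each node.\<close>

lemma perfect: "perfect V E (edge_val p val)"
proof -
  have "(\<Sum>e\<in>E. edge_val p val e) = (\<Sum>u\<in>V. val u)"
    using sum_edge_val[of E] edge by (auto intro: sum.cong)
  moreover have "(\<Sum>u\<in>V. val u) + (\<Sum>u\<in>V. val (p u)) = 2 * card V"
    using val by (simp flip: sum.distrib)
  moreover have "(\<Sum>u\<in>V. val (p u)) = (\<Sum>u\<in>V. val u)"
    using sum.permute[OF perm, of val] by simp
  ultimately show ?thesis by (simp add: perfect_def)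
qed

lemma val_orbit: "v \<in> V \<Longrightarrow> val v = 1 \<Longrightarrow> (p ^^ i) v \<in> V \<and> val ((p ^^ i) v) = 1"
proof (induction i)
  case (Suc i)
  then show ?case using val[of "(p ^^ i) v"] by (simp add: p_in)
qed simp

lemma per_ge_3: "v \<in> V \<Longrightarrow> val v = 1 \<Longrightarrow> 3 \<le> period p v"
  using odd_per[of v] period(1,2)[OF perm fin, of v] p_ne[of v]
  by (cases "period p v = 1"; cases "period p v = 2") auto

lemma basic: "basic E (edge_val p val)"
  unfolding basic_def
\<comment> \<open>A cycle can be listed from each of its nodes. Listing it from its least node only
  makes different lists disjoint.\<close>
proof (intro exI[of _ "{cyc p v |v. v \<in> V \<and> val v = 1 \<and> (\<forall>i. v \<le> (p ^^ i) v)}"] conjI ballI impI)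
  fix c assume "c \<in> {cyc p v |v. v \<in> V \<and> val v = 1 \<and> (\<forall>i. v \<le> (p ^^ i) v)}"
  then obtain v where v: "c = cyc p v" "v \<in> V" "val v = 1" by blast
  have "u \<in> V" if "u \<in> set c" for u
    using that val_orbit[OF v(2,3)] unfolding v(1) set_cyc[OF perm fin] by auto
  then have "circuit_edges c \<subseteq> E"
    unfolding v(1) circuit_edges_cyc[OF perm fin] using edge by auto
  then show "circuit E c" "odd (length c)"
    using v per_ge_3[OF v(2,3)] odd_per[OF v(2,3)] distinct_cyc[OF perm fin]
    by (simp_all add: circuit_def)
next
  fix c d
  assume "c \<in> {cyc p v |v. v \<in> V \<and> val v = 1 \<and> (\<forall>i. v \<le> (p ^^ i) v)}"
    "d \<in> {cyc p v |v. v \<in> V \<and> val v = 1 \<and> (\<forall>i. v \<le> (p ^^ i) v)}" and ne: "c \<noteq> d"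
  then obtain v w where v: "c = cyc p v" "\<And>i. v \<le> (p ^^ i) v"
    and w: "d = cyc p w" "\<And>i. w \<le> (p ^^ i) w" by blast
  show "set c \<inter> set d = {}"
  proof (rule ccontr)
    assume "set c \<inter> set d \<noteq> {}"
    then have "set c = set d" using set_cyc_eq[OF perm fin] v(1) w(1) by blast
    moreover have "v \<in> set c" "w \<in> set d"
      unfolding v(1) w(1) set_cyc[OF perm fin] by (auto intro: exI[of _ 0])
    ultimately have "v \<in> set d" "w \<in> set c" by auto
    then obtain i j where "v = (p ^^ i) w" "w = (p ^^ j) v"
      unfolding v(1) w(1) set_cyc[OF perm fin] by blast
    then have "v = w" using v(2)[of j] w(2)[of i] by simp
    then show False using ne v w by simp
  qed
next
  let ?C = "{cyc p v |v. v \<in> V \<and> val v = 1 \<and> (\<forall>i. v \<le> (p ^^ i) v)}"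
  have "edge_val p val {u, p u} = 1" if "u \<in> V" "val u = 1" for u
  proof -
    \<comment> \<open>A period of at least 3 excludes 2-cycles, so the edge carries a single
      arc.\<close>
    have "p (p u) \<noteq> u"
      using period(3)[OF perm fin, of 2 u] per_ge_3[OF that] by (simp add: numeral_2_eq_2)
    then show ?thesis using edge_val_pair[of "p u" u p val] p_ne[OF that(1)] that by simp
  qed
  then have one: "{u, p u} \<in> {e \<in> E. edge_val p val e = 1}" if "u \<in> V" "val u = 1" for u
    using that edge by blast
  have "circuit_edges (cyc p v) \<subseteq> {e \<in> E. edge_val p val e = 1}" if v: "v \<in> V" "val v = 1" for v
  proof
    fix e assume "e \<in> circuit_edges (cyc p v)"
    then obtain u where "e = {u, p u}" "u \<in> set (cyc p v)"
      unfolding circuit_edges_cyc[OF perm fin] by blast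
    moreover from this have "u \<in> V \<and> val u = 1"
      using val_orbit[OF v] unfolding set_cyc[OF perm fin] by auto
    ultimately show "e \<in> {e \<in> E. edge_val p val e = 1}" using one by blast
  qed
  then have "(\<Union>c\<in>?C. circuit_edges c) \<subseteq> {e \<in> E. edge_val p val e = 1}"
    by blast
  moreover have "e \<in> (\<Union>c\<in>?C. circuit_edges c)" if e: "e \<in> E" "edge_val p val e = 1" for e
  proof -
    obtain a b where ab: "e = {a, b}" "a \<noteq> b" "a \<in> V" "b \<in> V" using edgeE[OF e(1)] .
    then have "(p a = b \<and> val a = 1) \<or> (p b = a \<and> val b = 1)"
      using e(2) edge_val_pair[of b a p val] by (auto split: if_splits)
    then obtain u where u: "u \<in> V" "e = {u, p u}" "val u = 1" using ab by auto
    define v where "v = Min (set (cyc p u))"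
    have "u \<in> set (cyc p u)" unfolding set_cyc[OF perm fin] by (auto intro: exI[of _ 0])
    then have "v \<in> set (cyc p u)" unfolding v_def by (intro Min_in) auto
    then have eq: "set (cyc p v) = set (cyc p u)" and v: "v \<in> V" "val v = 1"
      using set_cyc_eq[OF perm fin] val_orbit[OF u(1,3)] unfolding set_cyc[OF perm fin] by auto
    have "v \<le> (p ^^ i) v" for i
    proof -
      have "(p ^^ i) v \<in> set (cyc p v)" unfolding set_cyc[OF perm fin] by auto
      then have "(p ^^ i) v \<in> set (cyc p u)" by (simp only: eq)
      then show ?thesis unfolding v_def by simp
    qed
    then have "cyc p v \<in> ?C" using v by blast
    moreover have "e \<in> circuit_edges (cyc p v)"
      unfolding circuit_edges_cyc[OF perm fin] eq using u(2) \<open>u \<in> set (cyc p u)\<close> by blast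
    ultimately show ?thesis by blast
  qed
  ultimately show "{e \<in> E. edge_val p val e = 1} = (\<Union>c\<in>?C. circuit_edges c)" by blast
qed

text \<open>Each edge of the support joins some \<open>u\<close> to \<open>p u\<close>. Three such
  edges on three nodes take one arc from each node, so \<open>p\<close> rotates the triangle in one
  of the two directions.\<close>

lemma triangle_free: "triangle_free E (edge_val p val)"
  unfolding triangle_free_def
proof
  assume "\<exists>c. circuit {e \<in> E. edge_val p val e \<noteq> 0} c \<and> length c = 3"
  then obtain c where c: "distinct c" "circuit_edges c \<subseteq> {e \<in> E. edge_val p val e \<noteq> 0}"
    "length c = 3" by (auto simp: circuit_def)
  obtain x y z where xyz: "c = [x, y, z]"
    using c(3) by (auto simp: length_Suc_conv numeral_3_eq_3)
  have "{c ! i, c ! (Suc i mod length c)} \<in> circuit_edges c" if "i < 3" for i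
    using that c(3) by (auto simp: circuit_edges_def)
  from this[of 0] this[of 1] this[of 2]
  have *: "{x, y} \<in> E" "edge_val p val {x, y} \<noteq> 0" "{y, z} \<in> E" "edge_val p val {y, z} \<noteq> 0"
    "{z, x} \<in> E" "edge_val p val {z, x} \<noteq> 0"
    using c(2) by (auto simp: xyz)
  have ne: "x \<noteq> y" "y \<noteq> z" "z \<noteq> x" using c(1) by (auto simp: xyz)
  have "p x = y \<or> p y = x" "p y = z \<or> p z = y" "p z = x \<or> p x = z"
    using *(2,4,6) ne edge_val_pair[of y x p val] edge_val_pair[of z y p val] edge_val_pair[of x z p val]
    by (auto split: if_splits)
  then have "p (p (p x)) = x" using ne by auto
  moreover have "x \<in> V" using *(1) graph by (auto simp: graph_def)
  ultimately show False using no3 by blast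
qed

end

section \<open>Schrijver's circuit cancelling\<close>

text \<open>Half-edges of a cubic bipartite multigraph: a node is an orbit of \<open>nx\<close>, an
  edge an orbit of \<open>bt\<close>. The number 0 is kept out because it is the null pointer of the
  walk.\<close>

locale cubic_bip =
  fixes H :: "nat set" and nx bt :: "nat \<Rightarrow> nat" and side :: "nat \<Rightarrow> bool"
  assumes finH: "finite H" and zeroH: "0 \<notin> H"
    and nx_in: "\<And>h. h \<in> H \<Longrightarrow> nx h \<in> H" and nx3: "\<And>h. h \<in> H \<Longrightarrow> nx (nx (nx h)) = h"
    and nx_ne: "\<And>h. h \<in> H \<Longrightarrow> nx h \<noteq> h"
    and bt_in: "\<And>h. h \<in> H \<Longrightarrow> bt h \<in> H" and bt_bt: "\<And>h. h \<in> H \<Longrightarrow> bt (bt h) = h"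
    and side_nx: "\<And>h. h \<in> H \<Longrightarrow> side (nx h) = side h"
    and side_bt: "\<And>h. h \<in> H \<Longrightarrow> side (bt h) \<noteq> side h"
begin

definition orb :: "nat \<Rightarrow> nat set" where
  "orb h = {h, nx h, nx (nx h)}"

lemma orb_in: "h \<in> H \<Longrightarrow> y \<in> orb h \<Longrightarrow> y \<in> H"
  using nx_in by (auto simp: orb_def)

lemma orb_eq: "h \<in> H \<Longrightarrow> y \<in> orb h \<Longrightarrow> orb y = orb h"
  using nx3 by (auto simp: orb_def)

lemma self_orb: "h \<in> orb h"
  by (simp add: orb_def)

lemma orb_sym: "h \<in> H \<Longrightarrow> y \<in> orb h \<Longrightarrow> h \<in> orb y"
  using orb_eq[of h y] self_orb[of h] by simp

lemma nx2_ne: "h \<in> H \<Longrightarrow> nx (nx h) \<noteq> h"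
  using nx3[of h] nx_ne[of h] by auto

lemma bt_ne: "h \<in> H \<Longrightarrow> bt h \<noteq> h"
  using side_bt[of h] by auto

text \<open>Polymorphic because both the weights and their signed changes are summed around a
  node.\<close>

definition osum :: "(nat \<Rightarrow> 'a::comm_monoid_add) \<Rightarrow> nat \<Rightarrow> 'a" where
  "osum \<phi> h = \<phi> h + \<phi> (nx h) + \<phi> (nx (nx h))"

definition balanced :: "(nat \<Rightarrow> nat) \<Rightarrow> bool" where
  "balanced w \<longleftrightarrow> (\<forall>h\<in>H. w (bt h) = w h \<and> osum w h = 3)"

definition frac :: "(nat \<Rightarrow> nat) \<Rightarrow> nat \<Rightarrow> bool" where
  "frac w h \<longleftrightarrow> w h = 1 \<or> w h = 2"

lemma balanced_le: "balanced w \<Longrightarrow> h \<in> H \<Longrightarrow> w h \<le> 3"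
  by (auto simp: balanced_def osum_def dest!: bspec[of _ _ h])

lemma balanced_frac: "balanced w \<Longrightarrow> h \<in> H \<Longrightarrow> frac w h \<or> w h = 0 \<or> w h = 3"
  using balanced_le[of w h] by (auto simp: frac_def)

text \<open>A walk with its newest half-edge first. Each entry leaves the node at which the next
  entry of the list arrives, does not turn back, and no node is left twice. The newest entry may
  arrive at a node that was left before: then a circuit closes.\<close>

primrec path :: "(nat \<Rightarrow> nat) \<Rightarrow> nat list \<Rightarrow> bool" where
  "path w [] \<longleftrightarrow> True"
| "path w (x # xs) \<longleftrightarrow> x \<in> H \<and> frac w x \<and> (\<forall>z\<in>set xs. z \<notin> orb x) \<and>
    (xs = [] \<or> x = nx (bt (hd xs)) \<or> x = nx (nx (bt (hd xs)))) \<and> path w xs"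

lemma path_Cons: "path w (x # xs) \<Longrightarrow> path w xs \<and> x \<in> H \<and> frac w x \<and> (\<forall>z\<in>set xs. z \<notin> orb x)"
  by simp

lemma path_in: "path w xs \<Longrightarrow> set xs \<subseteq> H"
  by (induction xs) auto

lemma path_frac: "path w xs \<Longrightarrow> y \<in> set xs \<Longrightarrow> frac w y"
  by (induction xs) auto

lemma path_distinct: "path w xs \<Longrightarrow> distinct xs"
  by (induction xs) (auto simp: self_orb)

lemma path_append: "path w (xs @ ys) \<Longrightarrow> path w xs \<and> path w ys"
  by (induction xs) auto

lemma path_cong: "path w xs \<Longrightarrow> (\<And>y. y \<in> set xs \<Longrightarrow> w' y = w y) \<Longrightarrow> path w' xs"
  by (induction xs) (simp_all add: frac_def)

(* The successor of y on the path leaves the vertex that y enters, and it is not bt y. *)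
lemma path_bt_mem:
  assumes "path w xs" "x \<in> set xs" "y \<in> set xs"
  shows "bt x \<noteq> y"
  using assms
proof (induction xs arbitrary: x y)
  case (Cons z xs)
  have z: "z \<in> H" "\<forall>u\<in>set xs. u \<notin> orb z" "path w xs" using path_Cons[OF Cons.prems(1)] by auto
  have H: "x \<in> H" "y \<in> H" using path_in[OF Cons.prems(1)] Cons.prems by auto
  have *: "bt u \<noteq> z" if uxs: "u \<in> set xs" for u
  proof
    assume u: "bt u = z"
    have uH: "u \<in> H" using path_in[OF z(3)] uxs by auto
    obtain v vs where xs: "xs = v # vs" using uxs by (cases xs) auto
    then have zv: "z = nx (bt v) \<or> z = nx (nx (bt v))" using Cons.prems(1) by simp
    have vH: "v \<in> H" using path_in[OF z(3)] xs by auto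
    show False
    proof (cases "u = v")
      case True
      then show False using zv u nx_ne[of z] nx2_ne[of z] z(1) by auto
    next
      case False
      then have "u \<in> set vs" using uxs xs by simp
      then obtain as bs where vs: "xs = as @ u # bs" "as \<noteq> []"
        using xs False by (metis append_Cons split_list list.distinct(1))
      then obtain as' t where as: "as = as' @ [t]" by (metis rev_exhaust)
      then have "path w (t # u # bs)" using z(3) vs path_append[of w as' "t # u # bs"] by simp
      then have "t = nx z \<or> t = nx (nx z)" using u by simp
      then have "t \<in> orb z" by (auto simp: orb_def)
      then show False using z(2) vs as by auto
    qed
  qed
  have **: "bt z \<noteq> u" if "u \<in> set xs" for u
    using *[OF that] bt_bt[of u] bt_bt[of z] path_in[OF z(3)] that z(1) by auto
  show ?case
    using Cons.IH[OF z(3)] Cons.prems(2,3) * ** side_bt[OF z(1)] by auto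
qed simp

section \<open>Alternating changes along a circuit\<close>

definition sg1 :: "bool \<Rightarrow> int" where
  "sg1 b = (if b then 1 else - 1)"

fun delta :: "bool \<Rightarrow> nat list \<Rightarrow> nat \<Rightarrow> int" where
  "delta b [] h = 0"
| "delta b (y # ys) h = (if h = y \<or> h = bt y then sg1 b else 0) + delta (\<not> b) ys h"

lemma delta_notin: "h \<notin> set ys \<Longrightarrow> (\<And>y. y \<in> set ys \<Longrightarrow> h \<noteq> bt y) \<Longrightarrow> delta b ys h = 0"
  by (induction ys arbitrary: b) auto

lemma osum_add: "osum (\<lambda>h. \<phi> h + \<psi> h) z = osum \<phi> z + osum \<psi> z"
  by (simp add: osum_def algebra_simps)

lemma osum_indicator:
  assumes "z \<in> H" "y \<in> H"
  shows "osum (\<lambda>h. if h = y then c else 0) z = (if y \<in> orb z then c else 0)"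
proof -
  have "nx z \<noteq> z" "nx (nx z) \<noteq> z" "nx (nx z) \<noteq> nx z"
    using assms nx_ne[of z] nx_ne[of "nx z"] nx2_ne[of z] nx_in[of z] by auto
  then show ?thesis by (auto simp: osum_def orb_def)
qed

lemma osum_edge:
  assumes "z \<in> H" "y \<in> H"
  shows "osum (\<lambda>h. if h = y \<or> h = bt y then c else (0::int)) z =
    (if y \<in> orb z then c else 0) + (if bt y \<in> orb z then c else 0)"
proof -
  have "(\<lambda>h. if h = y \<or> h = bt y then c else 0) =
      (\<lambda>h. (if h = y then c else 0) + (if h = bt y then c else 0))"
    using bt_ne[OF assms(2)] by auto
  then show ?thesis
    using osum_indicator[OF assms, of c] osum_indicator[OF assms(1) bt_in[OF assms(2)], of c]
    by (simp add: osum_add)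
qed

lemma orb_iff:
  assumes "z \<in> H" "y \<in> H" "x = nx (bt y) \<or> x = nx (nx (bt y))"
  shows "x \<in> orb z \<longleftrightarrow> bt y \<in> orb z"
proof -
  have "x \<in> orb (bt y)" "x \<in> H" using assms bt_in nx_in by (auto simp: orb_def)
  then have "orb x = orb (bt y)" using orb_eq bt_in assms by blast
  then show ?thesis using orb_sym orb_eq bt_in assms(1,2) \<open>x \<in> H\<close> by metis
qed

(* Telescoping: along a path only the vertex entered first and the vertex left last see a change. *)
lemma osum_delta:
  assumes "path w (y # ys)" "z \<in> H"
  shows "osum (delta b (y # ys)) z = (if bt y \<in> orb z then sg1 b else 0) +
    (if last (y # ys) \<in> orb z then sg1 (b = even (length ys)) else 0)"
  using assms(1)
proof (induction ys arbitrary: y b)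
  case Nil
  then show ?case
    using osum_edge[OF assms(2), of y "sg1 b"] by (simp add: osum_def)
next
  case (Cons x xs)
  have p: "path w (x # xs)" "y \<in> H" "x \<in> H" "y = nx (bt x) \<or> y = nx (nx (bt x))"
    using Cons.prems by auto
  have "osum (delta b (y # x # xs)) z =
      osum (\<lambda>h. if h = y \<or> h = bt y then sg1 b else 0) z + osum (delta (\<not> b) (x # xs)) z"
    by (simp add: osum_def algebra_simps)
  also have "\<dots> = (if y \<in> orb z then sg1 b else 0) + (if bt y \<in> orb z then sg1 b else 0) +
      ((if bt x \<in> orb z then sg1 (\<not> b) else 0) +
       (if last (x # xs) \<in> orb z then sg1 ((\<not> b) = even (length xs)) else 0))"
    by (simp only: Cons.IH[OF p(1)] osum_edge[OF assms(2) p(2)])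
  also have "(if y \<in> orb z then sg1 b else 0) = - (if bt x \<in> orb z then sg1 (\<not> b) else 0)"
    using orb_iff[OF assms(2) p(3) p(4)] by (simp add: sg1_def)
  finally show ?case by (simp add: sg1_def)
qed

text \<open>Every step crosses the bipartition; \<open>cancel\<close> derives from this that
  circuits are even.\<close>

lemma path_side:
  "path w (x # xs) \<Longrightarrow> side (last (x # xs)) = (side x = even (length xs))"
proof (induction xs arbitrary: x)
  case (Cons y ys)
  then have "path w (y # ys)" "y \<in> H" "x = nx (bt y) \<or> x = nx (nx (bt y))"
    by auto
  moreover have "side x \<noteq> side y"
    using calculation side_bt[of y] side_nx[of "bt y"] side_nx[of "nx (bt y)"] bt_in[of y] nx_in[of "bt y"]
    by auto
  ultimately show ?case using Cons.IH[of y] by auto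
qed simp

fun evs ods :: "(nat \<Rightarrow> nat) \<Rightarrow> nat list \<Rightarrow> nat" where
  "evs w [] = 0"
| "evs w (x # xs) = w x + ods w xs"
| "ods w [] = 0"
| "ods w (x # xs) = evs w xs"

text \<open>The linear term in the change of the energy. The factor 2 appears because both
  half-edges of an edge change, and \<open>b\<close> can be chosen to make the term
  nonnegative.\<close>

lemma sum_delta_weight:
  assumes "set ys \<subseteq> H" "\<And>h. h \<in> H \<Longrightarrow> w (bt h) = w h"
  shows "(\<Sum>h\<in>H. int (w h) * delta b ys h) = 2 * sg1 b * (int (evs w ys) - int (ods w ys))"
  using assms(1)
proof (induction ys arbitrary: b)
  case (Cons y ys)
  then have y: "y \<in> H" by simp
  have "(\<Sum>h\<in>H. int (w h) * (if h = y \<or> h = bt y then sg1 b else 0)) =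
      (\<Sum>h\<in>H. (if h = y then int (w y) * sg1 b else 0) + (if h = bt y then int (w y) * sg1 b else 0))"
    using side_bt[OF y] assms(2)[OF y] by (intro sum.cong) auto
  also have "\<dots> = 2 * sg1 b * int (w y)"
    using finH y bt_in[OF y] by (simp add: sum.distrib)
  finally have *: "(\<Sum>h\<in>H. int (w h) * (if h = y \<or> h = bt y then sg1 b else 0)) =
      2 * sg1 b * int (w y)" .
  have "(\<Sum>h\<in>H. int (w h) * delta b (y # ys) h) = 2 * sg1 b * int (w y) +
      2 * sg1 (\<not> b) * (int (evs w ys) - int (ods w ys))"
    using Cons.IH[of "\<not> b"] Cons.prems by (simp add: distrib_left sum.distrib *)
  then show ?case by (cases b) (simp_all add: sg1_def del: delta.simps)
qed simp

text \<open>The entries and their reverses are pairwise distinct half-edges, so the change is 1 or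
  -1 at \<open>2 * length ys\<close> places.\<close>

lemma sum_delta_square:
  assumes "distinct ys" "set ys \<subseteq> H" "\<And>x y. x \<in> set ys \<Longrightarrow> y \<in> set ys \<Longrightarrow> bt x \<noteq> y"
  shows "(\<Sum>h\<in>H. (delta b ys h)\<^sup>2) = 2 * int (length ys)"
  using assms
proof (induction ys arbitrary: b)
  case (Cons y ys)
  have y: "y \<in> H" "bt y \<in> H" "y \<noteq> bt y" using Cons.prems bt_in side_bt[of y] by auto
  have "delta (\<not> b) ys y = 0" "delta (\<not> b) ys (bt y) = 0"
  proof -
    have "y \<noteq> bt x" "bt y \<noteq> x" if "x \<in> set ys" for x
      using Cons.prems(3)[of x y] Cons.prems(3)[of y x] that by auto
    moreover have "bt y \<noteq> bt x" if "x \<in> set ys" for x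
      using Cons.prems(1,2) that bt_bt[of x] bt_bt[of y] by auto
    ultimately show "delta (\<not> b) ys y = 0" "delta (\<not> b) ys (bt y) = 0"
      using Cons.prems(1) by (auto intro!: delta_notin)
  qed
  then have "(delta b (y # ys) h)\<^sup>2 =
      (if h = y then 1 else 0) + (if h = bt y then 1 else 0) + (delta (\<not> b) ys h)\<^sup>2" for h
    using y by (auto simp: sg1_def)
  then have "(\<Sum>h\<in>H. (delta b (y # ys) h)\<^sup>2) = 2 + (\<Sum>h\<in>H. (delta (\<not> b) ys h)\<^sup>2)"
    using y finH by (simp add: sum.distrib del: delta.simps)
  also have "\<dots> = 2 * int (length (y # ys))"
    using Cons.IH Cons.prems by simp
  finally show ?case .
qed simp

definition energy :: "(nat \<Rightarrow> nat) \<Rightarrow> nat" where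
  "energy w = (\<Sum>h\<in>H. (w h)\<^sup>2)"

lemma energy_le: "balanced w \<Longrightarrow> energy w \<le> 9 * card H"
proof -
  assume w: "balanced w"
  have "(w h)\<^sup>2 \<le> 3\<^sup>2" if "h \<in> H" for h
    using balanced_le[OF w that] by (rule power_mono) simp
  then have "energy w \<le> (\<Sum>h\<in>H. 3\<^sup>2)"
    unfolding energy_def by (intro sum_mono) blast
  then show ?thesis by simp
qed

text \<open>The addition of \<open>delta\<close> as the program performs it, one edge after the
  other. Truncated subtraction does no harm, since weights on a walk are positive.\<close>

fun flip :: "bool \<Rightarrow> nat list \<Rightarrow> (nat \<Rightarrow> nat) \<Rightarrow> nat \<Rightarrow> nat" where
  "flip b [] w = w"
| "flip b (y # ys) w =
    (let a = (if b then Suc (w y) else w y - 1) in flip (\<not> b) ys (w(y := a, bt y := a)))"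

lemma flip_delta:
  assumes "distinct ys" "set ys \<subseteq> H" "\<And>x y. x \<in> set ys \<Longrightarrow> y \<in> set ys \<Longrightarrow> bt x \<noteq> y"
    "\<And>y. y \<in> set ys \<Longrightarrow> 0 < w y" "\<And>y. y \<in> set ys \<Longrightarrow> w (bt y) = w y"
  shows "int (flip b ys w h) = int (w h) + delta b ys h"
  using assms
proof (induction ys arbitrary: b w)
  case (Cons y ys)
  define a where "a = (if b then Suc (w y) else w y - 1)"
  define w' where "w' = w(y := a, bt y := a)"
  have y: "y \<in> H" "y \<noteq> bt y" using Cons.prems side_bt[of y] by auto
  have ne: "x \<noteq> y" "x \<noteq> bt y" "bt x \<noteq> y" "bt x \<noteq> bt y" if "x \<in> set ys" for x
  proof -
    show "x \<noteq> y" using Cons.prems(1) that by auto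
    then show "bt x \<noteq> bt y" using bt_bt[of x] bt_bt[OF y(1)] that Cons.prems(2) by force
    show "x \<noteq> bt y" "bt x \<noteq> y" using Cons.prems(3) that by (metis list.set_intros)+
  qed
  have "int (flip (\<not> b) ys w' h) = int (w' h) + delta (\<not> b) ys h"
    by (rule Cons.IH) (use Cons.prems ne in \<open>auto simp: w'_def\<close>)
  moreover have "0 < w y" "w (bt y) = w y" using Cons.prems by auto
  then have "int (w' h) = int (w h) + (if h = y \<or> h = bt y then sg1 b else 0)"
    by (auto simp: w'_def a_def sg1_def)
  moreover have "flip b (y # ys) w = flip (\<not> b) ys w'" by (simp add: a_def w'_def Let_def)
  ultimately show ?case by simp
qed simp

text \<open>\<open>ys\<close> is the newest part of the walk, back to the half-edge that leaves the
  node just reached. By \<open>osum_delta\<close> a node sum could change only where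
  \<open>ys\<close> begins and ends; this is one node, and there the two changes cancel because
  \<open>ys\<close> is even. The energy changes by the linear term, nonnegative by the choice of
  \<open>b\<close>, plus the sum of the squared changes. The older part keeps its weights, as it
  shares no edge with \<open>ys\<close>.\<close>

lemma cancel:
  assumes "path w (ys @ rest)" "ys \<noteq> []" "balanced w"
    and closed: "last ys = nx (bt (hd ys)) \<or> last ys = nx (nx (bt (hd ys)))"
    and b: "if b then ods w ys \<le> evs w ys else evs w ys \<le> ods w ys"
  defines "w' \<equiv> flip b ys w"
  shows "even (length ys)" "balanced w'" "path w' rest" "energy w + 2 * length ys \<le> energy w'"
    "\<And>h. \<not> frac w h \<Longrightarrow> w' h = w h"
proof -
  have p: "path w ys" "path w rest" using path_append[OF assms(1)] by auto
  note all = path_in[OF assms(1)] path_bt_mem[OF assms(1)] path_distinct[OF assms(1)]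
    path_frac[OF assms(1)]
  obtain y zs where ys: "ys = y # zs" using assms(2) by (cases ys) auto
  have yH: "y \<in> H" and lH: "last ys \<in> H" using all(1) ys by auto
  have w': "int (w' h) = int (w h) + delta b ys h" for h
    unfolding w'_def
  proof (rule flip_delta)
    show "0 < w y" if "y \<in> set ys" for y using all(4)[of y] that by (auto simp: frac_def)
    show "w (bt y) = w y" if "y \<in> set ys" for y
      using all(1) assms(3) that by (auto simp: balanced_def)
  qed (use all in auto)
  have "side (last ys) \<noteq> side y"
    using closed side_bt[OF yH] side_nx[of "bt y"] side_nx[of "nx (bt y)"] bt_in[OF yH] nx_in[of "bt y"]
    by (auto simp: ys)
  then show ev: "even (length ys)" using path_side[of w y zs] p(1) by (auto simp: ys)
  have delta_bt: "delta c xs (bt h) = delta c xs h" if "h \<in> H" "set xs \<subseteq> H" for c xs h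
    using that(2)
  proof (induction xs arbitrary: c)
    case (Cons a xs)
    have "bt h = bt a \<longleftrightarrow> h = a" "bt h = a \<longleftrightarrow> h = bt a"
      using bt_bt[OF that(1)] bt_bt[of a] Cons.prems by (metis list.set_intros(1) subsetD)+
    then show ?case using Cons by auto
  qed simp
  show "balanced w'"
    unfolding balanced_def
  proof (intro ballI conjI)
    fix h assume h: "h \<in> H"
    have "int (w' (bt h)) = int (w' h)"
      using h assms(3) delta_bt[OF h, of ys] all(1) by (simp add: w' balanced_def)
    then show "w' (bt h) = w' h" by simp
    have "osum (delta b ys) h = 0"
    proof -
      have "last ys \<in> orb h \<longleftrightarrow> bt y \<in> orb h" using orb_iff[OF h yH] closed ys by simp
      then show ?thesis using osum_delta[of w y zs h b] p(1) h ev by (auto simp: ys sg1_def)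
    qed
    moreover have "int (osum w' h) = int (osum w h) + osum (delta b ys) h"
      by (simp add: osum_def w')
    ultimately show "osum w' h = 3" using assms(3) h by (simp add: balanced_def)
  qed
  have "w' x = w x" if "x \<in> set rest" for x
  proof -
    have "x \<notin> set ys" using all(3) that by auto
    moreover have "x \<noteq> bt z" if "z \<in> set ys" for z using all(2)[of z x] that \<open>x \<in> set rest\<close> by auto
    ultimately have "delta b ys x = 0" by (rule delta_notin)
    then show ?thesis using w'[of x] by simp
  qed
  then show "path w' rest" by (rule path_cong[OF p(2)])
  show "w' h = w h" if h: "\<not> frac w h" for h
  proof -
    have "h \<notin> set ys" using all(4) h by auto
    moreover have "h \<noteq> bt z" if z: "z \<in> set ys" for z
    proof -
      have "z \<in> H" "frac w z" using z all by auto
      then show ?thesis using h assms(3) by (auto simp: balanced_def frac_def)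
    qed
    ultimately have "delta b ys h = 0" by (rule delta_notin)
    then show ?thesis using w'[of h] by simp
  qed
  have "int (energy w') = (\<Sum>h\<in>H. (int (w h) + delta b ys h)\<^sup>2)"
    by (simp add: energy_def w')
  also have "\<dots> = (\<Sum>h\<in>H. (int (w h))\<^sup>2 + 2 * (int (w h) * delta b ys h) + (delta b ys h)\<^sup>2)"
    by (intro sum.cong) (simp_all add: power2_sum)
  also have "\<dots> = int (energy w) + 2 * (\<Sum>h\<in>H. int (w h) * delta b ys h) + (\<Sum>h\<in>H. (delta b ys h)\<^sup>2)"
    by (simp add: sum.distrib energy_def flip: sum_distrib_left)
  also have "(\<Sum>h\<in>H. (delta b ys h)\<^sup>2) = 2 * int (length ys)"
    using all by (intro sum_delta_square) auto
  also have "(\<Sum>h\<in>H. int (w h) * delta b ys h) = 2 * sg1 b * (int (evs w ys) - int (ods w ys))"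
    using all(1) assms(3) by (intro sum_delta_weight) (auto simp: balanced_def)
  finally show "energy w + 2 * length ys \<le> energy w'"
    using b by (auto simp: sg1_def split: if_splits)
qed

text \<open>A weight 1 or 2 leaves 2 or 1 for the other two half-edges at the node reached. If one
  of them is 0, the other is fractional, so testing one of them is enough.\<close>

lemma path_extend:
  assumes "path w (x # xs)" "balanced w"
    and "nx (bt x) \<notin> set (x # xs)" "nx (nx (bt x)) \<notin> set (x # xs)"
    and "y = (if frac w (nx (bt x)) then nx (bt x) else nx (nx (bt x)))"
  shows "path w (y # x # xs)"
proof -
  have x: "x \<in> H" "frac w x" using path_Cons[OF assms(1)] by auto
  have g: "bt x \<in> H" "nx (bt x) \<in> H" using x bt_in nx_in by auto
  have "osum w (bt x) = 3" "w (bt x) = w x" using assms(2) g x by (auto simp: balanced_def)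
  then have "frac w y" using x(2) assms(5) by (auto simp: osum_def frac_def)
  moreover have "y \<in> orb (bt x)" using assms(5) by (auto simp: orb_def)
  then have "orb y = orb (bt x)" "y \<in> H" using orb_eq[OF g(1)] orb_in[OF g(1)] by auto
  moreover have "z \<notin> orb (bt x)" if "z \<in> set (x # xs)" for z
    using that assms(3,4) path_bt_mem[OF assms(1), of x z] by (auto simp: orb_def)
  moreover have "y = nx (bt x) \<or> y = nx (nx (bt x))" using assms(5) by presburger
  ultimately show ?thesis using assms(1) unfolding path.simps(2)[of w y] by (metis list.sel(1))
qed

end

text \<open>
  A slot is the address of an entry of an adjacency list; the slots run from variable 0
  to variable 3, variable 2 is \<open>n\<close>. Fields of a slot: 2 neighbour, 3 owner, 5 next slot of the same
  (contracted) node, 6 reverse slot, 7 copy on the other side of the double cover, 8 weight,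
  10 reverse half-edge in the double cover, 11 and 12 mark and predecessor on the walk. Fields of a
  node: 4 first slot, 9 in a contracted triangle, 13 permutation, 14 value, 15 visited.
\<close>

definition frac_test :: "exp \<Rightarrow> exp" where
  "frac_test e = Sb (Nm 2) (Df (Sb e (Nm 1)) (Sb (Nm 2) e))"

text \<open>Swapping variables 11 and 12 in every step lets one assignment collect the weights of
  both parities. The weight is 1 or 2 and is added by one or two successors, as the language has no
  addition. The marks of the circuit are cleared on the way.\<close>

definition sum_body :: com where
  "sum_body = Asg 13 (Vr 11) ;;
     Cond (Sb (Ld 8 (Vr 10)) (Nm 1)) (Asg 11 (Sc (Sc (Vr 12)))) (Asg 11 (Sc (Vr 12))) ;;
     Asg 12 (Vr 13) ;; Sto 11 (Vr 10) (Nm 0) ;; Asg 10 (Ld 12 (Vr 10))"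

definition flip_body :: com where
  "flip_body = Cond (Vr 14) (Sto 8 (Vr 10) (Sc (Ld 8 (Vr 10))) ;; Asg 14 (Nm 0))
     (Sto 8 (Vr 10) (Sb (Ld 8 (Vr 10)) (Nm 1)) ;; Asg 14 (Nm 1)) ;;
     Sto 8 (Ld 10 (Vr 10)) (Ld 8 (Vr 10)) ;; Asg 10 (Ld 12 (Vr 10))"

abbreviation "sum_loop \<equiv> While (Df (Vr 10) (Vr 9)) sum_body"
abbreviation "flip_loop \<equiv> While (Df (Vr 10) (Vr 9)) flip_body"

text \<open>Variable 8 is the oldest half-edge of the circuit. Its predecessor, saved in variable 9,
  ends both loops and becomes the new head of the walk; it is 0 if the walk is used up.\<close>

definition cancel_prog :: com where
  "cancel_prog =
     Asg 9 (Ld 12 (Vr 8)) ;; Asg 10 (Vr 5) ;; Asg 11 (Nm 0) ;; Asg 12 (Nm 0) ;; sum_loop ;;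
     Asg 10 (Vr 5) ;; Cond (Sb (Vr 11) (Vr 12)) (Asg 14 (Nm 0)) (Asg 14 (Nm 1)) ;; flip_loop ;;
     Asg 5 (Vr 9)"

definition push_prog :: com where
  "push_prog = Cond (frac_test (Ld 8 (Vr 6))) Skip (Asg 6 (Vr 7)) ;;
     Sto 11 (Vr 6) (Nm 1) ;; Sto 12 (Vr 6) (Vr 5) ;; Asg 5 (Vr 6)"

definition step_prog :: com where
  "step_prog = Asg 6 (Ld 5 (Ld 10 (Vr 5))) ;; Asg 7 (Ld 5 (Vr 6)) ;;
     Cond (Ld 11 (Vr 6)) (Asg 8 (Vr 6)) (Cond (Ld 11 (Vr 7)) (Asg 8 (Vr 7)) (Asg 8 (Nm 0))) ;;
     Cond (Vr 8) cancel_prog push_prog"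

definition start_prog :: com where
  "start_prog = Cond (frac_test (Ld 8 (Vr 4)))
     (Sto 11 (Vr 4) (Nm 1) ;; Sto 12 (Vr 4) (Nm 0) ;; Asg 5 (Vr 4)) (Asg 4 (Sc (Vr 4)))"

text \<open>One loop instead of nested ones: an iteration extends the walk, cancels a circuit,
  starts a walk or advances the scan. Variable 5 is 0 when there is no walk.\<close>

definition walk_prog :: com where
  "walk_prog = Asg 4 (Vr 0) ;; Asg 5 (Nm 0) ;;
     While (Df (Vr 4) (Vr 3)) (Cond (Vr 5) step_prog start_prog)"

text \<open>For the weights 0, 1, 2, 3 the distance that is subtracted from 2 is 2, 1, 1, 2.\<close>

lemma frac_test [simp]:
  "ok D (frac_test e) s = ok D e s"
  "ev e s \<le> 3 \<Longrightarrow> ev (frac_test e) s = 0 \<longleftrightarrow> \<not> (ev e s = 1 \<or> ev e s = 2)"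
  by (auto simp: frac_test_def)

definition hd0 :: "nat list \<Rightarrow> nat" where
  "hd0 xs = (case xs of [] \<Rightarrow> 0 | x # _ \<Rightarrow> x)"

lemma hd0_simps [simp]: "hd0 [] = 0" "hd0 (x # xs) = x"
  by (simp_all add: hd0_def)

primrec linked :: "(nat \<Rightarrow> nat) \<Rightarrow> nat list \<Rightarrow> bool" where
  "linked pr [] \<longleftrightarrow> True"
| "linked pr (x # xs) \<longleftrightarrow> pr x = hd0 xs \<and> linked pr xs"

lemma linked_append: "linked pr (xs @ ys) \<Longrightarrow> linked pr ys"
  by (induction xs) auto

lemma linked_last: "linked pr (xs @ ys) \<Longrightarrow> xs \<noteq> [] \<Longrightarrow> pr (last xs) = hd0 ys"
  by (induction xs) auto

lemma linked_cong: "linked pr xs \<Longrightarrow> (\<And>x. x \<in> set xs \<Longrightarrow> pr' x = pr x) \<Longrightarrow> linked pr' xs"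
  by (induction xs) auto

lemma hd0_ne: "distinct (z # zs @ rest) \<Longrightarrow> 0 \<notin> set (z # zs @ rest) \<Longrightarrow> z \<noteq> hd0 rest"
  by (cases rest) auto

lemma diff_sum_eq_0 [simp]: "(a - b) + (b - a) = 0 \<longleftrightarrow> a = (b::nat)"
  by auto

section \<open>Correctness and amortised cost of the walk\<close>

context cubic_bip
begin

text \<open>Each iteration swaps the two accumulators, so the parity of \<open>zs\<close> decides
  which of them finally holds which sum. The circuits in use are even.\<close>

lemma sum_loop:
  assumes "linked (fd s 12) (zs @ rest)" "rg s 10 = hd0 (zs @ rest)" "rg s 9 = hd0 rest"
    "distinct (zs @ rest)" "0 \<notin> set (zs @ rest)" "\<And>z. z \<in> set zs \<Longrightarrow> frac (fd s 8) z"
    "length zs \<le> k"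
    and "\<And>s'. fd s' = (fd s)(11 := \<lambda>h. if h \<in> set zs then 0 else fd s 11 h) \<Longrightarrow>
      (if even (length zs) then
         rg s' 11 = rg s 11 + ods (fd s 8) zs \<and> rg s' 12 = rg s 12 + evs (fd s 8) zs
       else rg s' 11 = rg s 12 + evs (fd s 8) zs \<and> rg s' 12 = rg s 11 + ods (fd s 8) zs) \<Longrightarrow>
      Q s' (k - length zs)"
  shows "wp D sum_loop Q s k"
  using assms
proof (induction zs arbitrary: s k)
  case Nil
  have "Q s k" using Nil.prems(8)[of s] by simp
  then show ?case
    by (intro wp_unfold) (use Nil.prems in auto)
next
  case (Cons z zs)
  have z: "rg s 10 = z" "z \<noteq> rg s 9" "frac (fd s 8) z" "0 < k"
    using Cons.prems hd0_ne[of z zs rest] by auto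
  have step: "wp D sum_loop Q s' (k - 1)"
    if s': "fd s' = (fd s)(11 := (fd s 11)(z := 0))" "rg s' 10 = hd0 (zs @ rest)"
      "rg s' 9 = rg s 9" "rg s' 11 = rg s 12 + fd s 8 z" "rg s' 12 = rg s 11" for s' :: state
  proof (rule Cons.IH)
    fix t :: state assume t: "fd t = (fd s')(11 := \<lambda>h. if h \<in> set zs then 0 else fd s' 11 h)"
      "if even (length zs) then
        rg t 11 = rg s' 11 + ods (fd s' 8) zs \<and> rg t 12 = rg s' 12 + evs (fd s' 8) zs
       else rg t 11 = rg s' 12 + evs (fd s' 8) zs \<and> rg t 12 = rg s' 11 + ods (fd s' 8) zs"
    have "Q t (k - length (z # zs))"
      by (rule Cons.prems(8)) (use t[unfolded s'] in \<open>auto simp: fun_eq_iff split: if_splits\<close>)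
    then show "Q t (k - 1 - length zs)" by simp
  qed (use Cons.prems s' in \<open>auto intro: linked_cong\<close>)
  have "fd s 12 z = hd0 (zs @ rest)" using Cons.prems(1) by simp
  then have "wp D sum_body R s k'"
    if "\<And>s'. fd s' = (fd s)(11 := (fd s 11)(z := 0)) \<Longrightarrow> rg s' 10 = hd0 (zs @ rest) \<Longrightarrow>
      rg s' 9 = rg s 9 \<Longrightarrow> rg s' 11 = rg s 12 + fd s 8 z \<Longrightarrow> rg s' 12 = rg s 11 \<Longrightarrow> R s' k'" for R k'
    unfolding sum_body_def using z
    by (intro wp_Seq wp_Asg wp_Cond wp_Sto) (auto simp: frac_def intro!: that)
  then have "wp D sum_body (wp D sum_loop Q) s (k - 1)" using step by blast
  then show ?case
    using z by (intro wp_unfold) auto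
qed

lemma flip_loop:
  assumes "linked (fd s 12) (zs @ rest)" "rg s 10 = hd0 (zs @ rest)" "rg s 9 = hd0 rest"
    "distinct (zs @ rest)" "0 \<notin> set (zs @ rest)" "\<And>z. z \<in> set zs \<Longrightarrow> fd s 10 z = bt z"
    "length zs \<le> k" "rg s 14 = of_bool b"
    and "\<And>s'. fd s' = (fd s)(8 := flip b zs (fd s 8)) \<Longrightarrow> Q s' (k - length zs)"
  shows "wp D flip_loop Q s k"
  using assms
proof (induction zs arbitrary: s k b)
  case Nil
  have "Q s k" using Nil.prems(9)[of s] by simp
  then show ?case
    by (intro wp_unfold) (use Nil.prems in auto)
next
  case (Cons z zs)
  have z: "rg s 10 = z" "z \<noteq> rg s 9" "0 < k" "fd s 10 z = bt z"
    using Cons.prems hd0_ne[of z zs rest] by auto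
  define a where "a = (if b then Suc (fd s 8 z) else fd s 8 z - 1)"
  have step: "wp D flip_loop Q s' (k - 1)"
    if s': "fd s' = (fd s)(8 := (fd s 8)(z := a, bt z := a))" "rg s' 10 = hd0 (zs @ rest)"
      "rg s' 9 = rg s 9" "rg s' 14 = of_bool (\<not> b)" for s' :: state
  proof (rule Cons.IH[of s' "k - 1" "\<not> b"])
    fix t :: state assume t: "fd t = (fd s')(8 := flip (\<not> b) zs (fd s' 8))"
    have "Q t (k - length (z # zs))"
      by (rule Cons.prems(9)) (use t[unfolded s'] in \<open>simp add: a_def Let_def\<close>)
    then show "Q t (k - 1 - length zs)" by simp
  qed (use Cons.prems s' in \<open>auto intro: linked_cong\<close>)
  have "fd s 12 z = hd0 (zs @ rest)" using Cons.prems(1) by simp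
  then have "wp D flip_body R s k'"
    if "\<And>s'. fd s' = (fd s)(8 := (fd s 8)(z := a, bt z := a)) \<Longrightarrow> rg s' 10 = hd0 (zs @ rest) \<Longrightarrow>
      rg s' 9 = rg s 9 \<Longrightarrow> rg s' 14 = of_bool (\<not> b) \<Longrightarrow> R s' k'" for R k'
    unfolding flip_body_def using z Cons.prems(8)
    by (intro wp_Seq wp_Asg wp_Cond wp_Sto) (auto simp: a_def intro!: that)
  then have "wp D flip_body (wp D flip_loop Q) s (k - 1)" using step by blast
  then show ?case
    using z by (intro wp_unfold) auto
qed

definition marked :: "(nat \<Rightarrow> nat) \<Rightarrow> nat list \<Rightarrow> bool" where
  "marked on xs \<longleftrightarrow> (\<forall>h\<in>H. on h = of_bool (h \<in> set xs))"

text \<open>The circuit is traversed twice, for the sums and for the changes, hence the cost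
  \<open>2 * length ys\<close>.\<close>

lemma cancel_prog:
  assumes w: "balanced (fd s 8)" and p: "path (fd s 8) (ys @ rest)" and "ys \<noteq> []"
    and "last ys = nx (bt (hd ys)) \<or> last ys = nx (nx (bt (hd ys)))"
    and link: "linked (fd s 12) (ys @ rest)" and on: "marked (fd s 11) (ys @ rest)"
    and regs: "rg s 5 = hd ys" "rg s 8 = last ys" and bt: "\<And>h. h \<in> H \<Longrightarrow> fd s 10 h = bt h"
    and k: "2 * length ys \<le> k"
    and Q: "\<And>s'. balanced (fd s' 8) \<Longrightarrow> path (fd s' 8) rest \<Longrightarrow> linked (fd s' 12) rest \<Longrightarrow>
      marked (fd s' 11) rest \<Longrightarrow> rg s' 5 = hd0 rest \<Longrightarrow> rg s' 4 = rg s 4 \<Longrightarrow> rg s' 3 = rg s 3 \<Longrightarrow>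
      energy (fd s 8) + 2 * length ys \<le> energy (fd s' 8) \<Longrightarrow>
      (\<And>h. \<not> frac (fd s 8) h \<Longrightarrow> fd s' 8 h = fd s 8 h) \<Longrightarrow>
      (\<And>f. f \<notin> {8, 11, 12} \<Longrightarrow> fd s' f = fd s f) \<Longrightarrow> Q s' (k - 2 * length ys)"
  shows "wp D cancel_prog Q s k"
proof -
  define b where "b = (ods (fd s 8) ys \<le> evs (fd s 8) ys)"
  note c = cancel[OF p \<open>ys \<noteq> []\<close> w assms(4), of b]
  have b: "if b then ods (fd s 8) ys \<le> evs (fd s 8) ys else evs (fd s 8) ys \<le> ods (fd s 8) ys"
    by (auto simp: b_def)
  note c = c[OF b]
  note d = path_distinct[OF p]
  have z: "0 \<notin> set (ys @ rest)" using path_in[OF p] zeroH by auto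
  have h: "hd0 (ys @ rest) = hd ys" using \<open>ys \<noteq> []\<close> by (cases ys) auto
  have l: "fd s 12 (last ys) = hd0 rest" by (rule linked_last[OF link \<open>ys \<noteq> []\<close>])
  let ?on = "\<lambda>h. if h \<in> set ys then 0 else fd s 11 h"
  have fin: "Q t k'"
    if t: "fd t = (fd s)(11 := ?on, 8 := flip b ys (fd s 8))" "rg t 5 = hd0 rest" "rg t 4 = rg s 4"
      "rg t 3 = rg s 3" "k' = k - length ys - length ys" for t :: state and k'
  proof -
    have "Q t (k - 2 * length ys)"
    proof (rule Q)
      show "marked (fd t 11) rest"
        using on d t by (auto simp: marked_def)
      show "linked (fd t 12) rest" using linked_append[OF link] t by simp
    qed (use t c in auto)
    then show ?thesis using t(5) by (simp add: mult_2)
  qed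
  have two: "wp D (Asg 10 (Vr 5) ;; Cond (Sb (Vr 11) (Vr 12)) (Asg 14 (Nm 0)) (Asg 14 (Nm 1)) ;;
      flip_loop ;; Asg 5 (Vr 9)) Q t (k - length ys)"
    if t: "fd t = (fd s)(11 := ?on)" "rg t 11 = ods (fd s 8) ys" "rg t 12 = evs (fd s 8) ys"
      "rg t 9 = hd0 rest" "rg t 5 = hd ys" "rg t 4 = rg s 4" "rg t 3 = rg s 3" for t :: state
  proof -
    have "wp D flip_loop (wp D (Asg 5 (Vr 9)) Q) t' (k - length ys)"
      if t': "fd t' = fd t" "rg t' 10 = hd ys" "rg t' 9 = hd0 rest" "rg t' 14 = of_bool b"
        "rg t' 4 = rg s 4" "rg t' 3 = rg s 3" for t' :: state
    proof (rule wp_frame)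
      show "wp D flip_loop (\<lambda>u k'. fd u = (fd t')(8 := flip b ys (fd t' 8)) \<and>
          k' = k - length ys - length ys) t' (k - length ys)"
        by (rule flip_loop[where zs = ys and rest = rest and b = b])
          (use t t' link h d z k bt path_in[OF p] in auto)
    next
      fix u :: state and k' assume u: "fd u = (fd t')(8 := flip b ys (fd t' 8)) \<and> k' = k - length ys - length ys"
        "\<And>x. x \<notin> wvars flip_loop \<Longrightarrow> rg u x = rg t' x"
      have "rg u 9 = hd0 rest" "rg u 4 = rg s 4" "rg u 3 = rg s 3"
        using u(2) t' by (auto simp: flip_body_def)
      then show "wp D (Asg 5 (Vr 9)) Q u k'"
        using u(1) t t' by (intro wp_Asg) (auto intro!: fin)
    qed
    then show ?thesis
      using t by (intro wp_Seq wp_Asg wp_Cond) (auto simp: b_def)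
  qed
  have "wp D sum_loop (wp D (Asg 10 (Vr 5) ;;
      Cond (Sb (Vr 11) (Vr 12)) (Asg 14 (Nm 0)) (Asg 14 (Nm 1)) ;; flip_loop ;; Asg 5 (Vr 9)) Q) t k"
    if t: "fd t = fd s" "rg t 10 = hd ys" "rg t 9 = hd0 rest" "rg t 11 = 0" "rg t 12 = 0"
      "rg t 5 = hd ys" "rg t 4 = rg s 4" "rg t 3 = rg s 3" for t :: state
  proof (rule wp_frame)
    show "wp D sum_loop (\<lambda>u k'. fd u = (fd s)(11 := ?on) \<and> rg u 11 = ods (fd s 8) ys \<and>
        rg u 12 = evs (fd s 8) ys \<and> k' = k - length ys) t k"
      by (rule sum_loop[where zs = ys and rest = rest])
        (use t link h d z k c(1) path_frac[OF p] in \<open>auto cong: if_cong\<close>)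
  next
    fix u :: state and k' assume u: "fd u = (fd s)(11 := ?on) \<and> rg u 11 = ods (fd s 8) ys \<and>
        rg u 12 = evs (fd s 8) ys \<and> k' = k - length ys"
      "\<And>x. x \<notin> wvars sum_loop \<Longrightarrow> rg u x = rg t x"
    have "rg u 9 = hd0 rest" "rg u 5 = hd ys" "rg u 4 = rg s 4" "rg u 3 = rg s 3"
      using u(2) t by (auto simp: sum_body_def)
    then show "wp D (Asg 10 (Vr 5) ;;
      Cond (Sb (Vr 11) (Vr 12)) (Asg 14 (Nm 0)) (Asg 14 (Nm 1)) ;; flip_loop ;; Asg 5 (Vr 9)) Q u k'"
      using u(1) two[of u] by simp
  qed
  then show ?thesis
    unfolding cancel_prog_def using regs l by (intro wp_Seq wp_Asg) simp_all
qed

lemma push_prog: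
  assumes "fd s 8 (rg s 6) \<le> 3" "y = (if frac (fd s 8) (rg s 6) then rg s 6 else rg s 7)"
    and "\<And>u. fd u = (fd s)(11 := (fd s 11)(y := 1), 12 := (fd s 12)(y := rg s 5)) \<Longrightarrow> rg u 5 = y \<Longrightarrow>
      rg u 4 = rg s 4 \<Longrightarrow> rg u 3 = rg s 3 \<Longrightarrow> Q u k"
  shows "wp D push_prog Q s k"
  unfolding push_prog_def using assms(1,2)
  by (intro wp_Seq wp_Asg wp_Cond wp_Sto wp_Skip assms(3)) (auto simp: frac_def)

lemma step_prog:
  assumes "a = fd s 5 (fd s 10 (rg s 5))" "b = fd s 5 a" "a \<noteq> 0" "b \<noteq> 0"
    and canc: "\<And>u f. fd u = fd s \<Longrightarrow> rg u 5 = rg s 5 \<Longrightarrow> rg u 8 = f \<Longrightarrow> rg u 4 = rg s 4 \<Longrightarrow>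
      rg u 3 = rg s 3 \<Longrightarrow> f = a \<or> f = b \<Longrightarrow> fd s 11 f \<noteq> 0 \<Longrightarrow> wp D cancel_prog Q u k"
    and push: "\<And>u. fd u = fd s \<Longrightarrow> rg u 5 = rg s 5 \<Longrightarrow> rg u 6 = a \<Longrightarrow> rg u 7 = b \<Longrightarrow> rg u 4 = rg s 4 \<Longrightarrow>
      rg u 3 = rg s 3 \<Longrightarrow> fd s 11 a = 0 \<Longrightarrow> fd s 11 b = 0 \<Longrightarrow> wp D push_prog Q u k"
  shows "wp D step_prog Q s k"
proof -
  have "wp D (Cond (Vr 8) cancel_prog push_prog) Q u k"
    if u: "fd u = fd s" "rg u 5 = rg s 5" "rg u 6 = a" "rg u 7 = b" "rg u 4 = rg s 4" "rg u 3 = rg s 3"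
      "rg u 8 = (if fd s 11 a \<noteq> 0 then a else if fd s 11 b \<noteq> 0 then b else 0)" for u
  proof (rule wp_Cond)
    assume "ev (Vr 8) u \<noteq> 0"
    then show "wp D cancel_prog Q u k"
      using u by (intro canc[of u "rg u 8"]) (auto split: if_splits)
  next
    assume "ev (Vr 8) u = 0"
    then show "wp D push_prog Q u k"
      using u assms(3,4) by (intro push[of u]) (auto split: if_splits)
  qed simp
  note * = this
  show ?thesis
    unfolding step_prog_def
    by (intro wp_Seq wp_Asg wp_Cond *) (use assms(1,2) in auto)
qed

text \<open>The last clause is the amortised analysis. Extending the walk or advancing the scan
  costs 1 and adds 1 to the right-hand side. A cancellation costs \<open>1 + 2 * length ys\<close>
  and shortens the walk by \<open>length ys\<close>, but raises the energy by at least
  \<open>2 * length ys\<close>, which is counted three times. As the energy is at most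
  \<open>9 * card H\<close> and the walk has at most \<open>card H\<close> entries,
  \<open>28 = 3 * 9 + 1\<close> ensures that \<open>K\<close> and the rest of the scan always remain
  in the budget.\<close>

definition walk_inv :: "nat \<Rightarrow> nat \<Rightarrow> nat \<Rightarrow> (nat \<Rightarrow> nat \<Rightarrow> nat) \<Rightarrow> nat list \<Rightarrow> state \<Rightarrow> nat \<Rightarrow> bool" where
  "walk_inv L E K Fd xs s k \<longleftrightarrow> balanced (fd s 8) \<and> path (fd s 8) xs \<and> linked (fd s 12) xs \<and>
     marked (fd s 11) xs \<and> rg s 5 = hd0 xs \<and> L \<le> rg s 4 \<and> rg s 4 \<le> E \<and> rg s 3 = E \<and>
     (rg s 4 = E \<longrightarrow> xs = []) \<and> (\<forall>p. L \<le> p \<and> p < rg s 4 \<longrightarrow> \<not> frac (fd s 8) p) \<and>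
     (\<forall>p. p \<notin> H \<longrightarrow> fd s 8 p = 0) \<and>
     (\<forall>f. f \<notin> {8, 11, 12} \<longrightarrow> fd s f = Fd f) \<and>
     K + E + 28 * card H \<le> k + 3 * energy (fd s 8) + length xs + rg s 4"

lemma walk_prog_correct:
  assumes F: "\<And>h. h \<in> H \<Longrightarrow> fd s 5 h = nx h" "\<And>h. h \<in> H \<Longrightarrow> fd s 10 h = bt h"
    and w: "balanced (fd s 8)" "\<And>p. p \<notin> H \<Longrightarrow> fd s 8 p = 0"
    and on: "\<And>h. h \<in> H \<Longrightarrow> fd s 11 h = 0"
    and r: "rg s 0 = L" "rg s 3 = E" "L \<le> E"
    and cover: "\<And>h. h \<in> H \<Longrightarrow> (L \<le> h \<and> h < E) \<or> (L \<le> bt h \<and> bt h < E)"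
    and k: "K + E + 28 * card H \<le> k"
    and Q: "\<And>s' k'. balanced (fd s' 8) \<Longrightarrow> (\<And>p. fd s' 8 p \<in> {0, 3}) \<Longrightarrow> (\<And>p. p \<notin> H \<Longrightarrow> fd s' 8 p = 0) \<Longrightarrow>
      (\<And>f. f \<notin> {8, 11, 12} \<Longrightarrow> fd s' f = fd s f) \<Longrightarrow> K \<le> k' \<Longrightarrow> Q s' k'"
  shows "wp D walk_prog Q s k"
proof -
  let ?I = "\<lambda>t k. \<exists>xs. walk_inv L E K (fd s) xs t k"
  have main: "wp D (While (Df (Vr 4) (Vr 3)) (Cond (Vr 5) step_prog start_prog)) Q t k"
    if "?I t k" for t
  proof (rule wp_While[where I = ?I])
    fix t k assume "?I t k"
    then obtain xs where i: "walk_inv L E K (fd s) xs t k" by blast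
    note i = i[unfolded walk_inv_def]
    note el = energy_le[of "fd t 8"]
    {
      assume "ev (Df (Vr 4) (Vr 3)) t = 0"
      then have "rg t 4 = E" using i by simp
      \<comment> \<open>The scan covers only one half-edge of an edge; the other one has the same
        weight.\<close>
      then have nf: "\<not> frac (fd t 8) h" if "h \<in> H" for h
        using cover[OF that] i that by (auto simp: balanced_def frac_def)
      show "Q t k"
      proof (rule Q)
        show "fd t 8 p \<in> {0, 3}" for p
          using i nf[of p] balanced_frac[of "fd t 8" p] by (cases "p \<in> H") auto
        show "K \<le> k" using i el \<open>rg t 4 = E\<close> by auto
      qed (use i in auto)
    next
      assume "ev (Df (Vr 4) (Vr 3)) t \<noteq> 0"
      then have lt: "rg t 4 < E" using i by auto
      have lx: "length xs \<le> card H"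
        using i path_in path_distinct finH by (metis card_mono distinct_card)
      have kp: "0 < k" using i el lx lt by auto
      then obtain m where km: "k = Suc m" by (cases k) auto
      have "wp D start_prog ?I t m" if xs: "xs = []"
      proof -
        have le3: "fd t 8 (rg t 4) \<le> 3" using i balanced_le by (cases "rg t 4 \<in> H") auto
        have fr: "?I (set_var 5 (rg t 4) (set_fld 12 (rg t 4) 0 (set_fld 11 (rg t 4) 1 t))) m"
          if "frac (fd t 8) (rg t 4)"
        proof -
          have "rg t 4 \<in> H" using that i by (auto simp: frac_def)
          then show ?thesis using i that lt km xs
            by (intro exI[of _ "[rg t 4]"]) (auto simp: walk_inv_def marked_def)
        qed
        have nf: "?I (set_var 4 (Suc (rg t 4)) t) m" if "\<not> frac (fd t 8) (rg t 4)"
          using i that lt km xs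
          by (intro exI[of _ "[]"]) (auto simp: walk_inv_def less_Suc_eq)
        show ?thesis
          unfolding start_prog_def using fr nf le3
          by (intro wp_Seq wp_Asg wp_Cond wp_Sto) (auto simp: frac_def)
      qed
      moreover have "wp D step_prog ?I t m" if xs: "xs = x # zs" for x zs
      proof -
        have xH: "x \<in> H" "frac (fd t 8) x" using i xs by auto
        have g: "bt x \<in> H" "nx (bt x) \<in> H" "nx (nx (bt x)) \<in> H" using xH bt_in nx_in by auto
        define a b where "a = nx (bt x)" and "b = nx a"
        have ab: "a \<in> H" "b \<in> H" using g by (auto simp: a_def b_def)
        have fdt: "fd t 10 x = bt x" "fd t 5 (bt x) = a" "fd t 5 a = b" "rg t 5 = x"
          using i F xs xH g by (auto simp: a_def b_def)
        have onab: "fd t 11 a = of_bool (a \<in> set xs)" "fd t 11 b = of_bool (b \<in> set xs)"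
          using i ab by (auto simp: marked_def)
        have canc: "wp D cancel_prog ?I t' m"
          if t': "fd t' = fd t" "rg t' 5 = x" "rg t' 8 = f" "rg t' 4 = rg t 4" "rg t' 3 = E"
            and f: "f \<in> set xs" "f = a \<or> f = b" for t' :: state and f
        proof -
          obtain as rest where as: "xs = as @ f # rest" using split_list[OF f(1)] by blast
          define ys where "ys = as @ [f]"
          have ys: "xs = ys @ rest" "ys \<noteq> []" "hd ys = x" "last ys = f"
            using as xs by (cases as; simp add: ys_def)+
          have closed: "last ys = nx (bt (hd ys)) \<or> last ys = nx (nx (bt (hd ys)))"
            using f(2) ys by (simp add: a_def b_def)
          have len: "length xs = length ys + length rest" using ys by simp
          \<comment> \<open>The budget for the cancellation must be known before it is run, so the
            energy bound is applied to its result in advance.\<close>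
          have "energy (fd t 8) + 2 * length ys \<le> 9 * card H"
          proof -
            define c where "c = (ods (fd t 8) ys \<le> evs (fd t 8) ys)"
            have "if c then ods (fd t 8) ys \<le> evs (fd t 8) ys else evs (fd t 8) ys \<le> ods (fd t 8) ys"
              by (auto simp: c_def)
            moreover have "path (fd t 8) (ys @ rest)" "balanced (fd t 8)" using i ys(1) by simp_all
            ultimately have "balanced (flip c ys (fd t 8))"
              "energy (fd t 8) + 2 * length ys \<le> energy (flip c ys (fd t 8))"
              using cancel(2,4)[OF _ ys(2) _ closed] by blast+
            then show ?thesis using energy_le le_trans by blast
          qed
          then have e9: "3 * energy (fd t 8) + 6 * length ys \<le> 27 * card H" by simp
          have ik: "K + E + 28 * card H \<le> k + 3 * energy (fd t 8) + length xs + rg t 4"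
            using i by blast
          have k2: "1 + 2 * length ys \<le> k"
            using e9 ik lx len lt by linarith
          have ys1: "1 \<le> length ys" using ys(2) by (cases ys) auto
          have k3: "K + E + 28 * card H \<le> m - 2 * length ys + 3 * e + length rest + rg t 4"
            if "energy (fd t 8) + 2 * length ys \<le> e" for e
            using ik len k2 km that ys1 by linarith
          show ?thesis
          proof (rule cancel_prog[where ys = ys and rest = rest])
            show "2 * length ys \<le> m" using k2 km by simp
            show "last ys = nx (bt (hd ys)) \<or> last ys = nx (nx (bt (hd ys)))"
              by (rule closed)
            fix u :: state
            assume u: "balanced (fd u 8)" "path (fd u 8) rest" "linked (fd u 12) rest"
              "marked (fd u 11) rest" "rg u 5 = hd0 rest" "rg u 4 = rg t' 4" "rg u 3 = rg t' 3"
              "energy (fd t' 8) + 2 * length ys \<le> energy (fd u 8)"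
              "\<And>h. \<not> frac (fd t' 8) h \<Longrightarrow> fd u 8 h = fd t' 8 h"
              "\<And>f. f \<notin> {8, 11, 12} \<Longrightarrow> fd u f = fd t' f"
            have "walk_inv L E K (fd s) rest u (m - 2 * length ys)"
              unfolding walk_inv_def
            proof (intro conjI)
              show "\<forall>p. L \<le> p \<and> p < rg u 4 \<longrightarrow> \<not> frac (fd u 8) p"
                using u(6,9) t' i by (auto simp: frac_def)
              show "\<forall>p. p \<notin> H \<longrightarrow> fd u 8 p = 0"
                using u(9) t' i by (auto simp: frac_def)
              show "K + E + 28 * card H
                \<le> m - 2 * length ys + 3 * energy (fd u 8) + length rest + rg u 4"
                using k3 u(6,8) t' by simp
            qed (use u t' i lt in auto)
            then show "?I u (m - 2 * length ys)" by blast
          qed (use t' i ys F xs in \<open>auto\<close>)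
        qed
        have push: "wp D push_prog ?I t' m"
          if t': "fd t' = fd t" "rg t' 5 = x" "rg t' 6 = a" "rg t' 7 = b" "rg t' 4 = rg t 4"
            "rg t' 3 = E" and f: "a \<notin> set xs" "b \<notin> set xs" for t' :: state
        proof -
          define y where "y = (if frac (fd t 8) a then a else b)"
          have y: "path (fd t 8) (y # xs)"
            using path_extend[of "fd t 8" x zs y] i xs f by (auto simp: y_def a_def b_def)
          then have "y \<in> H" "y \<notin> set xs" using self_orb by auto
          have res: "?I u m"
            if u: "fd u = (fd t)(11 := (fd t 11)(y := 1), 12 := (fd t 12)(y := x))"
              "rg u 5 = y" "rg u 4 = rg t 4" "rg u 3 = E" for u :: state
          proof -
            have "linked ((fd t 12)(y := x)) xs"
              by (rule linked_cong[of "fd t 12"]) (use i \<open>y \<notin> set xs\<close> in auto)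
            then have "linked ((fd t 12)(y := x)) (y # xs)" using xs by simp
            then have "walk_inv L E K (fd s) (y # xs) u m"
              using i u lt km y unfolding walk_inv_def
              by (auto simp: marked_def simp del: path.simps linked.simps)
            then show ?thesis by blast
          qed
          show ?thesis
          proof (rule push_prog)
            show "fd t' 8 (rg t' 6) \<le> 3" using i balanced_le ab t' by auto
            show "y = (if frac (fd t' 8) (rg t' 6) then rg t' 6 else rg t' 7)"
              using t' by (simp add: y_def)
          qed (use t' res in simp)
        qed
        show ?thesis
        proof (rule step_prog)
          show "a = fd t 5 (fd t 10 (rg t 5))" "b = fd t 5 a" using fdt by simp_all
          show "a \<noteq> 0" "b \<noteq> 0" using ab zeroH by metis+
          show "wp D cancel_prog ?I u m"
            if "fd u = fd t" "rg u 5 = rg t 5" "rg u 8 = f" "rg u 4 = rg t 4" "rg u 3 = rg t 3"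
              "f = a \<or> f = b" "fd t 11 f \<noteq> 0" for u f
          proof (rule canc)
            show "f \<in> set xs" using that(6,7) onab by auto
          qed (use that fdt i in auto)
          show "wp D push_prog ?I u m"
            if "fd u = fd t" "rg u 5 = rg t 5" "rg u 6 = a" "rg u 7 = b" "rg u 4 = rg t 4"
              "rg u 3 = rg t 3" "fd t 11 a = 0" "fd t 11 b = 0" for u
            by (rule push) (use that fdt i onab in auto)
        qed
      qed
      moreover have "rg t 5 = hd0 xs" "\<And>x zs. xs = x # zs \<Longrightarrow> x \<in> H" using i by auto
      ultimately have "wp D (Cond (Vr 5) step_prog start_prog) ?I t m"
        using zeroH by (cases xs) (auto intro!: wp_Cond)
      then show "0 < k \<and> wp D (Cond (Vr 5) step_prog start_prog) ?I t (k - 1)" by (simp add: km)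
    }
  qed (use that in auto)
  have "walk_inv L E K (fd s) [] t k"
    if "fd t = fd s" "rg t 4 = L" "rg t 5 = 0" "rg t 3 = E" for t :: state
    using that w on r k by (auto simp: walk_inv_def marked_def)
  then show ?thesis
    unfolding walk_prog_def using r by (intro wp_Seq wp_Asg main exI[of _ "[]"]) auto
qed

end

section \<open>Contracting triangles\<close>

locale slots =
  fixes n :: nat and S :: "nat set" and ow nb nx0 tw :: "nat \<Rightarrow> nat"
  assumes finS: "finite S" and zeroS: "0 \<notin> S"
    and nx0_in: "\<And>p. p \<in> S \<Longrightarrow> nx0 p \<in> S" and nx0_3: "\<And>p. p \<in> S \<Longrightarrow> nx0 (nx0 (nx0 p)) = p"
    and nx0_ne: "\<And>p. p \<in> S \<Longrightarrow> nx0 p \<noteq> p" and ow_nx0: "\<And>p. p \<in> S \<Longrightarrow> ow (nx0 p) = ow p"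
    and ow_eq: "\<And>p q. p \<in> S \<Longrightarrow> q \<in> S \<Longrightarrow> ow q = ow p \<Longrightarrow> q = p \<or> q = nx0 p \<or> q = nx0 (nx0 p)"
    and tw_in: "\<And>p. p \<in> S \<Longrightarrow> tw p \<in> S" and tw_tw: "\<And>p. p \<in> S \<Longrightarrow> tw (tw p) = p"
    and ow_tw: "\<And>p. p \<in> S \<Longrightarrow> ow (tw p) = nb p" and nb_ne: "\<And>p. p \<in> S \<Longrightarrow> nb p \<noteq> ow p"
    and simple: "\<And>p q. p \<in> S \<Longrightarrow> q \<in> S \<Longrightarrow> ow p = ow q \<Longrightarrow> nb p = nb q \<Longrightarrow> p = q"
    and ow_lt: "\<And>p. p \<in> S \<Longrightarrow> ow p < n" and ex_slot: "\<And>v. v < n \<Longrightarrow> \<exists>p\<in>S. ow p = v"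
begin

lemma nb_tw: "p \<in> S \<Longrightarrow> nb (tw p) = ow p"
  using ow_tw[of "tw p"] tw_in tw_tw by simp

lemma nb_lt: "p \<in> S \<Longrightarrow> nb p < n"
  using ow_lt[OF tw_in] ow_tw by simp

definition adj :: "nat \<Rightarrow> nat \<Rightarrow> bool" where
  "adj u v \<longleftrightarrow> (\<exists>p\<in>S. ow p = u \<and> nb p = v)"

lemma adj_sym: "adj u v \<Longrightarrow> adj v u"
  unfolding adj_def using tw_in ow_tw nb_tw by blast

lemma adj_ne: "adj u v \<Longrightarrow> u \<noteq> v"
  unfolding adj_def using nb_ne by metis

lemma adj_slot: "p \<in> S \<Longrightarrow> adj (ow p) (nb p)"
  unfolding adj_def by blast

(* The structure after contracting the triangles on the vertices v with cl v <> 0: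
   w is 1 on the slots that leave a contracted vertex, nx permutes these three slots cyclically. *)
definition contr :: "(nat \<Rightarrow> nat) \<Rightarrow> (nat \<Rightarrow> nat) \<Rightarrow> (nat \<Rightarrow> nat) \<Rightarrow> bool" where
  "contr nx w cl \<longleftrightarrow>
     (\<forall>p\<in>S. w p = 0 \<or> w p = 1) \<and>
     (\<forall>p\<in>S. cl (ow p) = 0 \<longrightarrow> w p = 1 \<and> nx p = nx0 p) \<and>
     (\<forall>v<n. cl v \<noteq> 0 \<longrightarrow> (\<exists>!p. p \<in> S \<and> ow p = v \<and> w p = 1)) \<and>
     (\<forall>p\<in>S. w p = 1 \<and> cl (ow p) \<noteq> 0 \<longrightarrow>
        nx p \<in> S \<and> w (nx p) = 1 \<and> cl (ow (nx p)) \<noteq> 0 \<and> nx (nx (nx p)) = p \<and>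
        ow (nx p) \<noteq> ow p \<and> ow (nx (nx p)) \<noteq> ow p \<and> adj (ow p) (ow (nx p)) \<and>
        nb p \<noteq> ow (nx p) \<and> nb p \<noteq> ow (nx (nx p))) \<and>
     (\<forall>p\<in>S. w (tw p) = w p)"

lemma contr_init: "(\<And>p. p \<in> S \<Longrightarrow> w p = 1) \<Longrightarrow> (\<And>p. p \<in> S \<Longrightarrow> nx p = nx0 p) \<Longrightarrow> contr nx w (\<lambda>_. 0)"
  by (auto simp: contr_def tw_in)

lemma slots_of:
  assumes "p \<in> S" "q \<in> S" "r \<in> S" "ow q = ow p" "ow r = ow p" "p \<noteq> q" "p \<noteq> r" "q \<noteq> r" "s \<in> S"
  shows "ow s = ow p \<longleftrightarrow> s = p \<or> s = q \<or> s = r"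
  using ow_eq[OF assms(1,2)] ow_eq[OF assms(1,3)] ow_eq[OF assms(1,9)] assms by auto

text \<open>All updates write the same value, so membership in a set replaces them and their order
  and overlaps do not matter.\<close>

lemma upd_zero:
  "w(a := 0, b := 0, c := 0, d := 0, e := 0, f := 0) = (\<lambda>s. if s \<in> {a, b, c, d, e, f} then 0 else w s)"
  by (rule ext) (simp only: fun_upd_apply insert_iff empty_iff, presburger)

text \<open>The triangle has the nodes \<open>a = ow p\<close>, \<open>b = nb p\<close>,
  \<open>c = nb q\<close>, and \<open>p\<close>, \<open>q\<close>, \<open>x\<close> lead from
  \<open>a\<close> to \<open>b\<close>, from \<open>a\<close> to \<open>c\<close> and from
  \<open>b\<close> to \<open>c\<close>. These slots and their reverses get weight 0; the third slots
  \<open>r\<close>, \<open>y\<close>, \<open>t\<close> of the nodes become the three slots of the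
  contracted node. The complete graph on four nodes shows that parallel edges can arise.\<close>

lemma contract_step:
  assumes c: "contr nx w cl"
    and p: "p \<in> S" "q = nx p" "r = nx q" and cl: "cl (ow p) = 0" "cl (nb p) = 0" "cl (nb q) = 0"
    and x: "x \<in> S" "y \<in> S" "ow x = nb p" "ow y = nb p" "x \<noteq> tw p" "y \<noteq> tw p" "x \<noteq> y" "nb x = nb q"
    and t: "t \<in> S" "ow t = nb q" "t \<noteq> tw q" "t \<noteq> tw x"
  shows "contr (nx(r := y, y := t, t := r))
    (w(p := 0, tw p := 0, q := 0, tw q := 0, x := 0, tw x := 0))
    (cl(ow p := 1, nb p := 1, nb q := 1))"
proof -
  define a b c where abc: "a = ow p" "b = nb p" "c = nb q"
  define p' q' z where pqz: "p' = tw p" "q' = tw q" "z = tw x"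
  have q: "q = nx0 p" "q \<in> S" using assms(1) p cl nx0_in by (auto simp: contr_def)
  have r: "r = nx0 q" "r \<in> S" using assms(1) p cl nx0_in q ow_nx0 by (auto simp: contr_def)
  have S9: "p' \<in> S" "q' \<in> S" "z \<in> S" using tw_in p q x by (auto simp: pqz)
  have own: "ow q = a" "ow r = a" "ow p' = b" "ow x = b" "ow y = b" "ow q' = c" "ow z = c" "ow t = c"
    "nb p' = a" "nb q' = a" "nb z = b" "nb x = c"
    using ow_nx0[OF p(1)] ow_nx0[OF q(2)] ow_tw[OF p(1)] ow_tw[OF q(2)] ow_tw[OF x(1)]
      nb_tw[OF p(1)] nb_tw[OF q(2)] nb_tw[OF x(1)] q(1) r(1) x t
    by (auto simp: abc pqz)
  have dpq: "p \<noteq> q" "q \<noteq> r" "p \<noteq> r"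
    using nx0_ne[OF p(1)] nx0_ne[OF q(2)] nx0_3[OF p(1)] nx0_ne[OF r(2)] q r by auto
  have d: "a \<noteq> b" "a \<noteq> c" "b \<noteq> c"
    using nb_ne[OF p(1)] nb_ne[OF q(2)] simple[OF p(1) q(2)] own dpq unfolding abc by metis+
  have dz: "z \<noteq> q'" using own d by auto
  have dne: "p' \<noteq> x" "p' \<noteq> y" "q' \<noteq> t" "z \<noteq> t" using x(5,6) t(3,4) by (auto simp: pqz)
  have A: "ow s = a \<longleftrightarrow> s = p \<or> s = q \<or> s = r" if "s \<in> S" for s
    using slots_of[OF p(1) q(2) r(2) _ _ dpq(1,3,2) that] own by (simp add: abc)
  have B: "ow s = b \<longleftrightarrow> s = p' \<or> s = x \<or> s = y" if "s \<in> S" for s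
    using slots_of[OF S9(1) x(1,2) _ _ dne(1,2) x(7) that] own by simp
  have C: "ow s = c \<longleftrightarrow> s = q' \<or> s = z \<or> s = t" if "s \<in> S" for s
    using slots_of[OF S9(2,3) t(1) _ _ dz[symmetric] dne(3,4) that] own by simp
  have twz: "tw s \<in> {p, p', q, q', x, z} \<longleftrightarrow> s \<in> {p, p', q, q', x, z}" if "s \<in> S" for s
  proof -
    have e: "tw s = u \<longleftrightarrow> s = tw u" if "u \<in> S" for u using tw_tw[OF \<open>s \<in> S\<close>] tw_tw[OF that] by metis
    have "tw p' = p" "tw q' = q" "tw z = x" using tw_tw p(1) q(2) x(1) by (simp_all add: pqz)
    then show ?thesis
      using e[OF p(1)] e[OF q(2)] e[OF x(1)] e[OF S9(1)] e[OF S9(2)] e[OF S9(3)]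
      unfolding pqz[symmetric] by blast
  qed
  define Z where "Z = {p, p', q, q', x, z}"
  define w' where "w' = (\<lambda>s. if s \<in> Z then 0 else w s)"
  have w': "w(p := 0, tw p := 0, q := 0, tw q := 0, x := 0, tw x := 0) = w'"
  proof -
    have "w(p := 0, p' := 0, q := 0, q' := 0, x := 0, z := 0) = w'"
      by (simp only: upd_zero w'_def Z_def)
    then show ?thesis by (simp only: pqz)
  qed
  have ryt: "r \<notin> Z" "y \<notin> Z" "t \<notin> Z"
    unfolding Z_def using own abc(1) d dpq dne dz x(7) by auto
  have owZ: "ow s \<in> {a, b, c}" if "s \<in> Z" for s
    using that own abc(1) unfolding Z_def by auto
  have inZ: "s \<in> Z \<or> s = r \<or> s = y \<or> s = t" if "s \<in> S" "ow s \<in> {a, b, c}" for s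
    using that A[of s] B[of s] C[of s] by (auto simp: Z_def)
  have cla: "cl a = 0" "cl b = 0" "cl c = 0" using cl by (simp_all only: abc)
  have "w s = 1" if "s \<in> S" "cl (ow s) = 0" for s
    using c that unfolding contr_def by blast
  then have w1: "w r = 1" "w y = 1" "w t = 1"
    using r(2) x(2) t(1) own cla by simp_all
  \<comment> \<open>Two slots of a node never have the same neighbour, so the third one leads out of
    the triangle and becomes no loop.\<close>
  have nbr: "nb r \<noteq> b" "nb r \<noteq> c"
    using simple[OF r(2) p(1)] simple[OF r(2) q(2)] own(1,2) dpq unfolding abc by metis+
  have nby: "nb y \<noteq> a" "nb y \<noteq> c"
    using simple[OF x(2) S9(1)] simple[OF x(2,1)] own x(7) dne by metis+
  have nbt: "nb t \<noteq> a" "nb t \<noteq> b"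
    using simple[OF t(1) S9(2)] simple[OF t(1) S9(3)] own dne by metis+
  have adjs: "adj a b" "adj b c" "adj c a"
    using own adj_slot[OF p(1)] adj_slot[OF x(1)] adj_slot[OF S9(2)] unfolding abc by metis+
  define nx' where "nx' = nx(r := y, y := t, t := r)"
  have ryt': "r \<noteq> y" "r \<noteq> t" "y \<noteq> t" using own d by auto
  have nx'1: "nx' r = y" "nx' y = t" "nx' t = r" using ryt' by (auto simp: nx'_def)
  have nx'2: "nx' s = nx s" if "ow s \<notin> {a, b, c}" for s
    using that own by (auto simp: nx'_def)
  have w'2: "w' s = w s" if "ow s \<notin> {a, b, c}" for s
    using that owZ by (auto simp: w'_def)
  have w'1: "w' r = 1" "w' y = 1" "w' t = 1" using ryt w1 by (auto simp: w'_def)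
  define cl' where "cl' = cl(a := 1, b := 1, c := 1)"
  have cl'1: "cl' a \<noteq> 0" "cl' b \<noteq> 0" "cl' c \<noteq> 0" by (auto simp: cl'_def)
  have cl'2: "cl' v = cl v" if "v \<notin> {a, b, c}" for v using that by (auto simp: cl'_def)
  have abcS: "a = ow p" "b = ow p'" "c = ow q'" using own abc by auto
  have "contr nx' w' cl'"
    unfolding contr_def
  proof (intro conjI ballI allI impI)
    fix s assume s: "s \<in> S"
    show "w' s = 0 \<or> w' s = 1" using assms(1) s by (auto simp: contr_def w'_def)
    show "w' (tw s) = w' s"
      using assms(1) s twz[OF s] by (auto simp: contr_def w'_def Z_def[symmetric])
  next
    fix s assume s: "s \<in> S" "cl' (ow s) = 0"
    then have "ow s \<notin> {a, b, c}" using cl'1 by auto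
    then show "w' s = 1"
      using assms(1) s w'2 cl'2 by (auto simp: contr_def)
    show "nx' s = nx0 s"
      using nx'2[OF \<open>ow s \<notin> {a, b, c}\<close>] cl'2[OF \<open>ow s \<notin> {a, b, c}\<close>] assms(1) s
      by (auto simp: contr_def)
  next
    fix v assume v: "v < n" "cl' v \<noteq> 0"
    show "\<exists>!p. p \<in> S \<and> ow p = v \<and> w' p = 1"
    proof (cases "v \<in> {a, b, c}")
      case True
      have "\<exists>!s. s \<in> S \<and> ow s = a \<and> w' s = 1"
        by (rule ex1I[of _ r]) (use own r w'1 A in \<open>auto simp: w'_def Z_def\<close>)
      moreover have "\<exists>!s. s \<in> S \<and> ow s = b \<and> w' s = 1"
        by (rule ex1I[of _ y]) (use own x w'1 B in \<open>auto simp: w'_def Z_def\<close>)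
      moreover have "\<exists>!s. s \<in> S \<and> ow s = c \<and> w' s = 1"
        by (rule ex1I[of _ t]) (use own t w'1 C in \<open>auto simp: w'_def Z_def\<close>)
      ultimately show ?thesis using True by blast
    next
      case False
      then have "\<exists>!p. p \<in> S \<and> ow p = v \<and> w p = 1"
        using assms(1) v cl'2 by (auto simp: contr_def)
      moreover have "(p \<in> S \<and> ow p = v \<and> w' p = 1) \<longleftrightarrow> (p \<in> S \<and> ow p = v \<and> w p = 1)" for p
        using False w'2[of p] by auto
      ultimately show ?thesis by simp
    qed
  next
    fix s assume s: "s \<in> S" and ws: "w' s = 1 \<and> cl' (ow s) \<noteq> 0"
    have "nx' s \<in> S \<and> w' (nx' s) = 1 \<and> cl' (ow (nx' s)) \<noteq> 0 \<and> nx' (nx' (nx' s)) = s \<and>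
      ow (nx' s) \<noteq> ow s \<and> ow (nx' (nx' s)) \<noteq> ow s \<and> adj (ow s) (ow (nx' s)) \<and>
      nb s \<noteq> ow (nx' s) \<and> nb s \<noteq> ow (nx' (nx' s))"
    proof (cases "ow s \<in> {a, b, c}")
      case True
      then have "s = r \<or> s = y \<or> s = t" using inZ[OF s True] ws by (auto simp: w'_def)
      then show ?thesis
        by (elim disjE) (simp_all add: nx'1 w'1 cl'1 own(2,5,8) d d[symmetric] adjs nbr nby nbt
            r(2) x(2) t(1))
    next
      case False
      have *: "u \<notin> {a, b, c}" if "cl u \<noteq> 0" for u using that cl by (auto simp: abc)
      have cls: "w s = 1 \<and> cl (ow s) \<noteq> 0" using False ws w'2 cl'2 by simp
      then have 1: "nx s \<in> S" "w (nx s) = 1" "cl (ow (nx s)) \<noteq> 0" "nx (nx (nx s)) = s"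
        "ow (nx s) \<noteq> ow s" "ow (nx (nx s)) \<noteq> ow s" "adj (ow s) (ow (nx s))"
        "nb s \<noteq> ow (nx s)" "nb s \<noteq> ow (nx (nx s))"
        using assms(1) s unfolding contr_def by blast+
      then have 2: "cl (ow (nx (nx s))) \<noteq> 0"
        using assms(1) unfolding contr_def by blast
      show ?thesis
        using 1 nx'2[OF False] nx'2[OF *[OF 1(3)]] nx'2[OF *[OF 2]] w'2[OF *[OF 1(3)]]
          cl'2[OF *[OF 1(3)]] by simp
    qed
    then show "nx' s \<in> S" "w' (nx' s) = 1" "cl' (ow (nx' s)) \<noteq> 0" "nx' (nx' (nx' s)) = s"
      "ow (nx' s) \<noteq> ow s" "ow (nx' (nx' s)) \<noteq> ow s" "adj (ow s) (ow (nx' s))"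
      "nb s \<noteq> ow (nx' s)" "nb s \<noteq> ow (nx' (nx' s))" by blast+
  qed
  then show ?thesis by (simp add: w' nx'_def cl'_def abc)
qed

text \<open>From here on single nodes and contracted triangles look alike: three slots of weight 1,
  rotated by \<open>nx\<close>. They are called a class below.\<close>

lemma contr_orbit:
  assumes "contr nx w cl" "p \<in> S" "w p = 1"
  shows "nx p \<in> S" "w (nx p) = 1" "nx (nx (nx p)) = p" "nx p \<noteq> p"
    "cl (ow (nx p)) = 0 \<longleftrightarrow> cl (ow p) = 0"
    "cl (ow p) = 0 \<Longrightarrow> ow (nx p) = ow p"
proof -
  have u: "nx q = nx0 q \<and> w q = 1" if "q \<in> S" "cl (ow q) = 0" for q
    using assms(1) that unfolding contr_def by blast
  have cl: "nx q \<in> S \<and> w (nx q) = 1 \<and> cl (ow (nx q)) \<noteq> 0 \<and> nx (nx (nx q)) = q \<and> ow (nx q) \<noteq> ow q"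
    if "q \<in> S" "w q = 1" "cl (ow q) \<noteq> 0" for q
    using assms(1) that unfolding contr_def by blast
  have "nx p \<in> S \<and> w (nx p) = 1 \<and> nx (nx (nx p)) = p \<and> nx p \<noteq> p \<and> ow (nx p) = ow p" if "cl (ow p) = 0"
    using u[OF assms(2) that] u[of "nx0 p"] u[of "nx0 (nx0 p)"] that nx0_in ow_nx0 nx0_3 nx0_ne assms(2)
    by simp
  with cl[OF assms(2,3)]
  show "nx p \<in> S" "w (nx p) = 1" "nx (nx (nx p)) = p" "nx p \<noteq> p"
    "cl (ow (nx p)) = 0 \<longleftrightarrow> cl (ow p) = 0"
    "cl (ow p) = 0 \<Longrightarrow> ow (nx p) = ow p" by metis+
qed

text \<open>\<open>M\<close> is the set of slots selected by the matching: \<open>p\<close> is the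
  way out of its class, and the slot with selected reverse is the way in. If this is
  \<open>p\<close> as well, the nodes of \<open>a\<close> and \<open>b\<close> are swapped.
  Otherwise the route from the way in to the way out passes through the third node.\<close>

definition sig_spec :: "(nat \<Rightarrow> nat) \<Rightarrow> (nat \<Rightarrow> nat) \<Rightarrow> (nat \<Rightarrow> bool) \<Rightarrow> (nat \<Rightarrow> nat) \<Rightarrow> nat \<Rightarrow> bool" where
  "sig_spec nx cl M sg p \<longleftrightarrow> sg (ow p) = nb p \<and> (cl (ow p) \<noteq> 0 \<longrightarrow>
     (let a = nx p; b = nx a in
      if M (tw p) then sg (ow a) = ow b \<and> sg (ow b) = ow a
      else if M (tw a) then sg (ow a) = ow b \<and> sg (ow b) = ow p
      else sg (ow b) = ow a \<and> sg (ow a) = ow p))"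

definition maximal :: "(nat \<Rightarrow> nat) \<Rightarrow> bool" where
  "maximal cl \<longleftrightarrow> (\<forall>a b c. adj a b \<longrightarrow> adj b c \<longrightarrow> adj c a \<longrightarrow> cl a \<noteq> 0 \<or> cl b \<noteq> 0 \<or> cl c \<noteq> 0)"

text \<open>A cycle of length 3 would be a triangle, so by maximality it would contain a node of a
  contracted one, and \<open>cl3\<close> excludes this. Every node has a preimage: the way in has
  one outside the class, the others within it. On a finite set this makes \<open>sg\<close>
  injective.\<close>

lemma sigma:
  assumes c: "contr nx w cl" and mx: "maximal cl"
    and out: "\<And>p. p \<in> S \<Longrightarrow> w p = 1 \<Longrightarrow> M p \<or> M (nx p) \<or> M (nx (nx p))"
    and inn: "\<And>p. p \<in> S \<Longrightarrow> w p = 1 \<Longrightarrow> M (tw p) \<or> M (tw (nx p)) \<or> M (tw (nx (nx p)))"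
    and M: "\<And>p. M p \<Longrightarrow> p \<in> S \<and> w p = 1"
    and sg: "\<And>p. M p \<Longrightarrow> sig_spec nx cl M sg p"
  shows "\<And>v. v < n \<Longrightarrow> adj v (sg v)" "sg ` {..<n} = {..<n}"
    "\<And>v. v < n \<Longrightarrow> sg (sg (sg v)) \<noteq> v"
proof -
  have free: "\<exists>p. M p \<and> ow p = v" "\<exists>p. M (tw p) \<and> p \<in> S \<and> ow p = v" if v: "v < n" "cl v = 0" for v
  proof -
    obtain p where p: "p \<in> S" "ow p = v" using ex_slot[OF v(1)] by blast
    have w: "w p = 1" using c p v unfolding contr_def by blast
    note 1 = contr_orbit[OF c p(1) w]
    note 2 = contr_orbit[OF c 1(1,2)]
    have o: "ow (nx p) = v" "ow (nx (nx p)) = v" using 1(6) 2(6) p v by auto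
    show "\<exists>p. M p \<and> ow p = v" using out[OF p(1) w] o p by blast
    show "\<exists>p. M (tw p) \<and> p \<in> S \<and> ow p = v" using inn[OF p(1) w] o p 1 2 by blast
  qed
  have adjM: "sg (ow (tw p)) = ow p" if "M (tw p)" "p \<in> S" for p
    using sg[OF that(1)] nb_tw[OF that(2)] by (simp add: sig_spec_def)
  \<comment> \<open>\<open>x\<close> owns the way out. If the way in is elsewhere, \<open>y\<close>
    is chosen to own it; exchanging \<open>y\<close> and \<open>z\<close> thus merges two of the
    three cases of \<open>sig_spec\<close>.\<close>
  have claimed: "\<exists>x y z. M x \<and> sg (ow x) = nb x \<and> nb x \<notin> {ow x, ow y, ow z} \<and> v \<in> {ow x, ow y, ow z} \<and>
      ow x \<noteq> ow y \<and> ow x \<noteq> ow z \<and> ow y \<noteq> ow z \<and> adj (ow x) (ow y) \<and> adj (ow y) (ow z) \<and> adj (ow z) (ow x) \<and>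
      x \<in> S \<and> y \<in> S \<and> z \<in> S \<and>
      (M (tw x) \<and> sg (ow y) = ow z \<and> sg (ow z) = ow y \<or>
       M (tw y) \<and> sg (ow y) = ow z \<and> sg (ow z) = ow x)"
    if v: "v < n" "cl v \<noteq> 0" for v
  proof -
    obtain p where p: "p \<in> S" "ow p = v" "w p = 1" using c v unfolding contr_def by blast
    have nxS: "nx s \<in> S" "w (nx s) = 1" "cl (ow (nx s)) \<noteq> 0" "nx (nx (nx s)) = s"
      "ow (nx s) \<noteq> ow s" "ow (nx (nx s)) \<noteq> ow s" "adj (ow s) (ow (nx s))"
      "nb s \<noteq> ow (nx s)" "nb s \<noteq> ow (nx (nx s))" if "s \<in> S" "w s = 1" "cl (ow s) \<noteq> 0" for s
      using c that unfolding contr_def by blast+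
    note p1 = nxS[OF p(1,3)] note p2 = nxS[OF p1(1,2,3)]
    obtain x where x: "M x" "cl (ow x) \<noteq> 0" "v \<in> {ow x, ow (nx x), ow (nx (nx x))}"
      using out[OF p(1,3)] p v p1 p2 by (metis insertCI)
    have xS: "x \<in> S" "w x = 1" using M[OF x(1)] by auto
    define y z where yz: "y = nx x" "z = nx y"
    note x1 = nxS[OF xS x(2)] note y1 = nxS[OF x1(1,2,3)] note z1 = nxS[OF y1(1,2,3)]
    have zx: "nx z = x" using x1 by (simp add: yz)
    have a: "adj (ow x) (ow y)" "adj (ow y) (ow z)" "adj (ow z) (ow x)"
      using x1 y1 z1 by (simp_all add: yz)
    have i: "M (tw x) \<or> M (tw y) \<or> M (tw z)" using inn[OF xS] by (simp add: yz)
    have s: "sg (ow x) = nb x" "M (tw x) \<Longrightarrow> sg (ow y) = ow z \<and> sg (ow z) = ow y"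
      "\<not> M (tw x) \<Longrightarrow> M (tw y) \<Longrightarrow> sg (ow y) = ow z \<and> sg (ow z) = ow x"
      "\<not> M (tw x) \<Longrightarrow> \<not> M (tw y) \<Longrightarrow> sg (ow z) = ow y \<and> sg (ow y) = ow x"
      using sg[OF x(1)] x(2) by (simp_all add: sig_spec_def Let_def yz)
    have ne: "nb x \<notin> {ow x, ow y, ow z}" "nb x \<notin> {ow x, ow z, ow y}" using nb_ne[OF xS(1)] x1 by (auto simp: yz)
    have d: "ow x \<noteq> ow y" "ow x \<noteq> ow z" "ow y \<noteq> ow z" using x1 y1 by (auto simp: yz)
    have S: "y \<in> S" "z \<in> S" using x1 y1 by (auto simp: yz)
    consider "M (tw x)" | "\<not> M (tw x)" "M (tw y)" | "\<not> M (tw x)" "\<not> M (tw y)" "M (tw z)" using i by blast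
    then show ?thesis
    proof cases
      case 1
      then show ?thesis using x s ne d a S xS by (intro exI[of _ x] exI[of _ y] exI[of _ z]) (auto simp: yz)
    next
      case 2
      then show ?thesis using x s ne d a S xS by (intro exI[of _ x] exI[of _ y] exI[of _ z]) (auto simp: yz)
    next
      case 3
      then show ?thesis using x s ne d a S xS adj_sym[OF a(1)] adj_sym[OF a(2)] adj_sym[OF a(3)]
        by (intro exI[of _ x] exI[of _ z] exI[of _ y]) (auto simp: yz)
    qed
  qed
  show adj: "adj v (sg v)" if vn: "v < n" for v
  proof (cases "cl v = 0")
    case True
    then obtain p where "M p" "ow p = v" using free(1)[OF vn] by blast
    then show ?thesis using sg[of p] M[of p] adj_slot[of p] by (auto simp: sig_spec_def)
  next
    case False
    obtain x y z where "x \<in> S" "sg (ow x) = nb x" "v \<in> {ow x, ow y, ow z}"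
      "adj (ow x) (ow y)" "adj (ow y) (ow z)" "adj (ow z) (ow x)"
      "(sg (ow y) = ow z \<and> sg (ow z) = ow y) \<or> (sg (ow y) = ow z \<and> sg (ow z) = ow x)"
      using claimed[OF vn False] by blast
    then show ?thesis using adj_slot[of x] adj_sym by auto
  qed
  have lt: "u < n \<and> v < n" if "adj u v" for u v
    using that ow_lt nb_lt by (auto simp: adj_def)
  have "v \<in> sg ` {..<n}" if v: "v < n" for v
  proof (cases "cl v = 0")
    case True
    then obtain p where "M (tw p)" "p \<in> S" "ow p = v" using free(2)[OF v] by blast
    then show ?thesis using adjM[of p] tw_in[of p] ow_lt by force
  next
    case False
    obtain x y z where "x \<in> S" "y \<in> S" "z \<in> S" "v \<in> {ow x, ow y, ow z}"
      "M (tw x) \<and> sg (ow y) = ow z \<and> sg (ow z) = ow y \<or>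
       M (tw y) \<and> sg (ow y) = ow z \<and> sg (ow z) = ow x"
      using claimed[OF v False] by blast
    then show ?thesis
      using adjM[of x] adjM[of y] tw_in ow_lt by (auto simp: image_iff) (metis lessThan_iff)+
  qed
  then show surj: "sg ` {..<n} = {..<n}" using adj lt by blast
  then have inj: "inj_on sg {..<n}"
    by (intro eq_card_imp_inj_on) auto
  \<comment> \<open>In the first case \<open>ow x\<close> and \<open>nb x\<close> are swapped, and
    so are the other two nodes. In the second case the nodes of \<open>y\<close>, \<open>z\<close>,
    \<open>x\<close> and then \<open>nb x\<close> follow one another and are four different
    nodes.\<close>
  have cl3: "sg (sg (sg v)) \<noteq> v" if v: "v < n" "cl v \<noteq> 0" for v
  proof
    assume cube: "sg (sg (sg v)) = v"
    obtain x y z where xyz: "x \<in> S" "y \<in> S" "z \<in> S" "v \<in> {ow x, ow y, ow z}" "sg (ow x) = nb x"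
      "nb x \<notin> {ow x, ow y, ow z}" "ow x \<noteq> ow y" "ow x \<noteq> ow z" "ow y \<noteq> ow z"
      and cs: "M (tw x) \<and> sg (ow y) = ow z \<and> sg (ow z) = ow y \<or>
       M (tw y) \<and> sg (ow y) = ow z \<and> sg (ow z) = ow x"
      using claimed[OF v] by blast
    have l: "ow x < n" "ow y < n" "ow z < n" "nb x < n" "sg (nb x) < n"
      using xyz(1-3) ow_lt nb_lt adj[of "nb x"] lt[of "nb x"] by simp_all
    have I: "u = u'" if "sg u = sg u'" "u < n" "u' < n" for u u'
      using inj that by (auto dest: inj_onD)
    from cs show False
    proof
      assume *: "M (tw x) \<and> sg (ow y) = ow z \<and> sg (ow z) = ow y"
      have "v = ow x" using xyz cube * by auto
      then have "sg (sg (nb x)) = sg (nb x)"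
        using cube xyz(5) adjM[of x] ow_tw[OF xyz(1)] * xyz(1) I[of "sg (nb x)" "nb x"] l by simp
      then show False using adj[OF l(5)] adj_ne by fastforce
    next
      assume *: "M (tw y) \<and> sg (ow y) = ow z \<and> sg (ow z) = ow x"
      consider "v = ow x" | "v = ow y" | "v = ow z" using xyz(4) by blast
      then show False
      proof cases
        case 1
        then have "sg (nb x) = ow z" using cube xyz(5) * I[of "sg (nb x)" "ow z"] l by simp
        then have "nb x = ow y" using * I[of "nb x" "ow y"] l by simp
        then show False using xyz by blast
      next
        case 2
        then show False using cube * xyz by auto
      next
        case 3
        then have "nb x = ow y" using cube xyz(5) * I[of "nb x" "ow y"] l by simp
        then show False using xyz by blast
      qed
    qed
  qed
  show "sg (sg (sg v)) \<noteq> v" if v: "v < n" for v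
  proof
    assume 3: "sg (sg (sg v)) = v"
    have l: "sg v < n" "sg (sg v) < n" using adj lt v by blast+
    have "adj v (sg v)" "adj (sg v) (sg (sg v))" "adj (sg (sg v)) v"
      using adj[OF v] adj[OF l(1)] adj[OF l(2)] 3 by auto
    then have "cl v \<noteq> 0 \<or> cl (sg v) \<noteq> 0 \<or> cl (sg (sg v)) \<noteq> 0" using mx unfolding maximal_def by blast
    then show False using cl3[OF v] cl3[OF l(1)] cl3[OF l(2)] 3 by auto
  qed
qed

end

section \<open>The phases of the program\<close>

inductive_cases big_SkipE: "big D Skip s t s'"
inductive_cases big_AsgE: "big D (Asg x e) s t s'"
inductive_cases big_StoE: "big D (Sto f a e) s t s'"
inductive_cases big_SeqE: "big D (c ;; d) s t s'"
inductive_cases big_CondE: "big D (Cond e c d) s t s'"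

text \<open>As equations, the rules let the simplifier execute loop-free code.\<close>

lemma wp_simps:
  "wp D Skip Q s k \<longleftrightarrow> Q s k"
  "wp D (Asg x e) Q s k \<longleftrightarrow> ok D e s \<and> Q (set_var x (ev e s) s) k"
  "wp D (Sto f a e) Q s k \<longleftrightarrow> ok D (Ld f a) s \<and> ok D e s \<and> Q (set_fld f (ev a s) (ev e s) s) k"
  "wp D (c ;; d) Q s k \<longleftrightarrow> wp D c (wp D d Q) s k"
  "wp D (Cond e c d) Q s k \<longleftrightarrow> ok D e s \<and> (if ev e s = 0 then wp D d Q s k else wp D c Q s k)"
proof -
  show "wp D (c ;; d) Q s k \<longleftrightarrow> wp D c (wp D d Q) s k"
  proof
    assume "wp D (c ;; d) Q s k"
    then obtain t s' t' s'' where *: "big D c s t s'" "big D d s' t' s''" "t + t' \<le> k"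
      "Q s'' (k - (t + t'))"
      unfolding wp_def by (auto elim!: big_SeqE)
    then have "wp D d Q s' (k - t)"
      unfolding wp_def by (intro exI[of _ t'] exI[of _ s'']) auto
    then show "wp D c (wp D d Q) s k"
      using * unfolding wp_def[of D c] by (intro exI[of _ t] exI[of _ s']) auto
  qed (rule wp_Seq)
  show "wp D Skip Q s k \<longleftrightarrow> Q s k"
    by (rule iffI, (auto simp: wp_def elim!: big_SkipE)[1]) (rule wp_Skip)
  show "wp D (Asg x e) Q s k \<longleftrightarrow> ok D e s \<and> Q (set_var x (ev e s) s) k"
    by (rule iffI, (auto simp: wp_def elim!: big_AsgE)[1]) (rule wp_Asg, blast+)
  show "wp D (Sto f a e) Q s k \<longleftrightarrow> ok D (Ld f a) s \<and> ok D e s \<and> Q (set_fld f (ev a s) (ev e s) s) k"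
    by (rule iffI, (auto simp: wp_def elim!: big_StoE)[1]) (rule wp_Sto, blast+)
  show "wp D (Cond e c d) Q s k \<longleftrightarrow> ok D e s \<and> (if ev e s = 0 then wp D d Q s k else wp D c Q s k)"
  proof
    assume "wp D (Cond e c d) Q s k"
    then show "ok D e s \<and> (if ev e s = 0 then wp D d Q s k else wp D c Q s k)"
      unfolding wp_def by (auto elim!: big_CondE)
  qed (rule wp_Cond, auto split: if_splits)
qed

text \<open>The body has to return its whole budget, so it is meant to be loop-free and each value
  of the counter costs exactly 1.\<close>

lemma wp_for:
  assumes body: "\<And>p s k. L \<le> p \<Longrightarrow> p < E \<Longrightarrow> rg s x = p \<Longrightarrow> rg s y = E \<Longrightarrow> I p s \<Longrightarrow>
      wp D body (\<lambda>s' k'. k' = k \<and> rg s' x = p \<and> rg s' y = E \<and> I (Suc p) s') s k"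
    and upd: "\<And>p v s. I p s \<Longrightarrow> I p (set_var x v s)"
    and init: "I L s" "rg s x = L" "rg s y = E" "L \<le> E" "x \<noteq> y" "K + (E - L) \<le> k"
    and Q: "\<And>s' k'. I E s' \<Longrightarrow> K \<le> k' \<Longrightarrow> rg s' y = E \<Longrightarrow> Q s' k'"
  shows "wp D (While (Df (Vr x) (Vr y)) (body ;; Asg x (Sc (Vr x)))) Q s k"
proof (rule wp_While[where I = "\<lambda>s k. rg s y = E \<and> L \<le> rg s x \<and> rg s x \<le> E \<and> I (rg s x) s \<and>
      K + (E - rg s x) \<le> k"])
  fix s k
  assume i: "rg s y = E \<and> L \<le> rg s x \<and> rg s x \<le> E \<and> I (rg s x) s \<and> K + (E - rg s x) \<le> k"
    and "ev (Df (Vr x) (Vr y)) s \<noteq> 0"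
  then have lt: "rg s x < E" by auto
  have "wp D body (wp D (Asg x (Sc (Vr x))) (\<lambda>s k. rg s y = E \<and> L \<le> rg s x \<and> rg s x \<le> E \<and>
      I (rg s x) s \<and> K + (E - rg s x) \<le> k)) s (k - 1)"
  proof (rule wp_conseq[OF body[of "rg s x" s "k - 1"]])
    fix s' k' assume "k' = k - 1 \<and> rg s' x = rg s x \<and> rg s' y = E \<and> I (Suc (rg s x)) s'"
    then show "wp D (Asg x (Sc (Vr x))) (\<lambda>s k. rg s y = E \<and> L \<le> rg s x \<and> rg s x \<le> E \<and>
      I (rg s x) s \<and> K + (E - rg s x) \<le> k) s' k'"
      using i lt init(5) upd by (intro wp_Asg) auto
  qed (use i lt in auto)
  then show "0 < k \<and> wp D (body ;; Asg x (Sc (Vr x))) (\<lambda>s k. rg s y = E \<and> L \<le> rg s x \<and>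
      rg s x \<le> E \<and> I (rg s x) s \<and> K + (E - rg s x) \<le> k) s (k - 1)"
    using i lt by (auto intro: wp_Seq)
qed (use init Q in auto)

section \<open>Reading the input\<close>

definition slot_prog :: "exp \<Rightarrow> com" where
  "slot_prog e = Sto 2 (Vr 4) (Ld 0 (Vr 4)) ;; Sto 3 (Vr 4) (Vr 5) ;; Sto 5 (Vr 4) e ;;
     Sto 7 (Vr 4) (Vr 6) ;; Sto 8 (Vr 4) (Nm 1) ;; Asg 4 (Sc (Vr 4)) ;; Asg 6 (Sc (Vr 6))"

text \<open>The third slot closes the ring: its successor is the first slot, stored in field 4 just
  before.\<close>

definition vertex_prog :: com where
  "vertex_prog = Sto 4 (Vr 5) (Vr 4) ;; slot_prog (Sc (Vr 4)) ;; slot_prog (Sc (Vr 4)) ;;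
     slot_prog (Ld 4 (Vr 5))"

text \<open>Memory cell \<open>n + 1\<close> holds the address behind the last list,
  \<open>4 * n + 2\<close> for a cubic graph. The copies for the other side of the double cover are
  numbered from there.\<close>

definition init_prog :: com where
  "init_prog = Asg 2 (Ld 0 (Nm 0)) ;; Asg 0 (Sc (Sc (Vr 2))) ;; Asg 3 (Ld 0 (Sc (Vr 2))) ;;
     Asg 4 (Vr 0) ;; Asg 6 (Vr 3) ;; Asg 5 (Nm 0) ;;
     While (Df (Vr 5) (Vr 2)) (vertex_prog ;; Asg 5 (Sc (Vr 5)))"

definition init_inv :: "nat \<Rightarrow> (nat \<Rightarrow> nat) \<Rightarrow> nat \<Rightarrow> (nat \<Rightarrow> nat \<Rightarrow> nat) \<Rightarrow> bool" where
  "init_inv n raw v F \<longleftrightarrow> F 0 = raw \<and> (\<forall>u<v. F 4 u = n + 2 + 3 * u) \<and>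
     (\<forall>u<v. \<forall>i<3. let p = n + 2 + 3 * u + i in F 2 p = raw p \<and> F 3 p = u \<and>
        F 5 p = n + 2 + 3 * u + (if i = 2 then 0 else Suc i) \<and> F 7 p = p + 3 * n) \<and>
     (\<forall>p. F 8 p = of_bool (n + 2 \<le> p \<and> p < n + 2 + 3 * v))"

lemma slot_prog:
  assumes "rg s 4 = P" "P < D"
    and "\<And>t. rg t = rg s \<Longrightarrow> fd t 4 = fd s 4 \<Longrightarrow> ok D e t \<and> ev e t = x"
    and Q: "\<And>s'. fd s' = (fd s)(2 := (fd s 2)(P := fd s 0 P), 3 := (fd s 3)(P := rg s 5),
        5 := (fd s 5)(P := x), 7 := (fd s 7)(P := rg s 6), 8 := (fd s 8)(P := 1)) \<Longrightarrow>
      rg s' = (rg s)(4 := Suc P, 6 := Suc (rg s 6)) \<Longrightarrow> Q s' k"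
  shows "wp D (slot_prog e) Q s k"
  unfolding slot_prog_def using assms(1-3) by (simp add: wp_simps) (rule Q, simp_all)

lemma vertex_prog:
  assumes "init_inv n raw v (fd s)" "v < n" "rg s 5 = v" "rg s 4 = n + 2 + 3 * v"
    "rg s 6 = n + 2 + 3 * n + 3 * v" "D = 4 * n + 2"
    and Q: "\<And>s'. init_inv n raw (Suc v) (fd s') \<Longrightarrow> rg s' 4 = n + 2 + 3 * Suc v \<Longrightarrow>
      rg s' 6 = n + 2 + 3 * n + 3 * Suc v \<Longrightarrow> (\<And>x. x \<notin> {4, 6} \<Longrightarrow> rg s' x = rg s x) \<Longrightarrow> Q s' k"
  shows "wp D vertex_prog Q s k"
proof -
  have i: "fd s 0 = raw" "\<And>u. u < v \<Longrightarrow> fd s 4 u = n + 2 + 3 * u"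
    "\<And>u i. u < v \<Longrightarrow> i < 3 \<Longrightarrow> fd s 2 (n + 2 + 3 * u + i) = raw (n + 2 + 3 * u + i) \<and>
      fd s 3 (n + 2 + 3 * u + i) = u \<and>
      fd s 5 (n + 2 + 3 * u + i) = n + 2 + 3 * u + (if i = 2 then 0 else Suc i) \<and>
      fd s 7 (n + 2 + 3 * u + i) = n + 2 + 3 * u + i + 3 * n"
    "\<And>p. fd s 8 p = of_bool (n + 2 \<le> p \<and> p < n + 2 + 3 * v)"
    using assms(1) by (auto simp: init_inv_def Let_def)
  define P where "P = n + 2 + 3 * v"
  define F where "F = (fd s)(4 := (fd s 4)(v := P),
      2 := (fd s 2)(P := raw P, P + 1 := raw (P + 1), P + 2 := raw (P + 2)),
      3 := (fd s 3)(P := v, P + 1 := v, P + 2 := v),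
      5 := (fd s 5)(P := P + 1, P + 1 := P + 2, P + 2 := P),
      7 := (fd s 7)(P := P + 3 * n, P + 1 := P + 3 * n + 1, P + 2 := P + 3 * n + 2),
      8 := (fd s 8)(P := 1, P + 1 := 1, P + 2 := 1))"
  have F: "init_inv n raw (Suc v) F"
  proof -
    have "let p = n + 2 + 3 * u + i in F 2 p = raw p \<and> F 3 p = u \<and>
        F 5 p = n + 2 + 3 * u + (if i = 2 then 0 else Suc i) \<and> F 7 p = p + 3 * n"
      if u: "u < Suc v" "i < 3" for u i
    proof (cases "u = v")
      case True
      have "i = 0 \<or> i = 1 \<or> i = 2" using u(2) by auto
      then show ?thesis by (elim disjE) (simp_all add: F_def True P_def)
    next
      case False
      then have "n + 2 + 3 * u + i < P" "u < v" using u by (auto simp: P_def)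
      then show ?thesis using i(3)[of u i] u(2) by (simp add: F_def)
    qed
    moreover have "F 8 p = of_bool (n + 2 \<le> p \<and> p < n + 2 + 3 * Suc v)" for p
    proof -
      have "p < P + 3 \<longleftrightarrow> p < P \<or> p = P \<or> p = P + 1 \<or> p = P + 2" by auto
      moreover have "P + 3 = n + 2 + 3 * Suc v" "n + 2 \<le> P" by (simp_all add: P_def)
      ultimately show ?thesis using i(4)[of p] by (auto simp: F_def P_def[symmetric])
    qed
    moreover have "F 4 u = n + 2 + 3 * u" if "u < Suc v" for u
      using that i(2)[of u] by (auto simp: F_def P_def)
    moreover have "F 0 = raw" by (simp add: F_def i(1))
    ultimately show ?thesis unfolding init_inv_def by blast
  qed
  have Q': "Q s' k" if "\<And>f. f \<in> {0, 2, 3, 4, 5, 7, 8} \<Longrightarrow> fd s' f = F f"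
    "rg s' = (rg s)(4 := P + 3, 6 := P + 3 * n + 3)" for s' :: state
  proof (rule Q)
    show "init_inv n raw (Suc v) (fd s')" using F that(1) by (simp add: init_inv_def)
  qed (use that(2) in \<open>auto simp: P_def\<close>)
  have lt: "P < D" "Suc P < D" "Suc (Suc P) < D" using assms(2,6) by (auto simp: P_def)
  have r: "rg s 4 = P" "rg s 6 = P + 3 * n" "rg s 5 = v" using assms(3-5) by (simp_all add: P_def)
  define G where "G F p x = F(2 := (F 2)(p := raw p), 3 := (F 3)(p := v), 5 := (F 5)(p := x),
    7 := (F 7)(p := p + 3 * n), 8 := (F 8)(p := 1))" for F :: "nat \<Rightarrow> nat \<Rightarrow> nat" and p x
  define F0 F1 F2 where "F0 = (fd s)(4 := (fd s 4)(v := P))"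
    and "F1 = G F0 P (P + 1)" and "F2 = G F1 (P + 1) (P + 2)"
  have 3: "wp D (slot_prog (Ld 4 (Vr 5))) Q t k"
    if t: "fd t = F2" "rg t = (rg s)(4 := P + 2, 6 := P + 3 * n + 2)" for t
  proof (rule slot_prog[where P = "P + 2" and x = P])
    fix t' :: state
    assume t': "fd t' = (fd t)(2 := (fd t 2)(P + 2 := fd t 0 (P + 2)), 3 := (fd t 3)(P + 2 := rg t 5),
        5 := (fd t 5)(P + 2 := P), 7 := (fd t 7)(P + 2 := rg t 6), 8 := (fd t 8)(P + 2 := 1))"
      "rg t' = (rg t)(4 := Suc (P + 2), 6 := Suc (rg t 6))"
    show "Q t' k"
    proof (rule Q')
      show "fd t' f = F f" if "f \<in> {0, 2, 3, 4, 5, 7, 8}" for f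
        using that unfolding t'(1) t F2_def F1_def F0_def G_def F_def by (auto simp: r i(1))
      show "rg t' = (rg s)(4 := P + 3, 6 := P + 3 * n + 3)"
        by (simp add: t' t fun_eq_iff)
    qed
  qed (use lt t r in \<open>auto simp: F2_def F1_def F0_def G_def\<close>)
  have 2: "wp D (slot_prog (Sc (Vr 4))) (wp D (slot_prog (Ld 4 (Vr 5))) Q) t k"
    if t: "fd t = F1" "rg t = (rg s)(4 := P + 1, 6 := P + 3 * n + 1)" for t
    by (rule slot_prog[where P = "P + 1" and x = "P + 2"], goal_cases)
      (use lt t r i(1) in \<open>auto simp: F2_def F1_def F0_def G_def intro!: 3\<close>)
  have 1: "wp D (slot_prog (Sc (Vr 4))) (wp D (slot_prog (Sc (Vr 4)) ;; slot_prog (Ld 4 (Vr 5))) Q) t k"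
    if t: "fd t = F0" "rg t = rg s" for t
    by (rule slot_prog[where P = P and x = "P + 1"], goal_cases)
      (use lt t r i(1) in \<open>auto simp: F1_def F0_def G_def wp_simps intro!: 2\<close>)
  show ?thesis
    unfolding vertex_prog_def by (simp add: wp_simps r) (rule 1, simp_all add: F0_def)
qed

lemma init_prog:
  assumes raw: "fd s 0 = raw" "raw 0 = n" "raw (Suc n) = 4 * n + 2" and w: "fd s 8 = (\<lambda>_. 0)"
    and D: "D = 4 * n + 2" and k: "K + n \<le> k"
    and Q: "\<And>s' k'. init_inv n raw n (fd s') \<Longrightarrow> rg s' 0 = n + 2 \<Longrightarrow> rg s' 2 = n \<Longrightarrow> rg s' 3 = 4 * n + 2 \<Longrightarrow>
      (\<And>f. f \<notin> {2, 3, 4, 5, 7, 8} \<Longrightarrow> fd s' f = fd s f) \<Longrightarrow> K \<le> k' \<Longrightarrow> Q s' k'"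
  shows "wp D init_prog Q s k"
proof -
  let ?I = "\<lambda>v s'. init_inv n raw v (fd s') \<and> rg s' 4 = n + 2 + 3 * v \<and>
    rg s' 6 = n + 2 + 3 * n + 3 * v \<and> rg s' 0 = n + 2 \<and> rg s' 3 = 4 * n + 2 \<and>
    (\<forall>f. f \<notin> {2, 3, 4, 5, 7, 8} \<longrightarrow> fd s' f = fd s f)"
  have loop: "wp D (While (Df (Vr 5) (Vr 2)) (vertex_prog ;; Asg 5 (Sc (Vr 5)))) Q t k"
    if t: "?I 0 t" "rg t 5 = 0" "rg t 2 = n" for t :: state
  proof (rule wp_for[where I = ?I and L = 0 and E = n and K = K])
    fix p k and t :: state assume p: "p < n" "rg t 5 = p" "rg t 2 = n" and I: "?I p t"
    show "wp D vertex_prog (\<lambda>s' k'. k' = k \<and> rg s' 5 = p \<and> rg s' 2 = n \<and> ?I (Suc p) s') t k"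
    proof (rule wp_frame)
      show "wp D vertex_prog (\<lambda>s' k'. k' = k \<and> init_inv n raw (Suc p) (fd s') \<and>
          rg s' 4 = n + 2 + 3 * Suc p \<and> rg s' 6 = n + 2 + 3 * n + 3 * Suc p) t k"
        by (rule vertex_prog) (use I p D in auto)
      fix s' k'
      assume 1: "k' = k \<and> init_inv n raw (Suc p) (fd s') \<and>
          rg s' 4 = n + 2 + 3 * Suc p \<and> rg s' 6 = n + 2 + 3 * n + 3 * Suc p"
        and 2: "\<And>f. f \<notin> wflds vertex_prog \<Longrightarrow> fd s' f = fd t f"
          "\<And>x. x \<notin> wvars vertex_prog \<Longrightarrow> rg s' x = rg t x"
      show "k' = k \<and> rg s' 5 = p \<and> rg s' 2 = n \<and> ?I (Suc p) s'"
        using 1 2 I p by (simp add: vertex_prog_def slot_prog_def)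
    qed
  qed (use t k Q in auto)
  have D1: "0 < D" "Suc n < D" using D by auto
  have "init_inv n raw 0 (fd s)" using raw(1) w by (simp add: init_inv_def)
  then show ?thesis
    unfolding init_prog_def using raw D1
    by (simp add: wp_simps) (rule loop, use raw in simp_all)
qed

section \<open>Reverse slots\<close>

definition twin_body :: com where
  "twin_body = Asg 5 (Ld 4 (Ld 2 (Vr 4))) ;;
     Cond (Df (Ld 2 (Vr 5)) (Ld 3 (Vr 4))) (Asg 5 (Sc (Vr 5))) Skip ;;
     Cond (Df (Ld 2 (Vr 5)) (Ld 3 (Vr 4))) (Asg 5 (Sc (Vr 5))) Skip ;;
     Sto 6 (Vr 4) (Vr 5)"

definition twin_prog :: com where
  "twin_prog = Asg 4 (Vr 0) ;; While (Df (Vr 4) (Vr 3)) (twin_body ;; Asg 4 (Sc (Vr 4)))"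

text \<open>The third slot is taken without a test; symmetry of the adjacency makes it the right
  one.\<close>

definition find :: "(nat \<Rightarrow> nat) \<Rightarrow> nat \<Rightarrow> nat \<Rightarrow> nat" where
  "find nb v q = (if nb q = v then q else if nb (Suc q) = v then Suc q else Suc (Suc q))"

lemma twin_prog:
  assumes r: "rg s 0 = L" "rg s 3 = E" "L \<le> E" and k: "K + (E - L) \<le> k"
    and Q: "\<And>s' k'. (\<And>f. f \<noteq> 6 \<Longrightarrow> fd s' f = fd s f) \<Longrightarrow> rg s' 0 = L \<Longrightarrow> rg s' 2 = rg s 2 \<Longrightarrow>
      rg s' 3 = E \<Longrightarrow>
      (\<And>p. L \<le> p \<Longrightarrow> p < E \<Longrightarrow> fd s' 6 p = find (fd s 2) (fd s 3 p) (fd s 4 (fd s 2 p))) \<Longrightarrow>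
      K \<le> k' \<Longrightarrow> Q s' k'"
  shows "wp D twin_prog Q s k"
proof -
  let ?I = "\<lambda>p s'. (\<forall>f. f \<noteq> 6 \<longrightarrow> fd s' f = fd s f) \<and> rg s' 0 = L \<and> rg s' 2 = rg s 2 \<and>
    (\<forall>q. L \<le> q \<and> q < p \<longrightarrow> fd s' 6 q = find (fd s 2) (fd s 3 q) (fd s 4 (fd s 2 q)))"
  have "wp D (While (Df (Vr 4) (Vr 3)) (twin_body ;; Asg 4 (Sc (Vr 4)))) Q t k"
    if t: "?I L t" "rg t 4 = L" "rg t 3 = E" for t :: state
  proof (rule wp_for[where I = ?I and L = L and E = E and K = K])
    fix p k and t :: state assume p: "p < E" "rg t 4 = p" "rg t 3 = E" and I: "?I p t"
    show "wp D twin_body (\<lambda>s' k'. k' = k \<and> rg s' 4 = p \<and> rg s' 3 = E \<and> ?I (Suc p) s') t k"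
      unfolding twin_body_def using I p
      by (simp add: wp_simps) (auto simp: find_def less_Suc_eq)
  qed (use t r k Q in auto)
  then show ?thesis unfolding twin_prog_def using r by (simp add: wp_simps)
qed

text \<open>The search in \<open>find\<close> hits because the adjacency is symmetric, and the hit
  is unique because the lists are distinct. Hence reversing twice leads back to the same
  slot.\<close>

lemma slots_intro:
  assumes i: "init_inv n raw n F"
    and lt: "\<And>u i. u < n \<Longrightarrow> i < 3 \<Longrightarrow> raw (n + 2 + 3 * u + i) < n \<and> raw (n + 2 + 3 * u + i) \<noteq> u"
    and inj: "\<And>u i j. u < n \<Longrightarrow> i < 3 \<Longrightarrow> j < 3 \<Longrightarrow> raw (n + 2 + 3 * u + i) = raw (n + 2 + 3 * u + j) \<Longrightarrow> i = j"
    and sym: "\<And>u i. u < n \<Longrightarrow> i < 3 \<Longrightarrow> \<exists>j<3. raw (n + 2 + 3 * raw (n + 2 + 3 * u + i) + j) = u"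
    and tw: "\<And>p. n + 2 \<le> p \<Longrightarrow> p < 4 * n + 2 \<Longrightarrow> tw p = find (F 2) (F 3 p) (F 4 (F 2 p))"
  shows "slots n {n + 2..<4 * n + 2} (F 3) (F 2) (F 5) tw"
proof -
  define pos where "pos u i = n + 2 + 3 * u + i" for u i
  have pos_in: "pos u i \<in> {n + 2..<4 * n + 2}" if "u < n" "i < 3" for u i
    using that by (auto simp: pos_def)
  have pos_ex: "\<exists>u<n. \<exists>i<3. p = pos u i" if "p \<in> {n + 2..<4 * n + 2}" for p
  proof -
    have "p = pos ((p - n - 2) div 3) ((p - n - 2) mod 3)" using that by (auto simp: pos_def)
    moreover have "(p - n - 2) div 3 < n" using that by (auto simp: less_mult_imp_div_less)
    moreover have "(p - n - 2) mod 3 < 3" by simp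
    ultimately show ?thesis by blast
  qed
  have pos_eq: "pos u i = pos v j \<longleftrightarrow> u = v \<and> i = j" if "i < 3" "j < 3" for u v i j
    using that unfolding pos_def by presburger
  have F: "F 2 (pos u i) = raw (pos u i)" "F 3 (pos u i) = u"
    "F 5 (pos u i) = pos u (if i = 2 then 0 else Suc i)" if "u < n" "i < 3" for u i
    using i that by (auto simp: init_inv_def pos_def Let_def)
  have F4: "F 4 u = pos u 0" if "u < n" for u using i that by (simp add: init_inv_def pos_def)
  have raw: "raw (pos u i) < n" "raw (pos u i) \<noteq> u" if "u < n" "i < 3" for u i
    using lt that by (auto simp: pos_def)
  have twp: "tw (pos u i) = pos (raw (pos u i)) j"
    if "u < n" "i < 3" "j < 3" "raw (pos (raw (pos u i)) j) = u" for u i j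
  proof -
    define w where "w = raw (pos u i)"
    have w: "w < n" "raw (pos w j) = u" using raw that by (auto simp: w_def)
    have iff: "raw (pos w j') = u \<longleftrightarrow> j' = j" if "j' < 3" for j'
      using inj[of w j' j] w that \<open>j < 3\<close> by (auto simp: pos_def)
    have "raw (pos w 0) = u \<longleftrightarrow> j = 0" "raw (pos w 1) = u \<longleftrightarrow> j = 1"
      using iff[of 0] iff[of 1] by auto
    moreover have "pos w 1 = Suc (pos w 0)" "pos w 2 = Suc (Suc (pos w 0))" by (simp_all add: pos_def)
    moreover have "j = 0 \<or> j = 1 \<or> j = 2" using \<open>j < 3\<close> by auto
    moreover have "F 2 (pos w 0) = raw (pos w 0)" "F 2 (pos w 1) = raw (pos w 1)"
      using F w by simp_all
    moreover have "tw (pos u i) = find (F 2) u (pos w 0)"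
      using tw[of "pos u i"] pos_in[OF that(1,2)] F[OF that(1,2)] F4[OF w(1)] by (simp add: w_def)
    ultimately have "tw (pos u i) = pos w j"
      unfolding find_def by (elim disjE) auto
    then show ?thesis by (simp add: w_def)
  qed
  have sym': "\<exists>j<3. raw (pos (raw (pos u i)) j) = u" if "u < n" "i < 3" for u i
    using sym[OF that] by (simp add: pos_def)
  have tws: "tw (pos u i) \<in> {n + 2..<4 * n + 2} \<and> tw (tw (pos u i)) = pos u i \<and>
      F 3 (tw (pos u i)) = F 2 (pos u i)" if ui: "u < n" "i < 3" for u i
  proof -
    define w where "w = raw (pos u i)"
    have w: "w < n" using raw ui by (simp add: w_def)
    obtain j where j: "j < 3" "raw (pos w j) = u" using sym'[OF ui] by (auto simp: w_def)
    have 1: "tw (pos u i) = pos w j" using twp[OF ui j(1)] j(2) by (simp add: w_def)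
    have "tw (pos w j) = pos (raw (pos w j)) i"
      by (rule twp) (use w j ui in \<open>auto simp: w_def\<close>)
    then show ?thesis using 1 w j F[OF w j(1)] F[OF ui] pos_in[OF w j(1)] by (simp add: w_def)
  qed
  show ?thesis
  proof
    show "finite {n + 2..<4 * n + 2}" "0 \<notin> {n + 2..<4 * n + 2}" by auto
    fix p assume "p \<in> {n + 2..<4 * n + 2}"
    then obtain u i where p: "u < n" "i < 3" "p = pos u i" using pos_ex by blast
    have two: "pos v (Suc (Suc 0)) = pos v 2" for v by (simp add: numeral_2_eq_2)
    have "i = 0 \<or> i = 1 \<or> i = 2" using p(2) by auto
    then show "F 5 p \<in> {n + 2..<4 * n + 2}" "F 5 p \<noteq> p" "F 3 (F 5 p) = F 3 p"
      using p F pos_in pos_eq by auto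
    show "F 5 (F 5 (F 5 p)) = p"
      using \<open>i = 0 \<or> i = 1 \<or> i = 2\<close> p F two by (elim disjE) simp_all
    show "tw p \<in> {n + 2..<4 * n + 2}" "tw (tw p) = p" "F 3 (tw p) = F 2 p"
      using tws p by auto
    show "F 2 p \<noteq> F 3 p" "F 3 p < n" using p F raw by auto
    fix q assume "q \<in> {n + 2..<4 * n + 2}"
    then obtain v j where q: "v < n" "j < 3" "q = pos v j" using pos_ex by blast
    show "F 3 p = F 3 q \<Longrightarrow> F 2 p = F 2 q \<Longrightarrow> p = q"
      using p q F inj[of u i j] unfolding pos_def[symmetric] by auto
    assume "F 3 q = F 3 p"
    then have "v = u" using p q F by simp
    moreover have "j = 0 \<or> j = 1 \<or> j = 2" using q(2) by auto
    ultimately show "q = p \<or> q = F 5 p \<or> q = F 5 (F 5 p)"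
      using p q F two \<open>i = 0 \<or> i = 1 \<or> i = 2\<close> by (elim disjE) simp_all
  next
    fix v assume "v < n"
    then show "\<exists>p\<in>{n + 2..<4 * n + 2}. F 3 p = v" using pos_in[of v 0] F[of v 0] by force
  qed
qed

section \<open>Finding and contracting triangles\<close>

definition third_prog :: com where
  "third_prog = Asg 9 (Ld 5 (Vr 8)) ;; Asg 13 (Ld 6 (Vr 8)) ;; Asg 14 (Ld 6 (Vr 11)) ;;
     Asg 15 (Ld 5 (Vr 13)) ;; Cond (Df (Vr 15) (Vr 14)) Skip (Asg 15 (Ld 5 (Vr 14)))"

text \<open>All addresses have been loaded by \<open>third_prog\<close>, before field 5 changes
  here.\<close>

definition store_prog :: com where
  "store_prog =
     Sto 8 (Vr 4) (Nm 0) ;; Sto 8 (Vr 10) (Nm 0) ;; Sto 8 (Vr 8) (Nm 0) ;; Sto 8 (Vr 13) (Nm 0) ;;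
     Sto 8 (Vr 11) (Nm 0) ;; Sto 8 (Vr 14) (Nm 0) ;;
     Sto 5 (Vr 9) (Vr 12) ;; Sto 5 (Vr 12) (Vr 15) ;; Sto 5 (Vr 15) (Vr 9) ;;
     Sto 9 (Vr 5) (Nm 1) ;; Sto 9 (Vr 6) (Nm 1) ;; Sto 9 (Vr 7) (Nm 1)"

lemma contract_prog:
  assumes rg: "rg s 4 = p" "rg s 5 = a" "rg s 6 = b" "rg s 7 = c" "rg s 8 = q" "rg s 10 = p'"
      "rg s 11 = x" "rg s 12 = y" "rg s 3 = E"
    and "r = fd s 5 q" "q' = fd s 6 q" "z = fd s 6 x"
    and t: "t = (if fd s 5 q' = z then fd s 5 z else fd s 5 q')"
    and Q: "\<And>u. fd u 8 = (fd s 8)(p := 0, p' := 0, q := 0, q' := 0, x := 0, z := 0) \<Longrightarrow>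
      fd u 5 = (fd s 5)(r := y, y := t, t := r) \<Longrightarrow> fd u 9 = (fd s 9)(a := 1, b := 1, c := 1) \<Longrightarrow>
      (\<And>f. f \<notin> {5, 8, 9} \<Longrightarrow> fd u f = fd s f) \<Longrightarrow> rg u 3 = E \<Longrightarrow> rg u 4 = p \<Longrightarrow> Q u k"
  shows "wp D (third_prog ;; store_prog) Q s k"
proof -
  have *: "wp D store_prog Q u k"
    if "fd u = fd s" "rg u 4 = p" "rg u 5 = a" "rg u 6 = b" "rg u 7 = c" "rg u 8 = q" "rg u 10 = p'"
      "rg u 11 = x" "rg u 12 = y" "rg u 3 = E" "rg u 9 = r" "rg u 13 = q'" "rg u 14 = z" "rg u 15 = t" for u
    unfolding store_prog_def using that
    by (simp add: wp_simps del: fun_upd_apply add: fun_upd_other fun_upd_same)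
      (rule Q; simp add: fun_upd_other fun_upd_same del: fun_upd_apply)
  show ?thesis
    unfolding third_prog_def using assms(1-12)
    by (simp add: wp_simps) (intro conjI impI; rule *; auto simp: t)
qed

context slots
begin

text \<open>Only a slot and its successor are examined. Of any two slots of a node, one follows the
  other in the cyclic order of three, so no triangle is missed.\<close>

definition tri_inv :: "nat \<Rightarrow> (nat \<Rightarrow> nat \<Rightarrow> nat) \<Rightarrow> bool" where
  "tri_inv p F \<longleftrightarrow> contr (F 5) (F 8) (F 9) \<and> (\<forall>q. q \<notin> S \<longrightarrow> F 8 q = 0) \<and>
     (\<forall>q\<in>S. q < p \<longrightarrow> F 9 (ow q) = 0 \<longrightarrow> F 9 (nb q) = 0 \<longrightarrow> F 9 (nb (nx0 q)) = 0 \<longrightarrow>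
       \<not> adj (nb q) (nb (nx0 q)))"

text \<open>\<open>x0\<close> and \<open>y0\<close> are the slots of \<open>nb p\<close> other than
  the reverse of \<open>p\<close>. If one of them leads to \<open>nb q\<close>, it is named
  \<open>x\<close>; if neither does, there is no triangle on \<open>p\<close> and
  \<open>q\<close>.\<close>

lemma tri_step:
  assumes p: "p \<in> S" and cl: "F 9 (ow p) = 0" "F 9 (nb p) = 0" "F 9 (nb (nx0 p)) = 0"
    and i: "tri_inv p F" and q: "q = F 5 p"
    and x: "x0 = F 5 (tw p)" "y0 = F 5 x0" "(x, y) = (if nb x0 = nb q then (x0, y0) else (y0, x0))"
  shows "nb q = nb (nx0 p)"
    "nb x \<noteq> nb q \<Longrightarrow> tri_inv (Suc p) F"
    "nb x = nb q \<Longrightarrow> r = F 5 q \<Longrightarrow> q' = tw q \<Longrightarrow> z = tw x \<Longrightarrow> t = (if F 5 q' = z then F 5 z else F 5 q') \<Longrightarrow>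
      F' 5 = (F 5)(r := y, y := t, t := r) \<Longrightarrow>
      F' 8 = (F 8)(p := 0, tw p := 0, q := 0, q' := 0, x := 0, z := 0) \<Longrightarrow>
      F' 9 = (F 9)(ow p := 1, nb p := 1, nb q := 1) \<Longrightarrow> tri_inv (Suc p) F'"
proof -
  have c: "contr (F 5) (F 8) (F 9)" and out: "\<And>q. q \<notin> S \<Longrightarrow> F 8 q = 0"
    and mx: "\<And>q. q \<in> S \<Longrightarrow> q < p \<Longrightarrow> F 9 (ow q) = 0 \<Longrightarrow> F 9 (nb q) = 0 \<Longrightarrow> F 9 (nb (nx0 q)) = 0 \<Longrightarrow>
       \<not> adj (nb q) (nb (nx0 q))"
    using i by (auto simp: tri_inv_def)
  have nx: "F 5 s = nx0 s" if "s \<in> S" "F 9 (ow s) = 0" for s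
    using c that unfolding contr_def by blast
  have q0: "q = nx0 p" "q \<in> S" "ow q = ow p" using q nx[OF p cl(1)] nx0_in[OF p] ow_nx0[OF p] by auto
  then show nbq: "nb q = nb (nx0 p)" by simp
  have p': "tw p \<in> S" "ow (tw p) = nb p" "nb (tw p) = ow p" using tw_in ow_tw nb_tw p by auto
  have x0: "x0 = nx0 (tw p)" "x0 \<in> S" "ow x0 = nb p"
    using x(1) nx[OF p'(1)] cl p' nx0_in[OF p'(1)] ow_nx0[OF p'(1)] by auto
  have y0: "y0 = nx0 x0" "y0 \<in> S" "ow y0 = nb p"
    using x(2) nx[OF x0(2)] cl x0 nx0_in[OF x0(2)] ow_nx0[OF x0(2)] by auto
  have ne: "x0 \<noteq> tw p" "y0 \<noteq> x0" "y0 \<noteq> tw p"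
    using nx0_ne[OF p'(1)] nx0_ne[OF x0(2)] nx0_ne[OF y0(2)] nx0_3[OF p'(1)] x0(1) y0(1) by auto
  have xy: "x \<in> S" "y \<in> S" "ow x = nb p" "ow y = nb p" "x \<noteq> tw p" "y \<noteq> tw p" "x \<noteq> y"
    and xy': "{x, y} = {x0, y0}" "nb x = nb q \<or> nb x0 \<noteq> nb q \<and> x = y0"
    using x(3) x0 y0 ne by (auto split: if_splits)
  have pc: "nb (tw p) \<noteq> nb q" using p'(3) nb_ne[OF q0(2)] q0(3) by simp
  show "tri_inv (Suc p) F" if "nb x \<noteq> nb q"
  proof -
    have "\<not> adj (nb p) (nb q)"
    proof
      assume "adj (nb p) (nb q)"
      then obtain s where s: "s \<in> S" "ow s = nb p" "nb s = nb q" unfolding adj_def by blast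
      then have "s = tw p \<or> s = x0 \<or> s = y0"
        using ow_eq[OF p'(1) s(1)] p'(2) x0(1) y0(1) by simp
      then show False using s(3) pc that xy' by auto
    qed
    then show ?thesis
      using c out mx q0(1) by (auto simp: tri_inv_def less_Suc_eq)
  qed
  show "tri_inv (Suc p) F'"
    if tri: "nb x = nb q" and d: "r = F 5 q" "q' = tw q" "z = tw x"
      "t = (if F 5 q' = z then F 5 z else F 5 q')"
      and F': "F' 5 = (F 5)(r := y, y := t, t := r)"
      "F' 8 = (F 8)(p := 0, tw p := 0, q := 0, q' := 0, x := 0, z := 0)"
      "F' 9 = (F 9)(ow p := 1, nb p := 1, nb q := 1)"
  proof -
    have cq: "F 9 (nb q) = 0" using cl(3) nbq by simp
    have q': "q' \<in> S" "ow q' = nb q" "nb q' = ow p"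
      using tw_in ow_tw nb_tw q0 d by auto
    have z: "z \<in> S" "ow z = nb q" "nb z = nb p"
      using tw_in[OF xy(1)] ow_tw[OF xy(1)] nb_tw[OF xy(1)] d tri xy(3) by auto
    have qz: "q' \<noteq> z" using q'(3) z(3) nb_ne[OF p] by auto
    have zq: "z = nx0 q' \<or> z = nx0 (nx0 q')" using ow_eq[OF q'(1) z(1)] q' z qz by auto
    have nxq: "F 5 q' = nx0 q'" "F 5 z = nx0 z" using nx q' z cq by auto
    \<comment> \<open>The successor of \<open>q'\<close> is \<open>z\<close> or the third slot; in
      the first case the third slot follows \<open>z\<close>.\<close>
    have t: "t \<in> S \<and> ow t = nb q \<and> t \<noteq> q' \<and> t \<noteq> z"
    proof (cases "nx0 q' = z")
      case True
      then have "t = nx0 z" using d nxq by simp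
      then show ?thesis
        using nx0_in[OF z(1)] ow_nx0[OF z(1)] nx0_ne[OF z(1)] nx0_3[OF q'(1)] nx0_ne[OF q'(1)] z True
        by (metis nx0_ne)
    next
      case False
      then have "t = nx0 q'" using d nxq by simp
      then show ?thesis
        using nx0_in[OF q'(1)] ow_nx0[OF q'(1)] nx0_ne[OF q'(1)] q' False by simp
    qed
    have "contr (F' 5) (F' 8) (F' 9)"
      unfolding F' d(2,3)
      by (rule contract_step[OF c p q d(1) cl(1,2) cq xy(1-7) tri]) (use t d in auto)
    moreover have "F' 8 s = 0" if "s \<notin> S" for s
      using out[OF that] unfolding F' by simp
    moreover have "\<not> adj (nb s) (nb (nx0 s))"
      if s: "s \<in> S" "s < Suc p" "F' 9 (ow s) = 0" "F' 9 (nb s) = 0" "F' 9 (nb (nx0 s)) = 0" for s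
    proof -
      have "F' 9 (ow p) \<noteq> 0" unfolding F' by (simp add: fun_upd_def)
      then have "s \<noteq> p" using s(3) by auto
      \<comment> \<open>Marks are never cleared, so the slots examined before need no second
        look.\<close>
      moreover have "F 9 v = 0" if "F' 9 v = 0" for v
        using that unfolding F' by (auto split: if_splits)
      ultimately show ?thesis using mx[of s] s by auto
    qed
    ultimately show ?thesis by (auto simp: tri_inv_def)
  qed
qed

lemma tri_inv_skip:
  assumes "tri_inv p F" "F 9 (ow p) \<noteq> 0 \<or> F 9 (nb p) \<noteq> 0 \<or> F 9 (nb (nx0 p)) \<noteq> 0"
  shows "tri_inv (Suc p) F"
  using assms by (auto simp: tri_inv_def less_Suc_eq)

lemma tri_inv_maximal:
  assumes "tri_inv E F" "\<And>p. p \<in> S \<Longrightarrow> p < E"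
  shows "maximal (F 9)"
  unfolding maximal_def
proof (intro allI impI)
  fix a b c assume a: "adj a b" "adj b c" "adj c a"
  show "F 9 a \<noteq> 0 \<or> F 9 b \<noteq> 0 \<or> F 9 c \<noteq> 0"
  proof (rule ccontr)
    assume cl: "\<not> (F 9 a \<noteq> 0 \<or> F 9 b \<noteq> 0 \<or> F 9 c \<noteq> 0)"
    obtain p where p: "p \<in> S" "ow p = a" "nb p = b" using a(1) by (auto simp: adj_def)
    obtain s where s: "s \<in> S" "ow s = a" "nb s = c" using adj_sym[OF a(3)] by (auto simp: adj_def)
    have "p \<noteq> s" using p s adj_ne[OF a(2)] by auto
    have *: "\<not> adj (nb q) (nb (nx0 q))"
      if "q \<in> S" "F 9 (ow q) = 0" "F 9 (nb q) = 0" "F 9 (nb (nx0 q)) = 0" for q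
      using assms that by (auto simp: tri_inv_def)
    have "s = nx0 p \<or> p = nx0 s"
      using ow_eq[OF p(1) s(1)] \<open>p \<noteq> s\<close> p s nx0_3[OF p(1)] by auto
    then show False
      using *[of p] *[of s] p s cl a(2) adj_sym[OF a(2)] by auto
  qed
qed

end

definition check_prog :: com where
  "check_prog = Cond (Df (Ld 2 (Vr 11)) (Vr 7)) Skip (third_prog ;; store_prog)"

definition find_prog :: com where
  "find_prog = Asg 10 (Ld 6 (Vr 4)) ;; Asg 11 (Ld 5 (Vr 10)) ;; Asg 12 (Ld 5 (Vr 11)) ;;
        Cond (Df (Ld 2 (Vr 11)) (Vr 7)) (Asg 13 (Vr 11) ;; Asg 11 (Vr 12) ;; Asg 12 (Vr 13)) Skip ;;
        check_prog"

definition tri_body :: com where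
  "tri_body = Asg 5 (Ld 3 (Vr 4)) ;; Asg 6 (Ld 2 (Vr 4)) ;; Asg 8 (Ld 5 (Vr 4)) ;; Asg 7 (Ld 2 (Vr 8)) ;;
     Cond (Ld 9 (Vr 5)) Skip (Cond (Ld 9 (Vr 6)) Skip (Cond (Ld 9 (Vr 7)) Skip
       find_prog))"

definition tri_prog :: com where
  "tri_prog = Asg 4 (Vr 0) ;; While (Df (Vr 4) (Vr 3)) (tri_body ;; Asg 4 (Sc (Vr 4)))"

context slots
begin

lemma tri_body:
  assumes p: "p \<in> S" and i: "tri_inv p (fd s)" and F: "fd s 2 = nb" "fd s 3 = ow"
    and F6: "\<And>q. q \<in> S \<Longrightarrow> fd s 6 q = tw q" and r: "rg s 4 = p" "rg s 3 = E"
    and Q: "\<And>u. tri_inv (Suc p) (fd u) \<Longrightarrow> (\<And>f. f \<notin> {5, 8, 9} \<Longrightarrow> fd u f = fd s f) \<Longrightarrow>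
      rg u 3 = E \<Longrightarrow> rg u 4 = p \<Longrightarrow> Q u k"
  shows "wp D tri_body Q s k"
proof -
  define q where "q = fd s 5 p"
  have skip: "Q u k"
    if "fd s 9 (ow p) \<noteq> 0 \<or> fd s 9 (nb p) \<noteq> 0 \<or> fd s 9 (nb q) \<noteq> 0" "fd u = fd s" "rg u 3 = E" "rg u 4 = p" for u
  proof (rule Q)
    have "q = nx0 p" if "fd s 9 (ow p) = 0"
      using i p that unfolding tri_inv_def contr_def q_def by blast
    then have "fd s 9 (ow p) \<noteq> 0 \<or> fd s 9 (nb p) \<noteq> 0 \<or> fd s 9 (nb (nx0 p)) \<noteq> 0" using that(1) by auto
    from tri_inv_skip[OF i this] show "tri_inv (Suc p) (fd u)" using that by simp
  qed (use that in auto)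
  have go: "wp D find_prog Q u k"
    if cl: "fd s 9 (ow p) = 0" "fd s 9 (nb p) = 0" "fd s 9 (nb q) = 0"
      and u: "fd u = fd s" "rg u 3 = E" "rg u 4 = p" "rg u 5 = ow p" "rg u 6 = nb p" "rg u 7 = nb q" "rg u 8 = q"
    for u :: state
  proof -
    define x0 y0 where "x0 = fd s 5 (tw p)" and "y0 = fd s 5 x0"
    define xy where "xy = (if nb x0 = nb q then (x0, y0) else (y0, x0))"
    define x y where "x = fst xy" and "y = snd xy"
    have q0: "q = nx0 p" using i p cl unfolding tri_inv_def contr_def q_def by blast
    have xy: "(x, y) = (if nb x0 = nb q then (x0, y0) else (y0, x0))"
      by (simp add: x_def y_def xy_def)
    have cl3: "fd s 9 (nb (nx0 p)) = 0" using cl(3) q0 by simp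
    note step = tri_step[OF p cl(1,2) cl3 i q_def x0_def y0_def xy]
    have xS: "x \<in> S" if "nb x = nb q"
    proof -
      have nx: "fd s 5 a = nx0 a" if "a \<in> S" "fd s 9 (ow a) = 0" for a
        using i that unfolding tri_inv_def contr_def by blast
      have "x0 \<in> S" "ow x0 = nb p" using nx[of "tw p"] tw_in[OF p] ow_tw[OF p] cl nx0_in ow_nx0
        by (auto simp: x0_def)
      moreover from this have "y0 \<in> S" using nx[of x0] cl nx0_in by (auto simp: y0_def)
      ultimately show ?thesis by (simp add: x_def xy_def)
    qed
    have qS: "q \<in> S" using q0 nx0_in[OF p] by simp
    have last: "wp D (check_prog) Q t k"
      if t: "fd t = fd s" "rg t 3 = E" "rg t 4 = p" "rg t 5 = ow p" "rg t 6 = nb p" "rg t 7 = nb q" "rg t 8 = q"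
        "rg t 10 = tw p" "rg t 11 = x" "rg t 12 = y" for t :: state
      unfolding check_prog_def
    proof (rule wp_Cond)
      assume "ev (Df (Ld 2 (Vr 11)) (Vr 7)) t \<noteq> 0"
      then have "nb x \<noteq> nb q" using t F by auto
      from step(2)[OF this] show "wp D Skip Q t k" using t by (intro wp_Skip Q) auto
    next
      assume "ev (Df (Ld 2 (Vr 11)) (Vr 7)) t = 0"
      then have e: "nb x = nb q" using t F by simp
      show "wp D (third_prog ;; store_prog) Q t k"
      proof (rule contract_prog[OF t(3-10) t(2) refl refl refl refl])
        fix w :: state
        assume w: "fd w 8 = (fd t 8)(p := 0, tw p := 0, q := 0, fd t 6 q := 0, x := 0, fd t 6 x := 0)"
          "fd w 5 = (fd t 5)(fd t 5 q := y,
            y := if fd t 5 (fd t 6 q) = fd t 6 x then fd t 5 (fd t 6 x) else fd t 5 (fd t 6 q),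
            (if fd t 5 (fd t 6 q) = fd t 6 x then fd t 5 (fd t 6 x) else fd t 5 (fd t 6 q)) := fd t 5 q)"
          "fd w 9 = (fd t 9)(ow p := 1, nb p := 1, nb q := 1)"
          "\<And>f. f \<notin> {5, 8, 9} \<Longrightarrow> fd w f = fd t f" "rg w 3 = E" "rg w 4 = p"
        show "Q w k"
        proof (rule Q)
          show "tri_inv (Suc p) (fd w)"
            by (rule step(3)[OF e refl refl refl refl])
              (use w t F6[OF qS] F6[OF xS[OF e]] in simp_all)
        qed (use w t in auto)
      qed
    qed (simp)
    show ?thesis unfolding find_prog_def using u F F6[OF p]
      by (simp add: wp_simps flip: x0_def y0_def) (intro conjI impI; rule last; auto simp: x_def y_def xy_def)
  qed
  show ?thesis
    unfolding tri_body_def using r F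
    by (simp add: wp_simps flip: q_def) (auto intro!: skip go)
qed

lemma tri_prog:
  assumes S: "S = {L..<E}" "L \<le> E" and i: "tri_inv L (fd s)" and F: "fd s 2 = nb" "fd s 3 = ow"
    and F6: "\<And>q. q \<in> S \<Longrightarrow> fd s 6 q = tw q" and r: "rg s 0 = L" "rg s 3 = E" and k: "K + (E - L) \<le> k"
    and Q: "\<And>u k'. contr (fd u 5) (fd u 8) (fd u 9) \<Longrightarrow> maximal (fd u 9) \<Longrightarrow>
      (\<And>q. q \<notin> S \<Longrightarrow> fd u 8 q = 0) \<Longrightarrow> (\<And>f. f \<notin> {5, 8, 9} \<Longrightarrow> fd u f = fd s f) \<Longrightarrow>
      (\<And>x. x \<in> {0, 2, 3} \<Longrightarrow> rg u x = rg s x) \<Longrightarrow> K \<le> k' \<Longrightarrow> Q u k'"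
  shows "wp D tri_prog Q s k"
proof -
  let ?I = "\<lambda>p t. tri_inv p (fd t) \<and> (\<forall>f. f \<notin> {5, 8, 9} \<longrightarrow> fd t f = fd s f) \<and>
    rg t 0 = rg s 0 \<and> rg t 2 = rg s 2"
  have "wp D (While (Df (Vr 4) (Vr 3)) (tri_body ;; Asg 4 (Sc (Vr 4)))) Q t k"
    if t: "?I L t" "rg t 4 = L" "rg t 3 = E" for t :: state
  proof (rule wp_for[where I = ?I and L = L and E = E and K = K])
    fix p k and t :: state assume p: "L \<le> p" "p < E" "rg t 4 = p" "rg t 3 = E" and I: "?I p t"
    show "wp D tri_body (\<lambda>s' k'. k' = k \<and> rg s' 4 = p \<and> rg s' 3 = E \<and> ?I (Suc p) s') t k"
    proof (rule wp_frame)
      show "wp D tri_body (\<lambda>s' k'. k' = k \<and> rg s' 4 = p \<and> rg s' 3 = E \<and> tri_inv (Suc p) (fd s') \<and>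
          (\<forall>f. f \<notin> {5, 8, 9} \<longrightarrow> fd s' f = fd t f)) t k"
        by (rule tri_body[where p = p and E = E]) (use p I S F F6 in auto)
      fix s' :: state and k'
      assume 1: "k' = k \<and> rg s' 4 = p \<and> rg s' 3 = E \<and> tri_inv (Suc p) (fd s') \<and>
          (\<forall>f. f \<notin> {5, 8, 9} \<longrightarrow> fd s' f = fd t f)"
        and 2: "\<And>x. x \<notin> wvars tri_body \<Longrightarrow> rg s' x = rg t x"
      have "rg s' 0 = rg t 0" "rg s' 2 = rg t 2"
        using 2 by (simp_all add: tri_body_def find_prog_def check_prog_def third_prog_def store_prog_def)
      then show "k' = k \<and> rg s' 4 = p \<and> rg s' 3 = E \<and> ?I (Suc p) s'" using 1 I by auto
    qed
  next
    fix t :: state and k' assume "?I E t" "K \<le> k'" "rg t 3 = E"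
    note t = this
    show "Q t k'"
    proof (rule Q)
      show "maximal (fd t 9)" by (rule tri_inv_maximal[of E]) (use t S in auto)
      show "fd t 8 q = 0" if "q \<notin> S" for q using t(1) that unfolding tri_inv_def by blast
      show "contr (fd t 5) (fd t 8) (fd t 9)" using t(1) unfolding tri_inv_def by blast
    qed (use t r in auto)
  qed (use t S k in auto)
  then show ?thesis unfolding tri_prog_def using r i by (simp add: wp_simps)
qed

end

section \<open>Building the double cover\<close>

definition double_body :: com where
  "double_body = Cond (Ld 8 (Vr 4))
     (Asg 5 (Ld 7 (Vr 4)) ;; Sto 5 (Vr 5) (Ld 7 (Ld 5 (Vr 4))) ;; Sto 10 (Vr 4) (Ld 7 (Ld 6 (Vr 4))) ;;
      Sto 10 (Vr 5) (Ld 6 (Vr 4)) ;; Sto 8 (Vr 5) (Nm 1)) Skip"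

definition double_prog :: com where
  "double_prog = Asg 4 (Vr 0) ;; While (Df (Vr 4) (Vr 3)) (double_body ;; Asg 4 (Sc (Vr 4)))"

context slots
begin

text \<open>The copy of a slot is its shift by \<open>m\<close>. Slot \<open>p\<close> is the
  half-edge at its owner on the first side, and its reverse belongs to the neighbour on the second
  side, hence \<open>tw p + m\<close>.\<close>

definition double_inv :: "nat \<Rightarrow> nat \<Rightarrow> (nat \<Rightarrow> nat) \<Rightarrow> (nat \<Rightarrow> nat) \<Rightarrow> nat \<Rightarrow> (nat \<Rightarrow> nat \<Rightarrow> nat) \<Rightarrow> bool" where
  "double_inv L m nx w p F \<longleftrightarrow> (\<forall>q\<in>S. F 5 q = nx q \<and> F 8 q = w q) \<and>
     (\<forall>q\<in>S. q < p \<longrightarrow> w q = 1 \<longrightarrow> F 5 (q + m) = nx q + m \<and> F 10 q = tw q + m \<and>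
        F 10 (q + m) = tw q \<and> F 8 (q + m) = 1) \<and>
     (\<forall>q. q \<notin> S \<longrightarrow> \<not> (\<exists>o'\<in>S. o' < p \<and> w o' = 1 \<and> q = o' + m) \<longrightarrow> F 8 q = 0)"

lemma double_prog:
  assumes S: "S = {L..<E}" "L \<le> E" and m: "m = E - L" and c: "contr (fd s 5) (fd s 8) (fd s 9)"
    and F8: "\<And>q. q \<notin> S \<Longrightarrow> fd s 8 q = 0"
    and F6: "\<And>q. q \<in> S \<Longrightarrow> fd s 6 q = tw q" and F7: "\<And>q. q \<in> S \<Longrightarrow> fd s 7 q = q + m"
    and r: "rg s 0 = L" "rg s 3 = E" and k: "K + (E - L) \<le> k"
    and Q: "\<And>u k'. double_inv L m (fd s 5) (fd s 8) E (fd u) \<Longrightarrow>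
      (\<And>f. f \<notin> {5, 8, 10} \<Longrightarrow> fd u f = fd s f) \<Longrightarrow>
      (\<And>x. x \<in> {0, 2, 3} \<Longrightarrow> rg u x = rg s x) \<Longrightarrow> K \<le> k' \<Longrightarrow> Q u k'"
  shows "wp D double_prog Q s k"
proof -
  let ?I = "\<lambda>p t. double_inv L m (fd s 5) (fd s 8) p (fd t) \<and> (\<forall>f. f \<notin> {5, 8, 10} \<longrightarrow> fd t f = fd s f) \<and>
    rg t 0 = rg s 0 \<and> rg t 2 = rg s 2"
  have "wp D (While (Df (Vr 4) (Vr 3)) (double_body ;; Asg 4 (Sc (Vr 4)))) Q t k"
    if t: "?I L t" "rg t 4 = L" "rg t 3 = E" for t :: state
  proof (rule wp_for[where I = ?I and L = L and E = E and K = K])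
    fix p k and t :: state assume p: "L \<le> p" "p < E" "rg t 4 = p" "rg t 3 = E" and I: "?I p t"
    have pS: "p \<in> S" using p S by auto
    have pm: "q + m \<notin> S" if "q \<in> S" for q using S m that by auto
    note i = I[THEN conjunct1, unfolded double_inv_def]
    have t8: "fd t 8 p = fd s 8 p" "fd t 5 p = fd s 5 p" using i pS by auto
    have t67: "fd t 6 = fd s 6" "fd t 7 = fd s 7" using I by auto
    show "wp D double_body (\<lambda>s' k'. k' = k \<and> rg s' 4 = p \<and> rg s' 3 = E \<and> ?I (Suc p) s') t k"
    proof (cases "fd s 8 p = 0")
      case True
      have "double_inv L m (fd s 5) (fd s 8) (Suc p) (fd t)"
        using i True unfolding double_inv_def by (auto simp: less_Suc_eq)
      then show ?thesis unfolding double_body_def using True t8 p I by (simp add: wp_simps)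
    next
      case False
      moreover have "fd s 8 p = 0 \<or> fd s 8 p = 1" using c pS unfolding contr_def by blast
      ultimately have w1: "fd s 8 p = 1" by simp
      have nxS: "fd s 5 p \<in> S" by (rule contr_orbit(1)[OF c pS w1])
      define u where "u = (fd t)(5 := (fd t 5)(p + m := fd s 5 p + m),
        10 := (fd t 10)(p := tw p + m, p + m := tw p), 8 := (fd t 8)(p + m := 1))"
      have pne: "q \<noteq> p + m" if "q \<in> S" for q using pm[OF pS] that by auto
      have u: "double_inv L m (fd s 5) (fd s 8) (Suc p) u"
        unfolding double_inv_def
      proof (intro conjI ballI allI impI)
        fix q assume q: "q \<in> S"
        show "u 5 q = fd s 5 q" "u 8 q = fd s 8 q" using i q pne[OF q] by (auto simp: u_def)
        assume "q < Suc p" "fd s 8 q = 1"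
        then show "u 5 (q + m) = fd s 5 q + m" "u 10 q = tw q + m" "u 10 (q + m) = tw q" "u 8 (q + m) = 1"
          using i q pne[OF q] pne[OF pS] pm[OF q] pS by (auto simp: u_def less_Suc_eq)
      next
        fix q assume "q \<notin> S" "\<not> (\<exists>o'\<in>S. o' < Suc p \<and> fd s 8 o' = 1 \<and> q = o' + m)"
        then show "u 8 q = 0" using i pS w1 by (auto simp: u_def less_Suc_eq)
      qed
      show ?thesis unfolding double_body_def
        using False t8 p p(3,4) t67 F6[OF pS] F7[OF pS] F7[OF nxS] F7[OF tw_in[OF pS]] pne[OF pS]
        by (simp add: wp_simps del: fun_upd_apply add: fun_upd_other fun_upd_same)
          (use u I in \<open>simp add: u_def del: fun_upd_apply\<close>)
    qed
  next
    fix t :: state and k' assume "?I E t" "K \<le> k'" "rg t 3 = E"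
    then show "Q t k'" using r by (intro Q) auto
  qed (use t S k in auto)
  moreover have "double_inv L m (fd s 5) (fd s 8) L (fd s)"
    using F8 S unfolding double_inv_def by auto
  ultimately show ?thesis unfolding double_prog_def using r by (simp add: wp_simps)
qed

lemma cubic_bip_double:
  assumes S: "S = {L..<E}" "L \<le> E" and m: "m = E - L" and c: "contr nx w cl" and d: "double_inv L m nx w E F"
  defines "H \<equiv> {p \<in> S. w p = 1} \<union> (\<lambda>p. p + m) ` {p \<in> S. w p = 1}"
  shows "cubic_bip H (F 5) (F 10) (\<lambda>h. h \<in> S)" "card H \<le> 2 * card S"
    "cubic_bip.balanced H (F 5) (F 10) (F 8)" "\<And>p. p \<notin> H \<Longrightarrow> F 8 p = 0"
proof -
  define O' where "O' = {p \<in> S. w p = 1}"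
  have nS: "p + m \<notin> S" if "p \<in> S" for p using that S m by auto
  have O1: "nx p \<in> O'" "nx (nx (nx p)) = p" "nx p \<noteq> p" "tw p \<in> O'" "tw (tw p) = p" "p \<in> S" if "p \<in> O'" for p
    using contr_orbit[OF c, of p] that tw_in tw_tw c unfolding O'_def contr_def by auto
  have F1: "F 5 p = nx p" "F 8 p = 1" "F 5 (p + m) = nx p + m" "F 10 p = tw p + m" "F 10 (p + m) = tw p"
    "F 8 (p + m) = 1" if "p \<in> O'" for p
    using d that S unfolding double_inv_def O'_def by auto
  have H: "H = O' \<union> (\<lambda>p. p + m) ` O'" by (simp add: H_def O'_def)
  show 1: "cubic_bip H (F 5) (F 10) (\<lambda>h. h \<in> S)"
  proof
    show "finite H" "0 \<notin> H" using finS zeroS by (auto simp: H_def)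
    fix h assume "h \<in> H"
    then obtain p where p: "p \<in> O'" "h = p \<or> h = p + m" by (auto simp: H)
    note O1p = O1[OF p(1)]
    note O2 = O1[OF O1p(1)]
    note O3 = O1[OF O1p(4)]
    have HI: "q \<in> H \<and> q + m \<in> H" if "q \<in> O'" for q using that by (auto simp: H)
    have HI': "nx p \<in> H" "nx p + m \<in> H" "tw p \<in> H" "tw p + m \<in> H" using HI O1p(1,4) by auto
    have ns: "p + m \<notin> S" "nx p + m \<notin> S" "tw p + m \<notin> S" using nS O1p(6) O2(6) O3(6) by auto
    note F1s = F1(1,3-5)[OF p(1)] F1(1,3-5)[OF O1p(1)] F1(1,3-5)[OF O2(1)] F1(1,3-5)[OF O1p(4)]
    have "F 5 h \<in> H \<and> F 5 (F 5 (F 5 h)) = h \<and> F 5 h \<noteq> h \<and> F 10 h \<in> H \<and> F 10 (F 10 h) = h \<and>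
      (F 5 h \<in> S) = (h \<in> S) \<and> (F 10 h \<in> S) \<noteq> (h \<in> S)"
      using p(2)
      by (elim disjE) (simp_all only: F1s HI' ns O1p(2,3,5,6) O2(6) O3(6) add_right_cancel simp_thms)
    then show "F 5 h \<in> H" "F 5 (F 5 (F 5 h)) = h" "F 5 h \<noteq> h" "F 10 h \<in> H" "F 10 (F 10 h) = h"
      "(F 5 h \<in> S) = (h \<in> S)" "(F 10 h \<in> S) \<noteq> (h \<in> S)" by blast+
  qed
  have "card H \<le> card O' + card ((\<lambda>p. p + m) ` O')" unfolding H by (rule card_Un_le)
  also have "\<dots> \<le> card O' + card O'" using finS by (intro add_left_mono card_image_le) (simp add: O'_def)
  also have "\<dots> \<le> 2 * card S" using card_mono[OF finS, of O'] by (auto simp: O'_def)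
  finally show "card H \<le> 2 * card S" .
  interpret cubic_bip H "F 5" "F 10" "\<lambda>h. h \<in> S" by (rule 1)
  have F8: "F 8 h = 1" if "h \<in> H" for h using that F1 by (auto simp: H)
  show "balanced (F 8)" unfolding balanced_def osum_def using F8 nx_in bt_in by simp
  fix p assume p: "p \<notin> H"
  show "F 8 p = 0"
  proof (cases "p \<in> S")
    case True
    then have "w p \<noteq> 1" "F 8 p = w p" using p d by (auto simp: H O'_def double_inv_def)
    then show ?thesis using c True unfolding contr_def by auto
  next
    case False
    then show ?thesis using p d unfolding double_inv_def H_def by blast
  qed
qed

end

section \<open>Reading off the permutation\<close>

context slots
begin

definition class_verts :: "(nat \<Rightarrow> nat) \<Rightarrow> (nat \<Rightarrow> nat) \<Rightarrow> nat \<Rightarrow> nat set" where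
  "class_verts nx cl p = (if cl (ow p) = 0 then {ow p} else {ow p, ow (nx p), ow (nx (nx p))})"

lemma sig_spec_cong:
  "sig_spec nx cl M sg p \<Longrightarrow> (\<And>v. v \<in> class_verts nx cl p \<Longrightarrow> sg' v = sg v) \<Longrightarrow> sig_spec nx cl M sg' p"
  by (auto simp: sig_spec_def class_verts_def Let_def split: if_splits)

text \<open>Selected slots of different classes write to disjoint sets of nodes, so what has been
  stored in field 13 for an earlier class survives.\<close>

lemma class_verts_disjoint:
  assumes c: "contr nx w cl" and o: "a \<in> S" "w a = 1" and p: "p \<in> S" "w p = 1"
    and v: "v \<in> class_verts nx cl a" "v \<in> class_verts nx cl p"
  shows "p = a \<or> p = nx a \<or> p = nx (nx a)"
proof -
  note a1 = contr_orbit[OF c o] note a2 = contr_orbit[OF c a1(1,2)]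
  note p1 = contr_orbit[OF c p] note p2 = contr_orbit[OF c p1(1,2)]
  have cl: "(cl v = 0) = (cl (ow a) = 0)" "(cl v = 0) = (cl (ow p) = 0)"
    using v a1(5) a2(5) p1(5) p2(5) by (auto simp: class_verts_def split: if_splits)
  show ?thesis
  proof (cases "cl v = 0")
    case True
    then have "ow p = ow a" using v cl by (simp add: class_verts_def)
    moreover have "nx q = nx0 q" if "q \<in> S" "cl (ow q) = 0" for q
      using c that unfolding contr_def by blast
    ultimately show ?thesis
      using ow_eq[OF o(1) p(1)] o(1) True cl(1) nx0_in[OF o(1)] ow_nx0[OF o(1)] by simp
  next
    case False
    obtain a' where a': "a' \<in> S" "w a' = 1" "ow a' = v" "a' = a \<or> a' = nx a \<or> a' = nx (nx a)"
      using v(1) False cl(1) a1(1,2) a2(1,2) o unfolding class_verts_def by auto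
    obtain p' where p': "p' \<in> S" "w p' = 1" "ow p' = v" "p' = p \<or> p' = nx p \<or> p' = nx (nx p)"
      using v(2) False cl(2) p1(1,2) p2(1,2) p unfolding class_verts_def by auto
    have "v < n" using a' ow_lt by auto
    then have "\<exists>!q. q \<in> S \<and> ow q = v \<and> w q = 1" using c False unfolding contr_def by blast
    then have e: "p' = a'" using a' p' by blast
    have "nx (nx (nx a)) = a" "nx (nx (nx p)) = p" by (fact a1(3) p1(3))+
    then show ?thesis using a'(4) p'(4) unfolding e by metis
  qed
qed

end

text \<open>A nonzero weight marks a selected slot, so the conditions ask at which node the
  permutation enters the triangle.\<close>

definition sig_class :: com where
  "sig_class = Asg 5 (Ld 5 (Vr 4)) ;; Asg 6 (Ld 5 (Vr 5)) ;;
     Cond (Ld 8 (Ld 6 (Vr 4)))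
       (Sto 13 (Ld 3 (Vr 5)) (Ld 3 (Vr 6)) ;; Sto 13 (Ld 3 (Vr 6)) (Ld 3 (Vr 5)))
       (Cond (Ld 8 (Ld 6 (Vr 5)))
         (Sto 13 (Ld 3 (Vr 5)) (Ld 3 (Vr 6)) ;; Sto 13 (Ld 3 (Vr 6)) (Ld 3 (Vr 4)))
         (Sto 13 (Ld 3 (Vr 6)) (Ld 3 (Vr 5)) ;; Sto 13 (Ld 3 (Vr 5)) (Ld 3 (Vr 4))))"

definition sig_body :: com where
  "sig_body = Cond (Ld 8 (Vr 4))
     (Sto 13 (Ld 3 (Vr 4)) (Ld 2 (Vr 4)) ;; Cond (Ld 9 (Ld 3 (Vr 4))) sig_class Skip) Skip"

definition sig_prog :: com where
  "sig_prog = Asg 4 (Vr 0) ;; While (Df (Vr 4) (Vr 3)) (sig_body ;; Asg 4 (Sc (Vr 4)))"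

context slots
begin

lemma sig_body:
  assumes p: "p \<in> S" "w p = 1" and c: "contr nx w cl"
    and F: "fd s 2 = nb" "fd s 3 = ow" "\<And>q. q \<in> S \<Longrightarrow> fd s 5 q = nx q" "\<And>q. q \<in> S \<Longrightarrow> fd s 6 q = tw q"
      "fd s 9 = cl"
    and M: "M = (\<lambda>q. q \<in> S \<and> fd s 8 q \<noteq> 0)" and Mp: "M p" and r: "rg s 4 = p"
    and Q: "\<And>u. sig_spec nx cl M (fd u 13) p \<Longrightarrow>
      (\<And>v. v \<notin> class_verts nx cl p \<Longrightarrow> fd u 13 v = fd s 13 v) \<Longrightarrow> Q u k"
  shows "wp D sig_body Q s k"
proof -
  define a b where "a = nx p" and "b = nx a"
  note p1 = contr_orbit[OF c p] note p2 = contr_orbit[OF c p1(1,2)]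
  have S: "a \<in> S" "b \<in> S" using p1 p2 by (auto simp: a_def b_def)
  have f: "fd s 5 p = a" "fd s 5 a = b" "fd s 6 p = tw p" "fd s 6 a = tw a"
    using F(3,4) p(1) S by (auto simp: a_def b_def)
  have M': "M (tw p) \<longleftrightarrow> fd s 8 (tw p) \<noteq> 0" "M (tw a) \<longleftrightarrow> fd s 8 (tw a) \<noteq> 0"
    using tw_in p S by (auto simp: M)
  have d: "ow a \<noteq> ow p" "ow b \<noteq> ow p" "ow b \<noteq> ow a" if "cl (ow p) \<noteq> 0"
    using c that p p1 unfolding contr_def a_def b_def by metis+
  have spec: "sig_spec nx cl M sg p \<longleftrightarrow> sg (ow p) = nb p \<and> (cl (ow p) \<noteq> 0 \<longrightarrow>
     (if fd s 8 (tw p) \<noteq> 0 then sg (ow a) = ow b \<and> sg (ow b) = ow a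
      else if fd s 8 (tw a) \<noteq> 0 then sg (ow a) = ow b \<and> sg (ow b) = ow p
      else sg (ow b) = ow a \<and> sg (ow a) = ow p))" for sg
    by (simp add: sig_spec_def Let_def M' flip: a_def b_def)
  have cv: "class_verts nx cl p = (if cl (ow p) = 0 then {ow p} else {ow p, ow a, ow b})"
    by (simp add: class_verts_def a_def b_def)
  have cls: "wp D sig_class Q u k"
    if u: "fd u = (fd s)(13 := (fd s 13)(ow p := nb p))" "rg u 4 = p" and cl: "cl (ow p) \<noteq> 0" for u
    unfolding sig_class_def using u F f
    by (simp add: wp_simps del: fun_upd_apply add: fun_upd_other fun_upd_same)
      (intro conjI impI; rule Q; use cl d[OF cl] in \<open>auto simp: spec cv\<close>)
  show ?thesis
    unfolding sig_body_def using r F Mp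
    by (simp add: wp_simps M del: fun_upd_apply add: fun_upd_other fun_upd_same)
      (intro conjI impI; (rule Q | rule cls); auto simp: spec cv)
qed

lemma sig_prog:
  assumes S: "S = {L..<E}" "L \<le> E" and c: "contr nx w cl"
    and F: "fd s 2 = nb" "fd s 3 = ow" "\<And>q. q \<in> S \<Longrightarrow> fd s 5 q = nx q" "\<And>q. q \<in> S \<Longrightarrow> fd s 6 q = tw q"
      "fd s 9 = cl"
    and M: "M = (\<lambda>q. q \<in> S \<and> fd s 8 q \<noteq> 0)" and Mw: "\<And>p. M p \<Longrightarrow> w p = 1"
    and uniq: "\<And>p. M p \<Longrightarrow> \<not> M (nx p) \<and> \<not> M (nx (nx p))"
    and r: "rg s 0 = L" "rg s 3 = E" and k: "K + (E - L) \<le> k"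
    and Q: "\<And>u k'. (\<And>p. M p \<Longrightarrow> sig_spec nx cl M (fd u 13) p) \<Longrightarrow>
      (\<And>f. f \<noteq> 13 \<Longrightarrow> fd u f = fd s f) \<Longrightarrow> (\<And>x. x \<in> {0, 2, 3} \<Longrightarrow> rg u x = rg s x) \<Longrightarrow>
      K \<le> k' \<Longrightarrow> Q u k'"
  shows "wp D sig_prog Q s k"
proof -
  let ?I = "\<lambda>p t. (\<forall>q. M q \<longrightarrow> q < p \<longrightarrow> sig_spec nx cl M (fd t 13) q) \<and>
    (\<forall>f. f \<noteq> 13 \<longrightarrow> fd t f = fd s f) \<and> rg t 0 = rg s 0 \<and> rg t 2 = rg s 2"
  have "wp D (While (Df (Vr 4) (Vr 3)) (sig_body ;; Asg 4 (Sc (Vr 4)))) Q t k"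
    if t: "?I L t" "rg t 4 = L" "rg t 3 = E" for t :: state
  proof (rule wp_for[where I = ?I and L = L and E = E and K = K])
    fix p k and t :: state assume p: "L \<le> p" "p < E" "rg t 4 = p" "rg t 3 = E" and I: "?I p t"
    have pS: "p \<in> S" using p S by auto
    show "wp D sig_body (\<lambda>s' k'. k' = k \<and> rg s' 4 = p \<and> rg s' 3 = E \<and> ?I (Suc p) s') t k"
    proof (cases "M p")
      case False
      then have "fd t 8 p = 0" using I pS by (simp add: M)
      moreover have "q < p" if "M q" "q < Suc p" for q using that False by (cases "q = p") auto
      ultimately show ?thesis unfolding sig_body_def using p I by (simp add: wp_simps)
    next
      case True
      show ?thesis
      proof (rule wp_frame)
        show "wp D sig_body (\<lambda>u k'. k' = k \<and> sig_spec nx cl M (fd u 13) p \<and>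
          (\<forall>v. v \<notin> class_verts nx cl p \<longrightarrow> fd u 13 v = fd t 13 v)) t k"
          by (rule sig_body[OF pS Mw[OF True] c]) (use I F p True M in auto)
        fix u :: state and k'
        assume 1: "k' = k \<and> sig_spec nx cl M (fd u 13) p \<and>
            (\<forall>v. v \<notin> class_verts nx cl p \<longrightarrow> fd u 13 v = fd t 13 v)"
          and 2: "\<And>f. f \<notin> wflds sig_body \<Longrightarrow> fd u f = fd t f" "\<And>x. x \<notin> wvars sig_body \<Longrightarrow> rg u x = rg t x"
        have "sig_spec nx cl M (fd u 13) q" if q: "M q" "q < Suc p" for q
        proof (cases "q = p")
          case True
          then show ?thesis using 1 by simp
        next
          case False
          have qS: "q \<in> S" using q M by auto
          have "v \<notin> class_verts nx cl p" if "v \<in> class_verts nx cl q" for v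
          proof
            assume "v \<in> class_verts nx cl p"
            from class_verts_disjoint[OF c qS Mw[OF q(1)] pS Mw[OF True] that this]
            show False using uniq[OF q(1)] True False by auto
          qed
          moreover have "sig_spec nx cl M (fd t 13) q" using I q False by auto
          ultimately show ?thesis using 1 by (auto intro: sig_spec_cong)
        qed
        then show "k' = k \<and> rg u 4 = p \<and> rg u 3 = E \<and> ?I (Suc p) u"
          using 1 2 I p by (simp add: sig_body_def sig_class_def)
      qed
    qed
  next
    fix t :: state and k' assume t: "?I E t" "K \<le> k'" "rg t 3 = E"
    have "q < E" if "M q" for q using that M S by auto
    then show "Q t k'" using t r by (intro Q) auto
  qed (use t S k in auto)
  moreover have "\<not> (M q \<and> q < L)" for q using M S by auto
  ultimately show ?thesis unfolding sig_prog_def using r by (simp add: wp_simps)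
qed

end

section \<open>Values along the cycles\<close>

lemma period_eq_card: "p permutes V \<Longrightarrow> finite V \<Longrightarrow> period p v = card (set (cyc p v))"
  by (simp add: distinct_card distinct_cyc)

lemma period_orbit: "p permutes V \<Longrightarrow> finite V \<Longrightarrow> period p ((p ^^ i) v) = period p v"
proof -
  assume p: "p permutes V" "finite V"
  have "(p ^^ i) v \<in> set (cyc p v)" unfolding set_cyc[OF p] by blast
  then show ?thesis by (simp only: period_eq_card[OF p] set_cyc_eq[OF p])
qed

definition alt_body :: com where
  "alt_body = Sto 14 (Vr 5) (Vr 6) ;; Asg 6 (Sb (Nm 2) (Vr 6)) ;; Sto 15 (Vr 5) (Nm 1) ;;
     Asg 5 (Ld 13 (Vr 5))"

definition one_body :: com where
  "one_body = Sto 14 (Vr 5) (Nm 1) ;; Asg 5 (Ld 13 (Vr 5))"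

text \<open>The parity of a cycle is known only after one round, when variable 6 is 0 if and only if
  the cycle is odd. A second round then writes 1 everywhere; the first one has written only 0 and 2,
  so meeting a 1 ends the second.\<close>

definition cyc_body :: com where
  "cyc_body = Cond (Ld 15 (Vr 4)) Skip (Asg 5 (Vr 4) ;; Asg 6 (Nm 2) ;;
     While (Df (Ld 15 (Vr 5)) (Nm 1)) alt_body ;;
     Cond (Vr 6) Skip (While (Df (Ld 14 (Vr 5)) (Nm 1)) one_body))"

definition cyc_prog :: com where
  "cyc_prog = Asg 4 (Nm 0) ;; While (Df (Vr 4) (Vr 2)) (cyc_body ;; Asg 4 (Sc (Vr 4)))"

lemma funpow_orbit_distinct:
  assumes "p permutes V" "finite V" "i < period p v" "j < period p v" "(p ^^ i) v = (p ^^ j) v"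
  shows "i = j"
  using distinct_cyc[OF assms(1,2), of v] assms(3-5) by (auto simp: cyc_def distinct_map inj_on_def)

text \<open>After \<open>j\<close> iterations exactly the first \<open>j\<close> nodes of the cycle
  have been marked, so the first marked node met again is \<open>v\<close>, after one full
  round.\<close>

lemma alt_loop:
  assumes p: "p permutes V" "finite V" and sg: "\<And>i. fd s 13 ((p ^^ i) v) = (p ^^ Suc i) v"
    and un: "\<And>i. fd s 15 ((p ^^ i) v) = 0" and r: "rg s 5 = v" "rg s 6 = 2"
    and k: "C + period p v \<le> k"
    and Q: "\<And>u k'. rg u 5 = v \<Longrightarrow> rg u 6 = (if even (period p v) then 2 else 0) \<Longrightarrow>
      (\<And>i. i < period p v \<Longrightarrow> fd u 15 ((p ^^ i) v) = 1 \<and> fd u 14 ((p ^^ i) v) = (if even i then 2 else 0)) \<Longrightarrow>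
      (\<And>x. x \<notin> set (cyc p v) \<Longrightarrow> fd u 15 x = fd s 15 x \<and> fd u 14 x = fd s 14 x) \<Longrightarrow>
      (\<And>f. f \<notin> {14, 15} \<Longrightarrow> fd u f = fd s f) \<Longrightarrow> C \<le> k' \<Longrightarrow> Q u k'"
  shows "wp D (While (Df (Ld 15 (Vr 5)) (Nm 1)) alt_body) Q s k"
proof -
  let ?K = "period p v"
  let ?A = "\<lambda>j u. rg u 5 = (p ^^ j) v \<and> rg u 6 = (if even j then 2 else 0) \<and>
    (\<forall>i<j. fd u 15 ((p ^^ i) v) = 1 \<and> fd u 14 ((p ^^ i) v) = (if even i then 2 else 0)) \<and>
    (\<forall>x. (\<forall>i<j. x \<noteq> (p ^^ i) v) \<longrightarrow> fd u 15 x = fd s 15 x \<and> fd u 14 x = fd s 14 x) \<and>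
    (\<forall>f. f \<notin> {14, 15} \<longrightarrow> fd u f = fd s f)"
  let ?I = "\<lambda>u k. \<exists>j\<le>?K. ?A j u \<and> C + ?K \<le> k + j"
  have dis: "(p ^^ i) v \<noteq> (p ^^ j) v" if "i < j" "j < ?K" for i j
    using funpow_orbit_distinct[OF p, of i v j] that by auto
  show ?thesis
  proof (rule wp_While[where I = ?I])
    show "?I s k" using r k by (intro exI[of _ 0]) auto
  next
    fix u :: state and k assume "?I u k"
    then obtain j where j: "j \<le> ?K" "?A j u" "C + ?K \<le> k + j" by blast
    {
      assume e: "ev (Df (Ld 15 (Vr 5)) (Nm 1)) u = 0"
      have "j = ?K"
      proof (rule ccontr)
        assume "j \<noteq> ?K"
        then have "j < ?K" using j(1) by simp
        then have "fd u 15 ((p ^^ j) v) = 0" using j(2) un dis by metis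
        then show False using e j(2) by simp
      qed
      then show "Q u k"
        using j period(2)[OF p, of v] by (intro Q) (auto simp: cyc_def image_iff)
    next
      assume e: "ev (Df (Ld 15 (Vr 5)) (Nm 1)) u \<noteq> 0"
      have "j \<noteq> ?K"
      proof
        assume "j = ?K"
        then have "fd u 15 ((p ^^ 0) v) = 1" "rg u 5 = v" using j(2) period(1,2)[OF p, of v] by auto
        then show False using e by simp
      qed
      then have jK: "j < ?K" using j(1) by simp
      obtain m where m: "k = Suc m" using j(3) jK by (cases k) auto
      have s13: "fd u 13 ((p ^^ j) v) = p ((p ^^ j) v)" using sg[of j] j(2) by simp
      have fin: "?I t m"
        if t: "rg t 5 = p ((p ^^ j) v)" "rg t 6 = 2 - rg u 6"
          "fd t 14 = (fd u 14)((p ^^ j) v := rg u 6)" "fd t 15 = (fd u 15)((p ^^ j) v := 1)"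
          "\<And>f. f \<notin> {14, 15} \<Longrightarrow> fd t f = fd u f" for t :: state
      proof (intro exI[of _ "Suc j"] conjI allI impI)
        fix i assume "i < Suc j"
        then have "i = j \<or> i < j \<and> (p ^^ i) v \<noteq> (p ^^ j) v" using dis[of i j] jK by auto
        then show "fd t 15 ((p ^^ i) v) = 1" "fd t 14 ((p ^^ i) v) = (if even i then 2 else 0)"
          using j(2) t by auto
      next
        fix x assume "\<forall>i<Suc j. x \<noteq> (p ^^ i) v"
        then have "x \<noteq> (p ^^ j) v" "\<forall>i<j. x \<noteq> (p ^^ i) v" by auto
        then show "fd t 15 x = fd s 15 x" "fd t 14 x = fd s 14 x"
          using j(2) t by auto
      qed (use j(2,3) jK t m in auto)
      have step: "wp D alt_body R u m"
        if "\<And>t. rg t 5 = p ((p ^^ j) v) \<Longrightarrow> rg t 6 = 2 - rg u 6 \<Longrightarrow>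
          fd t 14 = (fd u 14)((p ^^ j) v := rg u 6) \<Longrightarrow> fd t 15 = (fd u 15)((p ^^ j) v := 1) \<Longrightarrow>
          (\<And>f. f \<notin> {14, 15} \<Longrightarrow> fd t f = fd u f) \<Longrightarrow> R t m" for R
        unfolding alt_body_def using j(2)[THEN conjunct1] s13
        by (simp add: wp_simps del: fun_upd_apply add: fun_upd_other fun_upd_same)
          (rule that; simp add: fun_upd_other fun_upd_same del: fun_upd_apply)
      have "wp D alt_body ?I u m" by (rule step) (rule fin)
      then show "0 < k \<and> wp D alt_body ?I u (k - 1)" by (simp add: m)
    }
  qed simp
qed

lemma one_loop:
  assumes p: "p permutes V" "finite V" and sg: "\<And>i. fd s 13 ((p ^^ i) v) = (p ^^ Suc i) v"
    and un: "\<And>i. i < period p v \<Longrightarrow> fd s 14 ((p ^^ i) v) \<noteq> 1" and r: "rg s 5 = v"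
    and k: "C + period p v \<le> k"
    and Q: "\<And>u k'. (\<And>i. i < period p v \<Longrightarrow> fd u 14 ((p ^^ i) v) = 1) \<Longrightarrow>
      (\<And>x. x \<notin> set (cyc p v) \<Longrightarrow> fd u 14 x = fd s 14 x) \<Longrightarrow>
      (\<And>f. f \<noteq> 14 \<Longrightarrow> fd u f = fd s f) \<Longrightarrow> C \<le> k' \<Longrightarrow> Q u k'"
  shows "wp D (While (Df (Ld 14 (Vr 5)) (Nm 1)) one_body) Q s k"
proof -
  let ?K = "period p v"
  let ?A = "\<lambda>j u. rg u 5 = (p ^^ j) v \<and> (\<forall>i<j. fd u 14 ((p ^^ i) v) = 1) \<and>
    (\<forall>x. (\<forall>i<j. x \<noteq> (p ^^ i) v) \<longrightarrow> fd u 14 x = fd s 14 x) \<and> (\<forall>f. f \<noteq> 14 \<longrightarrow> fd u f = fd s f)"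
  let ?I = "\<lambda>u k. \<exists>j\<le>?K. ?A j u \<and> C + ?K \<le> k + j"
  have dis: "(p ^^ i) v \<noteq> (p ^^ j) v" if "i < j" "j < ?K" for i j
    using funpow_orbit_distinct[OF p, of i v j] that by auto
  show ?thesis
  proof (rule wp_While[where I = ?I])
    show "?I s k" using r k by (intro exI[of _ 0]) auto
  next
    fix u :: state and k assume "?I u k"
    then obtain j where j: "j \<le> ?K" "?A j u" "C + ?K \<le> k + j" by blast
    {
      assume e: "ev (Df (Ld 14 (Vr 5)) (Nm 1)) u = 0"
      have "j = ?K"
      proof (rule ccontr)
        assume "j \<noteq> ?K"
        then have "j < ?K" using j(1) by simp
        then have "fd u 14 ((p ^^ j) v) \<noteq> 1" using j(2) un dis by metis
        then show False using e j(2) by simp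
      qed
      then show "Q u k"
        using j by (intro Q) (auto simp: cyc_def image_iff)
    next
      assume e: "ev (Df (Ld 14 (Vr 5)) (Nm 1)) u \<noteq> 0"
      have "j \<noteq> ?K"
      proof
        assume "j = ?K"
        then have "fd u 14 ((p ^^ 0) v) = 1" "rg u 5 = v" using j(2) period(1,2)[OF p, of v] by auto
        then show False using e by simp
      qed
      then have jK: "j < ?K" using j(1) by simp
      obtain m where m: "k = Suc m" using j(3) jK by (cases k) auto
      have s13: "fd u 13 ((p ^^ j) v) = p ((p ^^ j) v)" using sg[of j] j(2) by simp
      have fin: "?I t m"
        if t: "rg t 5 = p ((p ^^ j) v)" "fd t 14 = (fd u 14)((p ^^ j) v := 1)"
          "\<And>f. f \<noteq> 14 \<Longrightarrow> fd t f = fd u f" for t :: state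
      proof (intro exI[of _ "Suc j"] conjI allI impI)
        fix i assume "i < Suc j"
        then show "fd t 14 ((p ^^ i) v) = 1" using j(2) t by (auto simp: less_Suc_eq)
      next
        fix x assume "\<forall>i<Suc j. x \<noteq> (p ^^ i) v"
        then have "x \<noteq> (p ^^ j) v" "\<forall>i<j. x \<noteq> (p ^^ i) v" by auto
        then show "fd t 14 x = fd s 14 x" using j(2) t by auto
      qed (use j(2,3) jK t m in auto)
      have step: "wp D one_body R u m"
        if "\<And>t. rg t 5 = p ((p ^^ j) v) \<Longrightarrow> fd t 14 = (fd u 14)((p ^^ j) v := 1) \<Longrightarrow>
          (\<And>f. f \<noteq> 14 \<Longrightarrow> fd t f = fd u f) \<Longrightarrow> R t m" for R
        unfolding one_body_def using j(2)[THEN conjunct1] s13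
        by (simp add: wp_simps del: fun_upd_apply add: fun_upd_other fun_upd_same)
          (rule that; simp add: fun_upd_other fun_upd_same del: fun_upd_apply)
      have "wp D one_body ?I u m" by (rule step) (rule fin)
      then show "0 < k \<and> wp D one_body ?I u (k - 1)" by (simp add: m)
    }
  qed simp
qed

text \<open>The clause on \<open>vs (p u)\<close> makes the visited set a union of whole
  cycles.\<close>

definition cyc_inv :: "nat \<Rightarrow> (nat \<Rightarrow> nat) \<Rightarrow> (nat \<Rightarrow> nat) \<Rightarrow> (nat \<Rightarrow> nat) \<Rightarrow> bool" where
  "cyc_inv n p vl vs \<longleftrightarrow> (\<forall>u<n. vs u = 0 \<or> vs u = 1 \<and> vs (p u) = 1 \<and> vl u + vl (p u) = 2 \<and>
     (vl u = 1 \<longrightarrow> odd (period p u)))"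

text \<open>A visited node on the cycle of \<open>v\<close> would pass its mark on along
  \<open>p\<close> until it reaches \<open>v\<close>.\<close>

lemma cyc_inv_orbit:
  assumes p: "p permutes {..<n}" and v: "v < n" "vs v = 0" and i: "cyc_inv n p vl vs"
  shows "vs ((p ^^ i) v) = 0" "(p ^^ i) v < n"
proof -
  have fin: "finite {..<n}" by simp
  have pn: "p u < n" if "u < n" for u using permutes_in_image[OF p, of u] that by simp
  have lt: "(p ^^ i) v < n" for i by (induction i) (use v pn in auto)
  then show "(p ^^ i) v < n" .
  have fwd: "vs ((p ^^ k) ((p ^^ i) v)) = 1" if "vs ((p ^^ i) v) = 1" for k
  proof (induction k)
    case (Suc k)
    have "(p ^^ k) ((p ^^ i) v) < n" using lt[of "k + i"] by (simp add: funpow_add)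
    then show ?case using Suc i unfolding cyc_inv_def by fastforce
  qed (use that in simp)
  have "v \<in> set (cyc p ((p ^^ i) v))"
  proof -
    have "(p ^^ i) v \<in> set (cyc p v)" "v \<in> set (cyc p v)"
      unfolding set_cyc[OF p fin] by (auto intro: exI[of _ 0])
    then show ?thesis using set_cyc_eq[OF p fin] by blast
  qed
  then obtain k where "v = (p ^^ k) ((p ^^ i) v)" unfolding set_cyc[OF p fin] by blast
  then have "vs ((p ^^ i) v) \<noteq> 1" using fwd[of k] v(2) by auto
  then show "vs ((p ^^ i) v) = 0" using i[unfolded cyc_inv_def, rule_format, OF lt[of i]] by simp
qed

lemma cyc_inv_extend:
  assumes p: "p permutes {..<n}" and v: "v < n" "vs v = 0" and i: "cyc_inv n p vl vs"
    and vs': "\<And>i. i < period p v \<Longrightarrow> vs' ((p ^^ i) v) = 1" "\<And>x. x \<notin> set (cyc p v) \<Longrightarrow> vs' x = vs x \<and> vl' x = vl x"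
    and vl': "if even (period p v) then \<forall>i<period p v. vl' ((p ^^ i) v) = (if even i then 2 else 0)
      else \<forall>i<period p v. vl' ((p ^^ i) v) = 1"
  shows "cyc_inv n p vl' vs'" "vs' v = 1" "\<And>u. vs u = 1 \<Longrightarrow> vs' u = 1"
    "card {u \<in> {..<n}. vs' u = 0} + period p v \<le> card {u \<in> {..<n}. vs u = 0}"
proof -
  have fin: "finite {..<n}" by simp
  let ?K = "period p v"
  note orb = cyc_inv_orbit[where vs = vs, OF p v i]
  have set: "set (cyc p v) = (\<lambda>i. (p ^^ i) v) ` {..<?K}" by (auto simp: cyc_def)
  have in0: "vs x = 0 \<and> x < n" if "x \<in> set (cyc p v)" for x using that orb by (auto simp: set)
  have in1: "vs' x = 1" if "x \<in> set (cyc p v)" for x using that vs'(1) by (auto simp: set)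
  show mono: "vs' u = 1" if "vs u = 1" for u
    using that in0[of u] in1[of u] vs'(2)[of u] by (cases "u \<in> set (cyc p v)") auto
  have "v \<in> set (cyc p v)" unfolding set_cyc[OF p fin] by (auto intro: exI[of _ 0])
  then show "vs' v = 1" by (rule in1)
  show "cyc_inv n p vl' vs'"
    unfolding cyc_inv_def
  proof (intro allI impI)
    fix u assume u: "u < n"
    show "vs' u = 0 \<or> vs' u = 1 \<and> vs' (p u) = 1 \<and> vl' u + vl' (p u) = 2 \<and> (vl' u = 1 \<longrightarrow> odd (period p u))"
    proof (cases "u \<in> set (cyc p v)")
      case True
      then obtain i where i: "i < ?K" "u = (p ^^ i) v" by (auto simp: set)
      have pu: "p u = (p ^^ Suc i) v" by (simp add: i)
      have "p u \<in> set (cyc p v)" unfolding pu set_cyc[OF p fin] by blast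
      then have 1: "vs' u = 1" "vs' (p u) = 1" using in1 True by auto
      have per: "period p u = ?K" unfolding i(2) by (rule period_orbit[OF p fin])
      have pu': "p u = (if Suc i = ?K then (p ^^ 0) v else (p ^^ Suc i) v)"
        using period(2)[OF p fin, of v] pu by (metis funpow_0)
      have K0: "0 < ?K" by (rule period(1)[OF p fin])
      have "vl' u + vl' (p u) = 2 \<and> (vl' u = 1 \<longrightarrow> odd ?K)"
      proof (cases "even ?K")
        case True
        then have *: "vl' ((p ^^ j) v) = (if even j then 2 else 0)" if "j < ?K" for j
          using vl' that by simp
        show ?thesis
        proof (cases "Suc i = ?K")
          case Suc: True
          \<comment> \<open>Where an even cycle closes, the last value is 0 and the first is
            2.\<close>
          then have "odd i" using \<open>even ?K\<close> by (metis even_Suc)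
          then show ?thesis using *[of i] *[of 0] i K0 pu' Suc by simp
        next
          case False
          then show ?thesis using *[of i] *[of "Suc i"] i pu by auto
        qed
      next
        case False
        then have *: "vl' ((p ^^ j) v) = 1" if "j < ?K" for j using vl' that by simp
        have "p u = (p ^^ 0) v \<or> Suc i < ?K \<and> p u = (p ^^ Suc i) v" using pu' i(1) by (auto split: if_splits)
        then have "vl' (p u) = 1" using *[of 0] *[of "Suc i"] K0 by metis
        then show ?thesis using *[OF i(1)] i(2) False by simp
      qed
      then show ?thesis using 1 per by simp
    next
      case False
      have pF: "p u \<notin> set (cyc p v)"
      proof
        assume "p u \<in> set (cyc p v)"
        then have e: "set (cyc p (p u)) = set (cyc p v)" by (rule set_cyc_eq[OF p fin])
        have "p u \<in> set (cyc p u)" unfolding set_cyc[OF p fin] by (auto intro: exI[of _ 1])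
        then have "set (cyc p (p u)) = set (cyc p u)" by (rule set_cyc_eq[OF p fin])
        moreover have "u \<in> set (cyc p u)" unfolding set_cyc[OF p fin] by (auto intro: exI[of _ 0])
        ultimately show False using False e by simp
      qed
      show ?thesis using i[unfolded cyc_inv_def, rule_format, OF u] vs'(2)[OF False] vs'(2)[OF pF] by simp
    qed
  qed
  have "card (set (cyc p v)) = ?K" using period_eq_card[OF p fin] by simp
  moreover have "{u \<in> {..<n}. vs' u = 0} \<inter> set (cyc p v) = {}" using in1 by fastforce
  moreover have "{u \<in> {..<n}. vs' u = 0} \<union> set (cyc p v) \<subseteq> {u \<in> {..<n}. vs u = 0}"
  proof
    fix x assume "x \<in> {u \<in> {..<n}. vs' u = 0} \<union> set (cyc p v)"
    then show "x \<in> {u \<in> {..<n}. vs u = 0}"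
      using in0[of x] vs'(2)[of x] by (cases "x \<in> set (cyc p v)") auto
  qed
  then have "card ({u \<in> {..<n}. vs' u = 0} \<union> set (cyc p v)) \<le> card {u \<in> {..<n}. vs u = 0}"
    by (intro card_mono) auto
  ultimately show "card {u \<in> {..<n}. vs' u = 0} + ?K \<le> card {u \<in> {..<n}. vs u = 0}"
    by (subst (asm) card_Un_disjoint) auto
qed

text \<open>Every unvisited node carries a budget of 2, one for each round.\<close>

lemma cyc_body:
  assumes p: "p permutes {..<n}" and sg: "\<And>u. u < n \<Longrightarrow> fd s 13 u = p u" and v: "v < n" "rg s 4 = v"
    and i: "cyc_inv n p (fd s 14) (fd s 15)" and k: "C + 2 * card {u \<in> {..<n}. fd s 15 u = 0} \<le> k"
    and Q: "\<And>u k'. cyc_inv n p (fd u 14) (fd u 15) \<Longrightarrow> fd u 15 v = 1 \<Longrightarrow>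
      (\<And>x. fd s 15 x = 1 \<Longrightarrow> fd u 15 x = 1) \<Longrightarrow>
      C + 2 * card {x \<in> {..<n}. fd u 15 x = 0} \<le> k' \<Longrightarrow> Q u k'"
  shows "wp D cyc_body Q s k"
proof (cases "fd s 15 v = 0")
  case False
  then have "fd s 15 v = 1" using i[unfolded cyc_inv_def, rule_format, OF v(1)] by simp
  then have "Q s k" using i k by (intro Q) auto
  then show ?thesis unfolding cyc_body_def using False v by (simp add: wp_simps)
next
  case True
  have fin: "finite {..<n}" by simp
  note orb = cyc_inv_orbit[where vs = "fd s 15", OF p v(1) True i]
  note ext = cyc_inv_extend[where vs = "fd s 15", OF p v(1) True i]
  let ?C = "C + 2 * (card {u \<in> {..<n}. fd s 15 u = 0} - period p v)"
  have le: "period p v \<le> card {u \<in> {..<n}. fd s 15 u = 0}"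
  proof -
    have "set (cyc p v) \<subseteq> {u \<in> {..<n}. fd s 15 u = 0}" using orb by (auto simp: cyc_def)
    from card_mono[OF _ this] show ?thesis using period_eq_card[OF p fin] by simp
  qed
  have two: "wp D (Cond (Vr 6) Skip (While (Df (Ld 14 (Vr 5)) (Nm 1)) one_body)) Q t k'"
    if t: "rg t 5 = v" "rg t 6 = (if even (period p v) then 2 else 0)"
      "\<And>i. i < period p v \<Longrightarrow> fd t 15 ((p ^^ i) v) = 1 \<and> fd t 14 ((p ^^ i) v) = (if even i then 2 else 0)"
      "\<And>x. x \<notin> set (cyc p v) \<Longrightarrow> fd t 15 x = fd s 15 x \<and> fd t 14 x = fd s 14 x"
      "\<And>f. f \<notin> {14, 15} \<Longrightarrow> fd t f = fd s f" "?C + period p v \<le> k'" for t :: state and k'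
  proof -
    have finish: "Q u k''"
      if u: "\<And>i. i < period p v \<Longrightarrow> fd u 15 ((p ^^ i) v) = 1"
        "\<And>x. x \<notin> set (cyc p v) \<Longrightarrow> fd u 15 x = fd s 15 x \<and> fd u 14 x = fd s 14 x"
        "if even (period p v) then \<forall>i<period p v. fd u 14 ((p ^^ i) v) = (if even i then 2 else 0)
          else \<forall>i<period p v. fd u 14 ((p ^^ i) v) = 1" "?C \<le> k''" for u :: state and k''
    proof -
      note e = ext[of "fd u 15" "fd u 14", OF u(1-3)]
      show ?thesis by (rule Q[OF e(1-3)]) (use e(4) u(4) in auto)
    qed
    show ?thesis
    proof (cases "even (period p v)")
      case True
      then have "Q t k'" using t by (intro finish) auto
      then show ?thesis using t True by (simp add: wp_simps)
    next
      case False
      have "wp D (While (Df (Ld 14 (Vr 5)) (Nm 1)) one_body) Q t k'"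
      proof (rule one_loop[OF p fin, where C = ?C])
        show "fd t 13 ((p ^^ i) v) = (p ^^ Suc i) v" for i
          using sg[OF orb(2)[of i]] t(5)[of 13] by simp
        show "fd t 14 ((p ^^ i) v) \<noteq> 1" if "i < period p v" for i using t(3)[OF that] by simp
        fix u :: state and k''
        assume u: "\<And>i. i < period p v \<Longrightarrow> fd u 14 ((p ^^ i) v) = 1"
          "\<And>x. x \<notin> set (cyc p v) \<Longrightarrow> fd u 14 x = fd t 14 x" "\<And>f. f \<noteq> 14 \<Longrightarrow> fd u f = fd t f" "?C \<le> k''"
        show "Q u k''" by (rule finish) (use u t False in auto)
      qed (use t in auto)
      then show ?thesis using t False by (simp add: wp_simps)
    qed
  qed
  have "wp D (While (Df (Ld 15 (Vr 5)) (Nm 1)) alt_body)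
      (wp D (Cond (Vr 6) Skip (While (Df (Ld 14 (Vr 5)) (Nm 1)) one_body)) Q) t k"
    if t: "fd t = fd s" "rg t 5 = v" "rg t 6 = 2" for t :: state
  proof (rule alt_loop[OF p fin, where C = "?C + period p v"])
    show "fd t 13 ((p ^^ i) v) = (p ^^ Suc i) v" for i
      using sg[OF orb(2)[of i]] t by simp
    show "fd t 15 ((p ^^ i) v) = 0" for i using orb(1) t by simp
    show "?C + period p v + period p v \<le> k" using k le by linarith
  qed (use t two in auto)
  then show ?thesis unfolding cyc_body_def using True v by (simp add: wp_simps)
qed

text \<open>One iteration per node pays for the scan, two for the rounds.\<close>

lemma cyc_prog:
  assumes p: "p permutes {..<n}" and sg: "\<And>u. u < n \<Longrightarrow> fd s 13 u = p u" and r: "rg s 2 = n"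
    and vs: "fd s 15 = (\<lambda>_. 0)" and k: "C + 3 * n \<le> k"
    and Q: "\<And>u k'. (\<And>v. v < n \<Longrightarrow> fd u 14 v + fd u 14 (p v) = 2 \<and> (fd u 14 v = 1 \<longrightarrow> odd (period p v))) \<Longrightarrow>
      (\<And>f. f \<notin> {14, 15} \<Longrightarrow> fd u f = fd s f) \<Longrightarrow> (\<And>x. x \<in> {0, 2, 3} \<Longrightarrow> rg u x = rg s x) \<Longrightarrow>
      C \<le> k' \<Longrightarrow> Q u k'"
  shows "wp D cyc_prog Q s k"
proof -
  let ?I = "\<lambda>t k. rg t 2 = n \<and> rg t 4 \<le> n \<and> cyc_inv n p (fd t 14) (fd t 15) \<and> (\<forall>u<rg t 4. fd t 15 u = 1) \<and>
    (\<forall>f. f \<notin> {14, 15} \<longrightarrow> fd t f = fd s f) \<and> rg t 0 = rg s 0 \<and> rg t 3 = rg s 3 \<and>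
    C + (n - rg t 4) + 2 * card {u \<in> {..<n}. fd t 15 u = 0} \<le> k"
  have "wp D (While (Df (Vr 4) (Vr 2)) (cyc_body ;; Asg 4 (Sc (Vr 4)))) Q t k"
    if "?I t k" for t
  proof (rule wp_While[where I = ?I])
    show "?I t k" by (rule that)
  next
    fix t :: state and k assume i: "?I t k"
    {
      assume "ev (Df (Vr 4) (Vr 2)) t = 0"
      then have "rg t 4 = n" using i by simp
      then show "Q t k"
        using i r unfolding cyc_inv_def by (intro Q) auto
    next
      assume "ev (Df (Vr 4) (Vr 2)) t \<noteq> 0"
      then have lt: "rg t 4 < n" using i by auto
      then obtain m where m: "k = Suc m" using i by (cases k) auto
      have "wp D cyc_body (wp D (Asg 4 (Sc (Vr 4))) ?I) t m"
      proof (rule wp_frame)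
        show "wp D cyc_body (\<lambda>u k'. cyc_inv n p (fd u 14) (fd u 15) \<and> fd u 15 (rg t 4) = 1 \<and>
            (\<forall>x. fd t 15 x = 1 \<longrightarrow> fd u 15 x = 1) \<and>
            C + (n - Suc (rg t 4)) + 2 * card {x \<in> {..<n}. fd u 15 x = 0} \<le> k') t m"
        proof (rule cyc_body[OF p _ lt refl, where C = "C + (n - Suc (rg t 4))"])
          show "fd t 13 u = p u" if "u < n" for u using i sg[OF that] by simp
          show "C + (n - Suc (rg t 4)) + 2 * card {u \<in> {..<n}. fd t 15 u = 0} \<le> m"
            using i lt m by linarith
        qed (use i in auto)
        fix u :: state and k'
        assume 1: "cyc_inv n p (fd u 14) (fd u 15) \<and> fd u 15 (rg t 4) = 1 \<and>
            (\<forall>x. fd t 15 x = 1 \<longrightarrow> fd u 15 x = 1) \<and>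
            C + (n - Suc (rg t 4)) + 2 * card {x \<in> {..<n}. fd u 15 x = 0} \<le> k'"
          and 2: "\<And>f. f \<notin> wflds cyc_body \<Longrightarrow> fd u f = fd t f" "\<And>x. x \<notin> wvars cyc_body \<Longrightarrow> rg u x = rg t x"
        have fr: "rg u 0 = rg t 0" "rg u 2 = rg t 2" "rg u 3 = rg t 3" "rg u 4 = rg t 4"
          "\<And>f. f \<notin> {14, 15} \<Longrightarrow> fd u f = fd t f"
          using 2 by (simp_all add: cyc_body_def alt_body_def one_body_def)
        show "wp D (Asg 4 (Sc (Vr 4))) ?I u k'"
          using 1 i lt fr by (simp add: wp_simps less_Suc_eq)
      qed
      then show "0 < k \<and> wp D (cyc_body ;; Asg 4 (Sc (Vr 4))) ?I t (k - 1)"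
        by (simp add: m wp_simps)
    }
  qed simp
  moreover have "cyc_inv n p (fd s 14) (fd s 15)" by (simp add: cyc_inv_def vs)
  ultimately show ?thesis unfolding cyc_prog_def using r k vs by (simp add: wp_simps)
qed

section \<open>Writing the output\<close>

definition out_body :: com where
  "out_body = Asg 5 (Ld 3 (Vr 4)) ;; Asg 6 (Ld 2 (Vr 4)) ;; Asg 7 (Nm 0) ;;
     Cond (Df (Ld 13 (Vr 5)) (Vr 6)) Skip (Asg 7 (Ld 14 (Vr 5))) ;;
     Cond (Df (Ld 13 (Vr 6)) (Vr 5)) Skip (Cond (Vr 7) Skip (Asg 7 (Ld 14 (Vr 6)))) ;;
     Sto 0 (Vr 4) (Vr 7)"

text \<open>The result overwrites the adjacency lists in place; neighbours and owners are read from
  their copies in fields 2 and 3.\<close>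

definition out_prog :: com where
  "out_prog = Asg 4 (Vr 0) ;; While (Df (Vr 4) (Vr 3)) (out_body ;; Asg 4 (Sc (Vr 4)))"

text \<open>\<open>edge_val\<close> without an addition: if \<open>p\<close> swaps the two nodes,
  one of their values is 0 and the other one is taken.\<close>

definition out_val :: "(nat \<Rightarrow> nat) \<Rightarrow> (nat \<Rightarrow> nat) \<Rightarrow> nat \<Rightarrow> nat \<Rightarrow> nat" where
  "out_val sg val v u = (let t = (if sg v = u then val v else 0) in
     if sg u = v \<and> t = 0 then val u else t)"

lemma out_prog:
  assumes r: "rg s 0 = L" "rg s 3 = E" "L \<le> E" and D: "E = D" and k: "K + (E - L) \<le> k"
    and Q: "\<And>u k'. (\<And>p. L \<le> p \<Longrightarrow> p < E \<Longrightarrow> fd u 0 p = out_val (fd s 13) (fd s 14) (fd s 3 p) (fd s 2 p)) \<Longrightarrow>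
      rg u 0 = L \<Longrightarrow> K \<le> k' \<Longrightarrow> Q u k'"
  shows "wp D out_prog Q s k"
proof -
  let ?I = "\<lambda>p t. (\<forall>q. L \<le> q \<longrightarrow> q < p \<longrightarrow> fd t 0 q = out_val (fd s 13) (fd s 14) (fd s 3 q) (fd s 2 q)) \<and>
    (\<forall>f. f \<noteq> 0 \<longrightarrow> fd t f = fd s f) \<and> rg t 0 = L"
  have "wp D (While (Df (Vr 4) (Vr 3)) (out_body ;; Asg 4 (Sc (Vr 4)))) Q t k"
    if t: "?I L t" "rg t 4 = L" "rg t 3 = E" for t :: state
  proof (rule wp_for[where I = ?I and L = L and E = E and K = K])
    fix p k and t :: state assume p: "L \<le> p" "p < E" "rg t 4 = p" "rg t 3 = E" and I: "?I p t"
    show "wp D out_body (\<lambda>s' k'. k' = k \<and> rg s' 4 = p \<and> rg s' 3 = E \<and> ?I (Suc p) s') t k"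
      unfolding out_body_def using p I D
      by (simp add: wp_simps) (auto simp: out_val_def less_Suc_eq)
  qed (use t r k Q in auto)
  then show ?thesis unfolding out_prog_def using r by (simp add: wp_simps)
qed

section \<open>The algorithm on the RAM\<close>

text \<open>With weights 0 and 3 and node sums 3, exactly one half-edge at each node of the double
  cover is selected. Nodes on the side of \<open>S\<close> give the ways out. Their copies give the
  ways in, because \<open>p + m\<close> has the weight of its reverse half-edge
  \<open>tw p\<close>.\<close>

lemma (in slots) walk_result:
  assumes S: "S = {L..<E}" "L \<le> E" and m: "m = E - L" and c: "contr nx w cl" and d: "double_inv L m nx w E F"
  defines "H \<equiv> {p \<in> S. w p = 1} \<union> (\<lambda>p. p + m) ` {p \<in> S. w p = 1}"
  assumes bal: "cubic_bip.balanced H (F 5) (F 10) w'" and v: "\<And>p. w' p \<in> {0, 3}"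
    and out: "\<And>p. p \<notin> H \<Longrightarrow> w' p = 0" and M: "M = (\<lambda>q. q \<in> S \<and> w' q \<noteq> 0)"
  shows "\<And>p. M p \<Longrightarrow> p \<in> S \<and> w p = 1" "\<And>p. M p \<Longrightarrow> \<not> M (nx p) \<and> \<not> M (nx (nx p))"
    "\<And>p. p \<in> S \<Longrightarrow> w p = 1 \<Longrightarrow> M p \<or> M (nx p) \<or> M (nx (nx p))"
    "\<And>p. p \<in> S \<Longrightarrow> w p = 1 \<Longrightarrow> M (tw p) \<or> M (tw (nx p)) \<or> M (tw (nx (nx p)))"
proof -
  interpret cubic_bip H "F 5" "F 10" "\<lambda>h. h \<in> S"
    unfolding H_def by (rule cubic_bip_double(1)[OF S m c d])
  show Mw: "p \<in> S \<and> w p = 1" if "M p" for p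
  proof -
    have "p \<in> S" using that unfolding M by blast
    moreover have "p \<in> H" using that out[of p] unfolding M by (cases "p \<in> H") auto
    moreover have "p \<noteq> q + m" if "q \<in> S" for q using \<open>p \<in> S\<close> that S m by auto
    ultimately show ?thesis unfolding H_def by auto
  qed
  have b: "w' (F 10 h) = w' h" "w' h + w' (F 5 h) + w' (F 5 (F 5 h)) = 3" if "h \<in> H" for h
    using bal that unfolding balanced_def osum_def by auto
  have o1: "nx p \<in> S" "w (nx p) = 1" "nx (nx p) \<in> S" "w (nx (nx p)) = 1" if "p \<in> S" "w p = 1" for p
  proof -
    note 1 = contr_orbit(1,2)[OF c that]
    show "nx p \<in> S" "w (nx p) = 1" "nx (nx p) \<in> S" "w (nx (nx p)) = 1"
      using 1 contr_orbit(1,2)[OF c 1] by blast+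
  qed
  have F5: "F 5 p = nx p" if "p \<in> S" for p
    using d[unfolded double_inv_def, THEN conjunct1] that by simp
  have F5m: "F 5 (p + m) = nx p + m" "F 10 (p + m) = tw p" if "p \<in> S" "w p = 1" for p
  proof -
    have "p < E" using that S by simp
    then show "F 5 (p + m) = nx p + m" "F 10 (p + m) = tw p" 
      using d[unfolded double_inv_def, THEN conjunct2, THEN conjunct1, rule_format, OF that(1) _ that(2)]
      by simp_all
  qed
  have s: "w' p + w' (nx p) + w' (nx (nx p)) = 3" if "p \<in> S" "w p = 1" for p
  proof -
    have "p \<in> H" using that by (simp add: H_def)
    from b(2)[OF this] show ?thesis using F5 o1 that by simp
  qed
  have s': "w' (tw p) + w' (tw (nx p)) + w' (tw (nx (nx p))) = 3" if p: "p \<in> S" "w p = 1" for p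
  proof -
    have H: "q + m \<in> H" if "q \<in> S" "w q = 1" for q using that by (simp add: H_def)
    have t: "w' (q + m) = w' (tw q)" if "q \<in> S" "w q = 1" for q
      using b(1)[OF H[OF that]] F5m(2)[OF that] by simp
    show ?thesis
      using b(2)[OF H[OF p]] F5m(1)[OF p] F5m(1)[OF o1(1,2)[OF p]] t[OF p] t[OF o1(1,2)[OF p]]
        t[OF o1(3,4)[OF p]] by simp
  qed
  show "\<not> M (nx p) \<and> \<not> M (nx (nx p))" if "M p" for p
  proof -
    have "w' p = 3" using that v[of p] by (auto simp: M)
    then show ?thesis using s[of p] Mw[OF that] by (auto simp: M)
  qed
  show "M p \<or> M (nx p) \<or> M (nx (nx p))" if "p \<in> S" "w p = 1" for p
    using s[OF that] o1[OF that] that by (auto simp: M)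
  show "M (tw p) \<or> M (tw (nx p)) \<or> M (tw (nx (nx p)))" if "p \<in> S" "w p = 1" for p
  proof -
    have "tw p \<in> S" "tw (nx p) \<in> S" "tw (nx (nx p)) \<in> S" using o1[OF that] that tw_in by auto
    then show ?thesis using s'[OF that] by (auto simp: M)
  qed
qed

section \<open>Putting the phases together\<close>

definition main_prog :: com where
  "main_prog = init_prog ;; twin_prog ;; tri_prog ;; double_prog ;; walk_prog ;; sig_prog ;; cyc_prog ;;
     out_prog"

text \<open>The budget: \<open>n\<close> for reading the nodes, \<open>3 * n\<close> each for
  reverse slots, triangles and double cover, \<open>E + 28 * card H\<close> for the walk, which is
  at most \<open>172 * n + 2\<close> since \<open>card H\<close> is at most \<open>6 * n\<close>,
  and \<open>3 * n\<close> each for permutation, cycle values and output. Every \<open>K\<close> and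
  \<open>C\<close> is what the later phases still need.\<close>

lemma main_prog:
  assumes raw: "fd s 0 = raw" "raw 0 = n" "raw (Suc n) = 4 * n + 2"
    and z: "\<And>f. f \<noteq> 0 \<Longrightarrow> fd s f = (\<lambda>_. 0)" and D: "D = 4 * n + 2"
    and lt: "\<And>u i. u < n \<Longrightarrow> i < 3 \<Longrightarrow> raw (n + 2 + 3 * u + i) < n \<and> raw (n + 2 + 3 * u + i) \<noteq> u"
    and inj: "\<And>u i j. u < n \<Longrightarrow> i < 3 \<Longrightarrow> j < 3 \<Longrightarrow> raw (n + 2 + 3 * u + i) = raw (n + 2 + 3 * u + j) \<Longrightarrow> i = j"
    and sym: "\<And>u i. u < n \<Longrightarrow> i < 3 \<Longrightarrow> \<exists>j<3. raw (n + 2 + 3 * raw (n + 2 + 3 * u + i) + j) = u"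
    and k: "191 * n + 2 \<le> k"
    and Q: "\<And>u k' p val. p permutes {..<n} \<Longrightarrow> (\<And>v. v < n \<Longrightarrow> \<exists>i<3. raw (n + 2 + 3 * v + i) = p v) \<Longrightarrow>
      (\<And>v. v < n \<Longrightarrow> p (p (p v)) \<noteq> v) \<Longrightarrow>
      (\<And>v. v < n \<Longrightarrow> val v + val (p v) = 2 \<and> (val v = 1 \<longrightarrow> odd (period p v))) \<Longrightarrow>
      (\<And>v i. v < n \<Longrightarrow> i < 3 \<Longrightarrow>
        fd u 0 (n + 2 + 3 * v + i) = out_val p val v (raw (n + 2 + 3 * v + i))) \<Longrightarrow>
      rg u 0 = n + 2 \<Longrightarrow> Q u k'"
  shows "wp D main_prog Q s k"
  unfolding main_prog_def
proof (rule wp_Seq, rule init_prog[OF raw z D, where K = "190 * n + 2"])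
  show "190 * n + 2 + n \<le> k" using k by simp
next
  fix s1 :: state and k1
  assume i1: "init_inv n raw n (fd s1)" and r1: "rg s1 0 = n + 2" "rg s1 2 = n" "rg s1 3 = 4 * n + 2"
    and f1: "\<And>f. f \<notin> {2, 3, 4, 5, 7, 8} \<Longrightarrow> fd s1 f = fd s f" and k1: "190 * n + 2 \<le> k1"
  define L E m where "L = n + 2" and "E = 4 * n + 2" and "m = E - L"
  define S where "S = {L..<E}"
  have m3: "m = 3 * n" "L \<le> E" by (simp_all add: m_def L_def E_def)
  have cS: "card S = 3 * n" by (simp add: S_def L_def E_def)
  show "wp D (twin_prog ;; tri_prog ;; double_prog ;; walk_prog ;; sig_prog ;; cyc_prog ;; out_prog) Q s1 k1"
  proof (rule wp_Seq, rule twin_prog[where L = L and E = E and K = "187 * n + 2"])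
    show "rg s1 0 = L" "rg s1 3 = E" "L \<le> E" using r1 by (simp_all add: L_def E_def)
    show "187 * n + 2 + (E - L) \<le> k1" using k1 by (simp add: L_def E_def)
  next
    fix s2 :: state and k2
    assume f2: "\<And>f. f \<noteq> 6 \<Longrightarrow> fd s2 f = fd s1 f" and r2: "rg s2 0 = L" "rg s2 2 = rg s1 2" "rg s2 3 = E"
      and tw: "\<And>p. L \<le> p \<Longrightarrow> p < E \<Longrightarrow> fd s2 6 p = find (fd s1 2) (fd s1 3 p) (fd s1 4 (fd s1 2 p))"
      and k2: "187 * n + 2 \<le> k2"
    define nb ow where "nb = fd s1 2" and "ow = fd s1 3"
    interpret slots n S ow nb "fd s1 5" "fd s2 6"
      unfolding S_def L_def E_def nb_def ow_def
      by (rule slots_intro[OF i1 lt inj sym tw]) (auto simp: L_def E_def)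
    have ii: "nb (L + 3 * v + i) = raw (L + 3 * v + i)" "ow (L + 3 * v + i) = v"
      "fd s1 7 (L + 3 * v + i) = L + 3 * v + i + m" if "v < n" "i < 3" for v i
      using i1 that unfolding init_inv_def L_def m3 nb_def ow_def Let_def by auto
    have dec: "\<exists>v<n. \<exists>i<3. q = L + 3 * v + i" if "q \<in> S" for q
    proof -
      have "q = L + 3 * ((q - L) div 3) + (q - L) mod 3" "(q - L) div 3 < n"
        using that by (auto simp: S_def L_def E_def less_mult_imp_div_less)
      then show ?thesis by (metis mod_less_divisor zero_less_numeral)
    qed
    have enc: "L + 3 * v + i \<in> S" if "v < n" "i < 3" for v i using that by (auto simp: S_def L_def E_def)
    have w1: "fd s1 8 p = of_bool (p \<in> S)" for p
      using i1 by (auto simp: init_inv_def S_def L_def E_def)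
    have t0: "tri_inv L (fd s2)"
      unfolding tri_inv_def
    proof (intro conjI allI ballI impI)
      have "fd s2 9 = (\<lambda>_. 0)" using f2[of 9] f1[of 9] z[of 9] by simp
      then show "contr (fd s2 5) (fd s2 8) (fd s2 9)"
        using contr_init[of "fd s2 8" "fd s2 5"] f2[of 5] f2[of 8] w1 by simp
      show "fd s2 8 q = 0" if "q \<notin> S" for q using that f2[of 8] w1 by simp
      show "\<not> adj (nb q) (nb (fd s1 5 q))" if "q \<in> S" "q < L" for q using that by (simp add: S_def)
    qed
    show "wp D (tri_prog ;; double_prog ;; walk_prog ;; sig_prog ;; cyc_prog ;; out_prog) Q s2 k2"
    proof (rule wp_Seq, rule tri_prog[OF S_def m3(2) t0, where K = "184 * n + 2"])
      show "fd s2 2 = nb" "fd s2 3 = ow" using f2 by (simp_all add: nb_def ow_def)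
      show "184 * n + 2 + (E - L) \<le> k2" using k2 m3 m_def by simp
      show "rg s2 0 = L" "rg s2 3 = E" by (fact r2)+
    next
      fix s3 :: state and k3
      assume c: "contr (fd s3 5) (fd s3 8) (fd s3 9)" and mx: "maximal (fd s3 9)"
        and o3: "\<And>q. q \<notin> S \<Longrightarrow> fd s3 8 q = 0" and f3: "\<And>f. f \<notin> {5, 8, 9} \<Longrightarrow> fd s3 f = fd s2 f"
        and r3: "\<And>x. x \<in> {0, 2, 3} \<Longrightarrow> rg s3 x = rg s2 x" and k3: "184 * n + 2 \<le> k3"
      show "wp D (double_prog ;; walk_prog ;; sig_prog ;; cyc_prog ;; out_prog) Q s3 k3"
      proof (rule wp_Seq, rule double_prog[OF S_def m3(2) m_def c o3, where K = "181 * n + 2"])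
        show "fd s3 7 q = q + m" if q: "q \<in> S" for q
          using dec[OF q] ii(3) f3[of 7] f2[of 7] by auto
        show "fd s3 6 q = fd s2 6 q" for q using f3[of 6] by simp
        show "rg s3 0 = L" "rg s3 3 = E" using r3 r2 by auto
        show "181 * n + 2 + (E - L) \<le> k3" using k3 m3 m_def by simp
      next
        fix s4 :: state and k4
        assume d: "double_inv L m (fd s3 5) (fd s3 8) E (fd s4)"
          and f4: "\<And>f. f \<notin> {5, 8, 10} \<Longrightarrow> fd s4 f = fd s3 f"
          and r4: "\<And>x. x \<in> {0, 2, 3} \<Longrightarrow> rg s4 x = rg s3 x" and k4: "181 * n + 2 \<le> k4"
        define H where "H = {p \<in> S. fd s3 8 p = 1} \<union> (\<lambda>p. p + m) ` {p \<in> S. fd s3 8 p = 1}"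
        note cb = cubic_bip_double[OF S_def m3(2) m_def c d, folded H_def]
        have z4: "fd s4 f = (\<lambda>_. 0)" if "f \<in> {11, 13, 14, 15}" for f
          using that f4[of f] f3[of f] f2[of f] f1[of f] z[of f] by auto
        have cov: "(L \<le> h \<and> h < E) \<or> (L \<le> fd s4 10 h \<and> fd s4 10 h < E)" if "h \<in> H" for h
        proof (cases "h \<in> S")
          case True
          then show ?thesis by (simp add: S_def)
        next
          case False
          then obtain q where q: "q \<in> S" "fd s3 8 q = 1" "h = q + m" using \<open>h \<in> H\<close> by (auto simp: H_def)
          then have "q < E" by (simp add: S_def)
          then have "fd s4 10 h = fd s2 6 q"
            using d[unfolded double_inv_def, THEN conjunct2, THEN conjunct1, rule_format, OF q(1) _ q(2)] q(3)
            by simp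
          then show ?thesis using tw_in[OF q(1)] by (simp add: S_def)
        qed
        have walk: "wp D walk_prog (\<lambda>t k'. cubic_bip.balanced H (fd s4 5) (fd s4 10) (fd t 8) \<and>
            (\<forall>p. fd t 8 p \<in> {0, 3}) \<and> (\<forall>p. p \<notin> H \<longrightarrow> fd t 8 p = 0) \<and> 9 * n \<le> k') s4 k4"
        proof (rule cubic_bip.walk_prog_correct[OF cb(1) refl refl cb(3,4), where K = "9 * n"])
          show "fd s4 11 h = 0" for h using z4[of 11] by simp
          show "rg s4 0 = L" "rg s4 3 = E" using r4 r3 r2 by auto
          show "L \<le> E" by (fact m3)
          show "9 * n + E + 28 * card H \<le> k4" using k4 cb(2) cS by (simp add: E_def)
        qed (use cov in auto)
        show "wp D (walk_prog ;; sig_prog ;; cyc_prog ;; out_prog) Q s4 k4"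
        proof (rule wp_Seq, rule wp_frame[OF walk])
          fix s5 :: state and k5
          assume w5: "cubic_bip.balanced H (fd s4 5) (fd s4 10) (fd s5 8) \<and>
            (\<forall>p. fd s5 8 p \<in> {0, 3}) \<and> (\<forall>p. p \<notin> H \<longrightarrow> fd s5 8 p = 0) \<and> 9 * n \<le> k5"
            and fr5: "\<And>f. f \<notin> wflds walk_prog \<Longrightarrow> fd s5 f = fd s4 f"
              "\<And>x. x \<notin> wvars walk_prog \<Longrightarrow> rg s5 x = rg s4 x"
          have f5: "fd s5 f = fd s4 f" if "f \<notin> {8, 11, 12}" for f
            using that by (intro fr5(1)) (simp add: walk_prog_def step_prog_def start_prog_def cancel_prog_def
                push_prog_def sum_body_def flip_body_def)
          have r5: "rg s5 x = rg s4 x" if "x \<in> {0, 2, 3}" for x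
            using that by (intro fr5(2)) (auto simp: walk_prog_def step_prog_def start_prog_def cancel_prog_def
                push_prog_def sum_body_def flip_body_def)
          define M where "M = (\<lambda>q. q \<in> S \<and> fd s5 8 q \<noteq> 0)"
          note wr = walk_result[OF S_def m3(2) m_def c d, folded H_def, of "fd s5 8", OF _ _ _ M_def]
          have Mw: "\<And>p. M p \<Longrightarrow> p \<in> S \<and> fd s3 8 p = 1"
            and uniq: "\<And>p. M p \<Longrightarrow> \<not> M (fd s3 5 p) \<and> \<not> M (fd s3 5 (fd s3 5 p))"
            and out: "\<And>p. p \<in> S \<Longrightarrow> fd s3 8 p = 1 \<Longrightarrow> M p \<or> M (fd s3 5 p) \<or> M (fd s3 5 (fd s3 5 p))"
            and inn: "\<And>p. p \<in> S \<Longrightarrow> fd s3 8 p = 1 \<Longrightarrow> M (fd s2 6 p) \<or> M (fd s2 6 (fd s3 5 p)) \<or>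
              M (fd s2 6 (fd s3 5 (fd s3 5 p)))"
            using wr w5 by blast+
          show "wp D (sig_prog ;; cyc_prog ;; out_prog) Q s5 k5"
          proof (rule wp_Seq, rule sig_prog[OF S_def m3(2) c _ _ _ _ _ M_def, where K = "6 * n"])
            show "fd s5 2 = nb" using f5[of 2] f4[of 2] f3[of 2] f2[of 2] by (simp add: nb_def)
            show "fd s5 3 = ow" using f5[of 3] f4[of 3] f3[of 3] f2[of 3] by (simp add: ow_def)
            show "fd s5 5 q = fd s3 5 q" if "q \<in> S" for q
              using f5[of 5] d[unfolded double_inv_def, THEN conjunct1] that by simp
            show "fd s5 6 q = fd s2 6 q" for q using f5[of 6] f4[of 6] f3[of 6] by simp
            show "fd s5 9 = fd s3 9" using f5[of 9] f4[of 9] by simp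
            show "rg s5 0 = L" "rg s5 3 = E" using r5 r4 r3 r2 by auto
            show "6 * n + (E - L) \<le> k5" using w5 m3 m_def by simp
            show "fd s3 8 p = 1" if "M p" for p using Mw[OF that] by blast
            show "\<not> M (fd s3 5 p) \<and> \<not> M (fd s3 5 (fd s3 5 p))" if "M p" for p by (rule uniq[OF that])
          next
            fix s6 :: state and k6
            assume sg: "\<And>p. M p \<Longrightarrow> sig_spec (fd s3 5) (fd s3 9) M (fd s6 13) p"
              and f6: "\<And>f. f \<noteq> 13 \<Longrightarrow> fd s6 f = fd s5 f"
              and r6: "\<And>x. x \<in> {0, 2, 3} \<Longrightarrow> rg s6 x = rg s5 x" and k6: "6 * n \<le> k6"
            note sig0 = sigma[OF c mx, where M = M and sg = "fd s6 13"]
            have sig: "\<And>v. v < n \<Longrightarrow> adj v (fd s6 13 v)" "fd s6 13 ` {..<n} = {..<n}"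
              "\<And>v. v < n \<Longrightarrow> fd s6 13 (fd s6 13 (fd s6 13 v)) \<noteq> v"
              by (rule sig0; (rule out inn Mw sg | assumption); assumption)+
            \<comment> \<open>Field 13 is arbitrary beyond the nodes, while \<open>permutes\<close>
              demands the identity there.\<close>
            define p where "p v = (if v < n then fd s6 13 v else v)" for v
            have bij: "bij_betw p {..<n} {..<n}"
            proof -
              have "bij_betw (fd s6 13) {..<n} {..<n}"
                using sig(2) by (auto simp: bij_betw_def intro: eq_card_imp_inj_on)
              then show ?thesis by (rule bij_betw_cong[THEN iffD1, rotated]) (simp add: p_def)
            qed
            have perm: "p permutes {..<n}"
              by (rule bij_imp_permutes[OF bij]) (simp add: p_def)
            have pn: "p v < n" if "v < n" for v using permutes_in_image[OF perm, of v] that by simp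
            show "wp D (cyc_prog ;; out_prog) Q s6 k6"
            proof (rule wp_Seq, rule cyc_prog[OF perm, where C = "3 * n"])
              show "fd s6 13 u = p u" if "u < n" for u using that by (simp add: p_def)
              show "rg s6 2 = n" using r6 r5 r4 r3 r2 r1 by simp
              show "fd s6 15 = (\<lambda>_. 0)" using f6[of 15] f5[of 15] z4[of 15] by simp
              show "3 * n + 3 * n \<le> k6" using k6 by simp
            next
              fix s7 :: state and k7
              assume val: "\<And>v. v < n \<Longrightarrow> fd s7 14 v + fd s7 14 (p v) = 2 \<and>
                  (fd s7 14 v = 1 \<longrightarrow> odd (period p v))"
                and f7: "\<And>f. f \<notin> {14, 15} \<Longrightarrow> fd s7 f = fd s6 f"
                and r7: "\<And>x. x \<in> {0, 2, 3} \<Longrightarrow> rg s7 x = rg s6 x" and k7: "3 * n \<le> k7"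
              have F7: "fd s7 2 = nb" "fd s7 3 = ow" "fd s7 13 = fd s6 13"
                using f7[of 2] f6[of 2] f5[of 2] f4[of 2] f3[of 2] f2[of 2]
                  f7[of 3] f6[of 3] f5[of 3] f4[of 3] f3[of 3] f2[of 3] f7[of 13]
                by (simp_all add: nb_def ow_def)
              show "wp D out_prog Q s7 k7"
              proof (rule out_prog[where L = L and E = E and K = 0])
                show "rg s7 0 = L" "rg s7 3 = E" using r7 r6 r5 r4 r3 r2 by auto
                show "L \<le> E" "E = D" using m3 D by (simp_all add: E_def)
                show "0 + (E - L) \<le> k7" using k7 m3 m_def by simp
              next
                fix u :: state and k'
                assume u: "\<And>q. L \<le> q \<Longrightarrow> q < E \<Longrightarrow>
                  fd u 0 q = out_val (fd s7 13) (fd s7 14) (fd s7 3 q) (fd s7 2 q)" and u0: "rg u 0 = L"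
                show "Q u k'"
                proof (rule Q[of p "fd s7 14"])
                  show "p permutes {..<n}" by (rule perm)
                  show "rg u 0 = n + 2" using u0 by (simp add: L_def)
                  show "\<exists>i<3. raw (n + 2 + 3 * v + i) = p v" if v: "v < n" for v
                  proof -
                    obtain q where q: "q \<in> S" "ow q = v" "nb q = p v"
                      using sig(1)[OF v] v by (auto simp: adj_def p_def)
                    obtain v' i where "v' < n" "i < 3" "q = L + 3 * v' + i" using dec[OF q(1)] by blast
                    then show ?thesis using ii q by (auto simp: L_def)
                  qed
                  show "p (p (p v)) \<noteq> v" if v: "v < n" for v
                    using sig(3)[OF v] v pn[OF v] pn[OF pn[OF v]] by (simp add: p_def split: if_splits)
                  show "fd s7 14 v + fd s7 14 (p v) = 2 \<and> (fd s7 14 v = 1 \<longrightarrow> odd (period p v))" if "v < n" for v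
                    by (rule val[OF that])
                  show "fd u 0 (n + 2 + 3 * v + i) = out_val p (fd s7 14) v (raw (n + 2 + 3 * v + i))"
                    if v: "v < n" "i < 3" for v i
                  proof -
                    have "L \<le> L + 3 * v + i" "L + 3 * v + i < E" using enc[OF v] by (auto simp: S_def)
                    from u[OF this]
                    have "fd u 0 (L + 3 * v + i) = out_val (fd s6 13) (fd s7 14) v (raw (L + 3 * v + i))"
                      using ii[OF v] F7 by simp
                    moreover have "fd s6 13 v = p v" "fd s6 13 (raw (L + 3 * v + i)) = p (raw (L + 3 * v + i))"
                      using lt[OF v] v by (simp_all add: p_def L_def)
                    ultimately show ?thesis by (simp add: out_val_def L_def)
                  qed
                qed
              qed
            qed
          qed
        qed
      qed
    qed simp
  qed
qed auto

section \<open>The encoding of cubic graphs\<close>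

lemma concat_nth_3:
  "(\<And>xs. xs \<in> set xss \<Longrightarrow> length xs = 3) \<Longrightarrow> v < length xss \<Longrightarrow> i < 3 \<Longrightarrow>
    concat xss ! (3 * v + i) = xss ! v ! i"
proof (induction xss arbitrary: v)
  case (Cons xs xss)
  then show ?case by (cases v) (auto simp: nth_append)
qed simp

lemma length_concat_3: "(\<And>xs. xs \<in> set xss \<Longrightarrow> length xs = 3) \<Longrightarrow> length (concat xss) = 3 * length xss"
  by (induction xss) auto

text \<open>Pairing \<open>v\<close> with the entries of its list is a bijection onto the edges at
  \<open>v\<close>.\<close>

lemma adjacency_length:
  assumes g: "graph V E" and r: "regular 3 V E" and a: "adjacency_lists V E adj" and v: "v \<in> V"
  shows "length (adj ! v) = 3"
proof -
  have d: "distinct (adj ! v)" "set (adj ! v) = {u. {v, u} \<in> E}"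
    using a v by (auto simp: adjacency_lists_def)
  have "incident E v = (\<lambda>u. {v, u}) ` set (adj ! v)"
  proof
    show "incident E v \<subseteq> (\<lambda>u. {v, u}) ` set (adj ! v)"
    proof
      fix e assume "e \<in> incident E v"
      then have e: "e \<in> E" "v \<in> e" "card e = 2" using g by (auto simp: incident_def graph_def)
      then obtain x y where "e = {x, y}" by (auto simp: card_2_iff)
      then obtain u where "e = {v, u}" using e(2) by auto
      then show "e \<in> (\<lambda>u. {v, u}) ` set (adj ! v)" using e(1) d(2) by auto
    qed
  qed (auto simp: d(2) incident_def)
  moreover have "inj_on (\<lambda>u. {v, u}) (set (adj ! v))" by (auto simp: inj_on_def doubleton_eq_iff)
  ultimately have "card (incident E v) = card (set (adj ! v))" by (simp add: card_image)
  then show ?thesis using r v distinct_card[OF d(1)] by (simp add: regular_def)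
qed

lemma list_pos_3:
  "(\<And>u. u < length adj \<Longrightarrow> length (adj ! u) = 3) \<Longrightarrow> v \<le> length adj \<Longrightarrow> list_pos adj v = 3 * v"
  by (simp add: list_pos_def)

lemma encode_3:
  assumes "\<And>u. u < length adj \<Longrightarrow> length (adj ! u) = 3"
  shows "length (encode adj) = 4 * length adj + 2" "encode adj ! 0 = length adj"
    "\<And>v. v \<le> length adj \<Longrightarrow> encode adj ! Suc v = length adj + 2 + 3 * v"
    "\<And>v i. v < length adj \<Longrightarrow> i < 3 \<Longrightarrow> encode adj ! (length adj + 2 + 3 * v + i) = adj ! v ! i"
proof -
  have l: "length xs = 3" if "xs \<in> set adj" for xs
    using that assms by (auto simp: in_set_conv_nth)
  show "length (encode adj) = 4 * length adj + 2"
    using length_concat_3[of adj] l by (simp add: encode_def)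
  show "encode adj ! 0 = length adj" by (simp add: encode_def)
  show "encode adj ! Suc v = length adj + 2 + 3 * v" if "v \<le> length adj" for v
    using that list_pos_3[OF assms that]
    by (simp add: encode_def nth_append del: upt_Suc)
  show "encode adj ! (length adj + 2 + 3 * v + i) = adj ! v ! i" if "v < length adj" "i < 3" for v i
    using concat_nth_3[of adj v i] l that
    by (simp add: encode_def nth_append del: upt_Suc)
qed

section \<open>The RAM program and its bounds\<close>

definition start_code :: "instr list" where
  "start_code = [Load 3 3, Add 1 3 3, Add 1 1 1, Const 3 2, Add 1 1 3]"

definition final_code :: "instr list" where
  "final_code = start_code @ cc 5 main_prog @ [Halt]"

text \<open>The prologue computes the input length \<open>D\<close>, four times \<open>n\<close>
  plus 2, into register 1. Its only other target is the temporary register 3, so all variables are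
  still 0.\<close>

lemma start_code:
  assumes "reg c = (\<lambda>_. 0)" "pc c = 0" "mem c 0 = n" "4 * n + 2 < W"
  shows "\<exists>c'. run W final_code 5 c = Some c' \<and> pc c' = 5 \<and> mem c' = mem c \<and> reg c' 1 = 4 * n + 2 \<and>
    (\<forall>x. reg c' (2 * x) = 0)"
proof -
  have "code_at final_code 0 start_code"
    unfolding final_code_def by (rule code_at_nth_append[of "[]", simplified])
  moreover have "2 * x \<noteq> 3" "2 * x \<noteq> 1" for x :: nat by presburger+
  ultimately show ?thesis
    using assms by (simp add: start_code_def code_at_Cons eval_nat_numeral(2,3) step_def set_reg_def)
qed

text \<open>Only a 2-cycle is critical. Its period is even, so the values on it are not 1, and of
  two values with sum 2 one is 0.\<close>

lemma edge_val_out_val: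
  assumes "v \<noteq> u" "val v + val (p v) = 2" "val v = 1 \<longrightarrow> odd (period p v)" "p permutes V" "finite V"
  shows "edge_val p val {v, u} = out_val p val v u"
proof (cases "p v = u \<and> p u = v \<and> val v \<noteq> 0")
  case True
  have "val v \<noteq> 1"
  proof
    assume "val v = 1"
    then have o: "odd (period p v)" using assms(3) by simp
    have "(p ^^ 2) v = v" using True by (simp add: numeral_2_eq_2)
    then have "\<not> 2 < period p v" using period(3)[OF assms(4,5), of 2 v] by auto
    moreover have "period p v \<noteq> 1" using period(2)[OF assms(4,5), of v] True assms(1) by auto
    ultimately show False using o period(1)[OF assms(4,5), of v]
      by (metis One_nat_def dvd_refl less_2_cases linorder_neqE_nat nat_neq_iff)
  qed
  then have "val v = 2" "val u = 0" using True assms(2) by auto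
  then show ?thesis using True assms(1) by (simp add: edge_val_pair out_val_def)
next
  case False
  then show ?thesis using assms(1) by (auto simp: edge_val_pair out_val_def Let_def)
qed

lemma final_code_correct:
  assumes g: "graph V E" and reg: "regular 3 V E" and a: "adjacency_lists V E adj" and n: "n = length adj"
    and t: "t = sz main_prog * (191 * n + 3) + 5"
    and W: "4 * n + 2 + 16 * (4 * n + 2 + gr main_prog * (191 * n + 3)) + 16 < W"
  shows "\<exists>s x. halts_within W final_code t (initial adj) s \<and> outputs adj s x \<and>
    two_matching V E x \<and> basic E x \<and> perfect V E x \<and> triangle_free E x"
proof -
  have V: "V = {..<n}" using a by (simp add: adjacency_lists_def n)
  have len: "length (adj ! v) = 3" if "v < n" for v
    using adjacency_length[OF g reg a] that V by simp
  have adjE: "distinct (adj ! v)" "set (adj ! v) = {u. {v, u} \<in> E}" if "v < n" for v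
    using a that by (auto simp: adjacency_lists_def n)
  have E: "u < n \<and> v < n \<and> u \<noteq> v" if "{u, v} \<in> E" for u v
  proof -
    have "{u, v} \<subseteq> V" "card {u, v} = 2" using g that unfolding graph_def by blast+
    then have "u \<in> V" "v \<in> V" "u \<noteq> v" by auto
    then show ?thesis by (simp add: V)
  qed
  note enc = encode_3[of adj, folded n, OF len]
  define D where "D = 4 * n + 2"
  define raw where "raw = mem (initial adj)"
  have raw: "raw 0 = n" "raw (Suc n) = 4 * n + 2"
    "\<And>v i. v < n \<Longrightarrow> i < 3 \<Longrightarrow> raw (n + 2 + 3 * v + i) = adj ! v ! i" "\<And>x. D \<le> x \<Longrightarrow> raw x = 0"
    using enc by (simp_all add: raw_def initial_def D_def)
  have nbr: "adj ! v ! i < n" "adj ! v ! i \<noteq> v" "{v, adj ! v ! i} \<in> E" if "v < n" "i < 3" for v i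
  proof -
    have "adj ! v ! i \<in> set (adj ! v)" using len that by simp
    then show 1: "{v, adj ! v ! i} \<in> E" using adjE that by auto
    show "adj ! v ! i < n" "adj ! v ! i \<noteq> v" using E[OF 1] by auto
  qed
  have idx: "\<exists>j<3. adj ! v ! j = u" if "{v, u} \<in> E" for u v
  proof -
    have "v < n" using E[OF that] by simp
    then have "u \<in> set (adj ! v)" using adjE that by simp
    then show ?thesis using len[OF \<open>v < n\<close>] by (auto simp: in_set_conv_nth)
  qed
  \<comment> \<open>\<open>D\<close> bounds every initial value, which is where the growth bound of
    \<open>cc_sim\<close> starts.\<close>
  have raw_le: "raw x \<le> D" for x
  proof (cases "x < D")
    case True
    then have "raw x \<in> set (encode adj)" using enc(1) by (simp add: raw_def initial_def D_def)
    moreover have "set (encode adj) =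
        insert n ((\<lambda>v. n + 2 + list_pos adj v) ` {..n} \<union> set (concat adj))"
      unfolding encode_def n[symmetric] list.set set_append set_map set_upt
      by (simp only: atLeast0LessThan lessThan_Suc_atMost)
    ultimately consider "raw x = n" | v where "v \<le> n" "raw x = n + 2 + list_pos adj v"
      | "raw x \<in> set (concat adj)"
      by blast
    then show ?thesis
    proof cases
      case 2
      then show ?thesis using list_pos_3[of adj v] len by (simp add: D_def n)
    next
      case 3
      then obtain xs where "xs \<in> set adj" "raw x \<in> set xs" by auto
      then obtain v where "v < n" "raw x \<in> set (adj ! v)" by (metis in_set_conv_nth n)
      then have "raw x < n" using adjE E by blast
      then show ?thesis by (simp add: D_def)
    qed (simp add: D_def)
  qed (simp add: raw(4))
  define s0 where "s0 = \<lparr>rg = (\<lambda>_. 0), fd = (\<lambda>f. if f = 0 then raw else (\<lambda>_. 0))\<rparr>"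
  have fd0: "fd s0 0 = raw" "\<And>f. f \<noteq> 0 \<Longrightarrow> fd s0 f = (\<lambda>_. 0)" by (simp_all add: s0_def)
  obtain c1 where c1: "run W final_code 5 (initial adj) = Some c1" "pc c1 = 5" "mem c1 = raw"
    "reg c1 1 = D" "\<And>x. reg c1 (2 * x) = 0"
    using start_code[of "initial adj" n W] raw(1) W by (auto simp: initial_def raw_def D_def)
  have rep0: "rep D s0 c1"
    using c1 raw(4) by (auto simp: rep_def s0_def)
  have bnd0: "bnd D s0" using raw_le by (auto simp: bnd_def s0_def)
  have "wp D main_prog (\<lambda>u k'. rg u 0 = n + 2 \<and> (\<exists>p val. p permutes {..<n} \<and>
      (\<forall>v<n. \<exists>i<3. raw (n + 2 + 3 * v + i) = p v) \<and> (\<forall>v<n. p (p (p v)) \<noteq> v) \<and>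
      (\<forall>v<n. val v + val (p v) = 2 \<and> (val v = 1 \<longrightarrow> odd (period p v))) \<and>
      (\<forall>v<n. \<forall>i<3. fd u 0 (n + 2 + 3 * v + i) = out_val p val v (raw (n + 2 + 3 * v + i))))) s0 (191 * n + 2)"
  proof (rule main_prog[OF fd0(1) raw(1,2) fd0(2) D_def])
    fix u i assume ui: "u < n" "i < (3::nat)"
    show "raw (n + 2 + 3 * u + i) < n \<and> raw (n + 2 + 3 * u + i) \<noteq> u" using raw(3) nbr ui by simp
    have "{adj ! u ! i, u} \<in> E" using nbr(3)[OF ui] by (simp add: insert_commute)
    then show "\<exists>j<3. raw (n + 2 + 3 * raw (n + 2 + 3 * u + i) + j) = u"
      using idx[of "adj ! u ! i" u] raw(3) nbr(1)[OF ui] ui by auto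
  next
    fix u i j assume "u < n" "i < (3::nat)" "j < (3::nat)" "raw (n + 2 + 3 * u + i) = raw (n + 2 + 3 * u + j)"
    then show "i = j" using raw(3) adjE(1)[of u] len[of u] by (auto simp: nth_eq_iff_index_eq)
  next
    show "191 * n + 2 \<le> 191 * n + 2" by simp
  next
    fix u :: state and k' p val
    assume "p permutes {..<n}" "\<And>v. v < n \<Longrightarrow> \<exists>i<3. raw (n + 2 + 3 * v + i) = p v"
      "\<And>v. v < n \<Longrightarrow> p (p (p v)) \<noteq> v"
      "\<And>v. v < n \<Longrightarrow> val v + val (p v) = 2 \<and> (val v = 1 \<longrightarrow> odd (period p v))"
      "\<And>v i. v < n \<Longrightarrow> i < 3 \<Longrightarrow>
        fd u 0 (n + 2 + 3 * v + i) = out_val p val v (raw (n + 2 + 3 * v + i))" "rg u 0 = n + 2"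
    then show "rg u 0 = n + 2 \<and> (\<exists>p val. p permutes {..<n} \<and>
      (\<forall>v<n. \<exists>i<3. raw (n + 2 + 3 * v + i) = p v) \<and> (\<forall>v<n. p (p (p v)) \<noteq> v) \<and>
      (\<forall>v<n. val v + val (p v) = 2 \<and> (val v = 1 \<longrightarrow> odd (period p v))) \<and>
      (\<forall>v<n. \<forall>i<3. fd u 0 (n + 2 + 3 * v + i) = out_val p val v (raw (n + 2 + 3 * v + i))))"
      by (intro conjI exI[of _ p] exI[of _ val]) simp_all
  qed
  then obtain T u p val where big: "big D main_prog s0 T u" "T \<le> 191 * n + 2" and u0: "rg u 0 = n + 2"
    and p: "p permutes {..<n}" "\<And>v. v < n \<Longrightarrow> \<exists>i<3. raw (n + 2 + 3 * v + i) = p v"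
      "\<And>v. v < n \<Longrightarrow> p (p (p v)) \<noteq> v"
    and val: "\<And>v. v < n \<Longrightarrow> val v + val (p v) = 2" "\<And>v. v < n \<Longrightarrow> val v = 1 \<longrightarrow> odd (period p v)"
    and res: "\<And>v i. v < n \<Longrightarrow> i < 3 \<Longrightarrow> fd u 0 (n + 2 + 3 * v + i) = out_val p val v (raw (n + 2 + 3 * v + i))"
    unfolding wp_def by blast
  have len5: "length start_code = 5" by (simp add: start_code_def)
  have code: "code_at final_code 5 (cc 5 main_prog)" "code_at final_code (5 + sz main_prog) [Halt]"
    unfolding final_code_def
    using code_at_nth_append[of start_code "cc 5 main_prog" "[Halt]"]
      code_at_nth_append[of "start_code @ cc 5 main_prog" "[Halt]" "[]"]
    by (simp_all add: len5)
  have T: "1 + T \<le> 191 * n + 3" using big(2) by simp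
  have "gr main_prog * (1 + T) \<le> gr main_prog * (191 * n + 3)" using T by (rule mult_le_mono2)
  then have "D + 16 * (D + gr main_prog * (1 + T)) + 16 < W" using W by (simp add: D_def)
  from cc_sim[OF big(1) code(1) c1(2) rep0 bnd0 this] obtain k c2 where
    k: "k \<le> sz main_prog * (1 + T)" "run W final_code k c1 = Some c2" "pc c2 = 5 + sz main_prog" "rep D u c2"
    by blast
  have "sz main_prog * (1 + T) \<le> sz main_prog * (191 * n + 3)" using T by (rule mult_le_mono2)
  then have "5 + k \<le> t" using k(1) t by simp
  moreover have "halted final_code c2" using code(2) k(3) by (simp add: halted_def code_at_Cons)
  ultimately have hw: "halts_within W final_code t (initial adj) c2"
    unfolding halts_within_def using run_trans[OF c1(1) k(2)] by blast
  have r2: "reg c2 0 = n + 2" "\<And>x. x < D \<Longrightarrow> mem c2 x = fd u 0 x"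
    using k(4)[unfolded rep_def, THEN conjunct1, rule_format, of 0] u0 k(4) by (simp_all add: rep_def)
  have "outputs adj c2 (edge_val p val)"
    unfolding outputs_def n[symmetric]
  proof (intro allI impI)
    fix v i assume v: "v < n" "i < length (adj ! v)"
    then have i: "i < 3" using len by simp
    have "mem c2 (n + 2 + 3 * v + i) = out_val p val v (adj ! v ! i)"
      using r2(2)[of "n + 2 + 3 * v + i"] res[OF v(1) i] raw(3)[OF v(1) i] v(1) i by (simp add: D_def)
    also have "\<dots> = edge_val p val {v, adj ! v ! i}"
      using edge_val_out_val[of v "adj ! v ! i" val p "{..<n}"] nbr(2)[OF v(1) i] val v(1) p(1) by simp
    finally show "mem c2 (reg c2 0 + list_pos adj v + i) = edge_val p val {v, adj ! v ! i}"
      using r2(1) list_pos_3[of adj v] len v(1) by (simp add: n)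
  qed
  moreover have "cycle_cover V E p val"
  proof
    show "graph V E" by (rule g)
    show "p permutes V" using p(1) V by simp
    fix v assume "v \<in> V"
    then have v: "v < n" by (simp add: V)
    obtain i where i: "i < 3" "raw (n + 2 + 3 * v + i) = p v" using p(2)[OF v] by blast
    show "{v, p v} \<in> E" using raw(3)[OF v i(1)] nbr(3)[OF v i(1)] i(2) by simp
    show "p (p (p v)) \<noteq> v" by (rule p(3)[OF v])
    show "val v + val (p v) = 2" by (rule val(1)[OF v])
    show "val v = 1 \<Longrightarrow> odd (period p v)" using val(2)[OF v] by simp
  qed
  ultimately show ?thesis
    using hw cycle_cover.two_matching cycle_cover.basic cycle_cover.perfect cycle_cover.triangle_free by blast
qed

theorem theorem10:
  "\<exists>(P :: instr list) (c :: nat) (T :: nat \<Rightarrow> nat).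
     (\<lambda>n. real (T n)) \<in> O(\<lambda>n. real n) \<and>
     (\<forall>V E adj. graph V E \<and> regular 3 V E \<and> adjacency_lists V E adj \<longrightarrow>
        (\<exists>s x. halts_within ((card V + 2) ^ c) P (T (card V)) (initial adj) s \<and>
               outputs adj s x \<and>
               two_matching V E x \<and> basic E x \<and> perfect V E x \<and> triangle_free E x))"
proof -
  define G where "G = gr main_prog"
  \<comment> \<open>Chosen such that \<open>C * (n + 2)\<close> exceeds the largest address
    \<open>68 * n + 50 + 16 * G * (191 * n + 3)\<close> that has to be representable.\<close>
  define C where "C = 100 + 16 * G * 191"
  define T where "T n = sz main_prog * (191 * n + 3) + 5" for n
  have "(\<lambda>n. real (T n)) \<in> O(\<lambda>n. real n)"
  \<comment> \<open>For \<open>n \<ge> 1\<close> an affine function with nonnegative coefficients is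
    at most \<open>n\<close> times its value at 1.\<close>
  proof (rule bigoI[where c = "real (T 1)"])
    have "T n \<le> T 1 * n" if "n \<ge> 1" for n
    proof -
      have "sz main_prog * (191 * n + 3) \<le> sz main_prog * (194 * n)"
        using that by (intro mult_le_mono2) simp
      moreover have "T 1 * n = sz main_prog * (194 * n) + 5 * n" by (simp add: T_def algebra_simps)
      ultimately show ?thesis using that unfolding T_def by linarith
    qed
    then have "real (T n) \<le> real (T 1) * real n" if "n \<ge> 1" for n
      using that by (metis of_nat_le_iff of_nat_mult)
    then show "\<forall>\<^sub>F n in sequentially. norm (real (T n)) \<le> real (T 1) * norm (real n)"
      by (intro eventually_sequentiallyI[of 1]) simp
  qed
  moreover have "\<exists>s x. halts_within ((card V + 2) ^ (C + 1)) final_code (T (card V)) (initial adj) s \<and>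
      outputs adj s x \<and> two_matching V E x \<and> basic E x \<and> perfect V E x \<and> triangle_free E x"
    if g: "graph V E" "regular 3 V E" "adjacency_lists V E adj" for V E adj
  proof -
    define n where "n = length adj"
    have cV: "card V = n" using g(3) by (simp add: adjacency_lists_def n_def)
    have "4 * n + 2 + 16 * (4 * n + 2 + G * (191 * n + 3)) + 16 \<le> C * (n + 2)"
      by (simp add: C_def algebra_simps)
    \<comment> \<open>The constant factor is turned into an exponent, so the word bound is a fixed
      power of \<open>n + 2\<close>.\<close>
    also have "\<dots> < 2 ^ C * (n + 2)" by (intro mult_less_mono1 less_exp) simp
    also have "\<dots> \<le> (n + 2) ^ C * (n + 2)" by (intro mult_le_mono1 power_mono) auto
    finally have "4 * n + 2 + 16 * (4 * n + 2 + gr main_prog * (191 * n + 3)) + 16 < (n + 2) ^ (C + 1)"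
      by (simp add: G_def mult.commute)
    from final_code_correct[OF g n_def T_def this] show ?thesis by (simp add: cV)
  qed
  ultimately show ?thesis by blast
qed

end
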